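(* Let $X$ be any countable set of indeterminates. The following problem is decidable: given $n \ge 1$ and matrices $A, B \in M_{n\times n}(\mathbb{Q}(X))$, determine whether there exists $i \in \mathbb{N}$ such that $A^i = B$.
   Context: $\mathbb{N}$ includes $0$. $\mathbb{Q}(X)$ is the field of rational functions over $\mathbb{Q}$ in the (algebraically independent) indeterminates from $X$; each element involves only finitely many indeterminates. $M_{n\times n}(R)$ is the set of $n\times n$ matrices over a ring $R$. "Decidable" means that there is an algorithm (Turing machine) that halts on every input and answers correctly. Inputs are given exactly: the indeterminates are indexed by (an initial segment of) the natural numbers, and each element of $\mathbb{Q}(X)$ is encoded as a quotient of two polynomials with integer coefficients in finitely many indexed indeterminates. *)

theory Defs
  imports
    Jordan_Normal_Form.Matrix
    "HOL-Library.Poly_Mapping"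
    "HOL-Library.Nat_Bijection"
    "HOL-Computational_Algebra.Fraction_Field"
begin

section \<open>Turing machines and decidable sets\<close>

text \<open>
  Deterministic machines with a single two-way infinite tape.  States are the numbers below
  \<^term>\<open>states\<close>, symbols the numbers below \<^term>\<open>symbols\<close>; symbol 0 is the blank.
  The transition function is only ever consulted on these two finite sets, so that a machine is a
  finite object although \<^term>\<open>delta\<close> is a total function.
\<close>

datatype move = Left | Stay | Right

record turing_machine =
  states :: nat
  symbols :: nat
  start :: nat
  accepting :: nat
  rejecting :: nat
  delta :: "nat \<Rightarrow> nat \<Rightarrow> nat \<times> nat \<times> move"

definition wf_tm :: "turing_machine \<Rightarrow> bool" where
  "wf_tm M \<longleftrightarrow>
     start M < states M \<and> accepting M < states M \<and> rejecting M < states M \<and>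
     accepting M \<noteq> rejecting M \<and> 2 \<le> symbols M \<and>
     (\<forall>q < states M. \<forall>a < symbols M. \<forall>q' a' d.
        delta M q a = (q', a', d) \<longrightarrow> q' < states M \<and> a' < symbols M)"

text \<open>A configuration consists of the state, the tape contents and the position of the head.\<close>

type_synonym config = "nat \<times> (int \<Rightarrow> nat) \<times> int"

definition halted :: "turing_machine \<Rightarrow> config \<Rightarrow> bool" where
  "halted M c \<longleftrightarrow> fst c = accepting M \<or> fst c = rejecting M"

fun offset :: "move \<Rightarrow> int" where
  "offset Left = -1"
| "offset Stay = 0"
| "offset Right = 1"

fun step :: "turing_machine \<Rightarrow> config \<Rightarrow> config" where
  "step M (q, t, h) =
     (if halted M (q, t, h) then (q, t, h)
      else (case delta M q (t h) of (q', a, d) \<Rightarrow> (q', t(h := a), h + offset d)))"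

text \<open>
  A natural number is presented to a machine in unary, the head being on the leftmost cell of the
  input (the notion of decidability does not depend on the choice of numeral system).
\<close>

definition initial :: "turing_machine \<Rightarrow> nat \<Rightarrow> config" where
  "initial M x = (start M, (\<lambda>i. if 0 \<le> i \<and> i < int x then 1 else 0), 0)"

definition accepts :: "turing_machine \<Rightarrow> nat \<Rightarrow> bool" where
  "accepts M x \<longleftrightarrow> (\<exists>k. fst ((step M ^^ k) (initial M x)) = accepting M)"

definition rejects :: "turing_machine \<Rightarrow> nat \<Rightarrow> bool" where
  "rejects M x \<longleftrightarrow> (\<exists>k. fst ((step M ^^ k) (initial M x)) = rejecting M)"

definition decidable :: "nat set \<Rightarrow> bool" where
  "decidable S \<longleftrightarrow>
     (\<exists>M. wf_tm M \<and> (\<forall>x. (x \<in> S \<longrightarrow> accepts M x) \<and> (x \<notin> S \<longrightarrow> rejects M x)))"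


section \<open>Rational functions over the rationals\<close>

text \<open>
  The field of rational functions in countably infinitely many indeterminates, indexed by the
  natural numbers, as the fraction field of the polynomial ring; a polynomial maps monomials
  (finitely supported exponent functions) to coefficients.
\<close>

type_synonym qpoly = "(nat \<Rightarrow>\<^sub>0 nat) \<Rightarrow>\<^sub>0 rat"
type_synonym ratfun = "qpoly fract"

definition polys :: "nat set \<Rightarrow> qpoly set" where
  "polys I = {p. \<forall>m \<in> Poly_Mapping.keys p. Poly_Mapping.keys m \<subseteq> I}"

text \<open>The subfield of the rational functions in the indeterminates with index in \<^term>\<open>I\<close>:\<close>

definition ratfuns :: "nat set \<Rightarrow> ratfun set" where
  "ratfuns I = {Fract p q | p q. p \<in> polys I \<and> q \<in> polys I \<and> q \<noteq> 0}"

definition matrices :: "nat \<Rightarrow> nat set \<Rightarrow> ratfun mat set" where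
  "matrices n I = {A \<in> carrier_mat n n. elements_mat A \<subseteq> ratfuns I}"

definition initial_segment :: "nat set \<Rightarrow> bool" where
  "initial_segment I \<longleftrightarrow> (\<forall>i \<in> I. \<forall>j < i. j \<in> I)"


section \<open>Codes of problem instances\<close>

text \<open>
  Finite syntax: a monomial is a list of pairs of an indeterminate (index) and an exponent, a
  polynomial with integer coefficients is a list of pairs of a coefficient and a monomial, a
  rational function is a pair of numerator and denominator.  Repetitions, zero coefficients and
  unreduced fractions are allowed, so that codes are not unique.
\<close>

type_synonym mono_expr = "(nat \<times> nat) list"
type_synonym poly_expr = "(int \<times> mono_expr) list"
type_synonym ratfun_expr = "poly_expr \<times> poly_expr"
type_synonym mat_expr = "ratfun_expr list list"

definition mono_val :: "mono_expr \<Rightarrow> nat \<Rightarrow>\<^sub>0 nat" where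
  "mono_val m = (\<Sum>(i, e) \<leftarrow> m. Poly_Mapping.single i e)"

definition poly_val :: "poly_expr \<Rightarrow> qpoly" where
  "poly_val p = (\<Sum>(c, m) \<leftarrow> p. Poly_Mapping.single (mono_val m) (of_int c))"

definition ratfun_val :: "ratfun_expr \<Rightarrow> ratfun" where
  "ratfun_val r = Fract (poly_val (fst r)) (poly_val (snd r))"

definition mat_val :: "nat \<Rightarrow> mat_expr \<Rightarrow> ratfun mat" where
  "mat_val n rss = mat_of_rows_list n (map (map ratfun_val) rss)"

definition poly_expr_ok :: "nat set \<Rightarrow> poly_expr \<Rightarrow> bool" where
  "poly_expr_ok I p \<longleftrightarrow> (\<forall>(c, m) \<in> set p. \<forall>(i, e) \<in> set m. i \<in> I)"

definition ratfun_expr_ok :: "nat set \<Rightarrow> ratfun_expr \<Rightarrow> bool" where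
  "ratfun_expr_ok I r \<longleftrightarrow>
     poly_expr_ok I (fst r) \<and> poly_expr_ok I (snd r) \<and> poly_val (snd r) \<noteq> 0"

definition mat_expr_ok :: "nat \<Rightarrow> nat set \<Rightarrow> mat_expr \<Rightarrow> bool" where
  "mat_expr_ok n I rss \<longleftrightarrow>
     length rss = n \<and> (\<forall>rs \<in> set rss. length rs = n \<and> (\<forall>r \<in> set rs. ratfun_expr_ok I r))"

definition mono_code :: "mono_expr \<Rightarrow> nat" where
  "mono_code m = list_encode (map prod_encode m)"

definition poly_code :: "poly_expr \<Rightarrow> nat" where
  "poly_code p = list_encode (map (\<lambda>(c, m). prod_encode (int_encode c, mono_code m)) p)"

definition ratfun_code :: "ratfun_expr \<Rightarrow> nat" where
  "ratfun_code r = prod_encode (poly_code (fst r), poly_code (snd r))"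

definition mat_code :: "mat_expr \<Rightarrow> nat" where
  "mat_code rss = list_encode (map (\<lambda>rs. list_encode (map ratfun_code rs)) rss)"

text \<open>\<^term>\<open>x\<close> is a code of the dimension \<^term>\<open>n\<close> and the matrices \<^term>\<open>A\<close>, \<^term>\<open>B\<close>:\<close>

definition codes_instance ::
    "nat set \<Rightarrow> nat \<Rightarrow> nat \<Rightarrow> ratfun mat \<Rightarrow> ratfun mat \<Rightarrow> bool" where
  "codes_instance I x n A B \<longleftrightarrow>
     (\<exists>as bs. mat_expr_ok n I as \<and> mat_val n as = A \<and>
              mat_expr_ok n I bs \<and> mat_val n bs = B \<and>
              x = prod_encode (n, prod_encode (mat_code as, mat_code bs)))"


subsection \<open>Every instance has a code, and a code determines the instance\<close>

lemma inj_list_code: "inj f \<Longrightarrow> inj (\<lambda>xs. list_encode (map f xs))"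
  by (rule injI) (simp add: list_encode_eq inj_map_eq_map)

lemma inj_mono_code: "inj mono_code"
  unfolding mono_code_def by (rule inj_list_code[OF inj_prod_encode])

lemma inj_poly_code: "inj poly_code"
  unfolding poly_code_def
  by (rule inj_list_code, rule injI)
     (clarsimp simp: prod_encode_eq int_encode_eq inj_eq[OF inj_mono_code])

lemma inj_ratfun_code: "inj ratfun_code"
  by (rule injI) (simp add: ratfun_code_def prod_encode_eq inj_eq[OF inj_poly_code] prod_eq_iff)

lemma inj_mat_code: "inj mat_code"
  unfolding mat_code_def by (intro inj_list_code inj_ratfun_code)

lemma codes_instance_unique:
  assumes "codes_instance I x n A B" "codes_instance I x n' A' B'"
  shows "n = n' \<and> A = A' \<and> B = B'"
  using assms unfolding codes_instance_def
  by (auto simp: prod_encode_eq inj_eq[OF inj_mat_code])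

lemma mono_val_in:
  "\<forall>(i, e) \<in> set m. i \<in> I \<Longrightarrow> Poly_Mapping.keys (mono_val m) \<subseteq> I"
proof (induction m)
  case (Cons a m)
  obtain i e where a: "a = (i, e)" by force
  have eq: "mono_val (a # m) = Poly_Mapping.single i e + mono_val m"
    by (simp add: mono_val_def a)
  have "Poly_Mapping.keys (mono_val (a # m)) \<subseteq>
      Poly_Mapping.keys (Poly_Mapping.single i e) \<union> Poly_Mapping.keys (mono_val m)"
    unfolding eq by (rule Poly_Mapping.keys_add)
  moreover have "Poly_Mapping.keys (Poly_Mapping.single i e) \<subseteq> {i}"
    by simp
  moreover have "i \<in> I" "Poly_Mapping.keys (mono_val m) \<subseteq> I"
    using Cons.prems Cons.IH by (simp_all add: a)
  ultimately show ?case by blast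
qed (simp add: mono_val_def)

lemma poly_val_in: "poly_expr_ok I p \<Longrightarrow> poly_val p \<in> polys I"
proof (induction p)
  case (Cons a p)
  obtain c m where a: "a = (c, m)" by force
  have eq: "poly_val (a # p) = Poly_Mapping.single (mono_val m) (of_int c) + poly_val p"
    by (simp add: poly_val_def a)
  have "Poly_Mapping.keys (poly_val (a # p)) \<subseteq>
      Poly_Mapping.keys (Poly_Mapping.single (mono_val m) (rat_of_int c)) \<union>
      Poly_Mapping.keys (poly_val p)"
    unfolding eq by (rule Poly_Mapping.keys_add)
  moreover have "Poly_Mapping.keys (Poly_Mapping.single (mono_val m) (rat_of_int c)) \<subseteq> {mono_val m}"
    by simp
  moreover have "poly_expr_ok I p" "Poly_Mapping.keys (mono_val m) \<subseteq> I"
    using Cons.prems mono_val_in[of m I] by (simp_all add: poly_expr_ok_def a)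
  ultimately show ?case
    using Cons.IH unfolding polys_def by blast
qed (simp add: poly_val_def polys_def)

lemma ratfun_val_in: "ratfun_expr_ok I r \<Longrightarrow> ratfun_val r \<in> ratfuns I"
  unfolding ratfun_expr_ok_def ratfun_val_def ratfuns_def using poly_val_in by blast

lemma mat_val_in:
  assumes "mat_expr_ok n I rss"
  shows "mat_val n rss \<in> matrices n I"
proof -
  have len: "length rss = n" using assms by (simp add: mat_expr_ok_def)
  have "ratfun_val (rss ! i ! j) \<in> ratfuns I" "length (rss ! i) = n" if "i < n" "j < n" for i j
  proof -
    have "rss ! i \<in> set rss" using that len by simp
    then have rs: "length (rss ! i) = n" "\<forall>r \<in> set (rss ! i). ratfun_expr_ok I r"
      using assms by (auto simp: mat_expr_ok_def)
    then show "ratfun_val (rss ! i ! j) \<in> ratfuns I" "length (rss ! i) = n"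
      using that by (auto intro: ratfun_val_in)
  qed
  then show ?thesis
    using len by (auto simp: mat_val_def matrices_def mat_of_rows_list_def dest!: elements_matD)
qed

lemma codes_instance_in:
  "codes_instance I x n A B \<Longrightarrow> A \<in> matrices n I \<and> B \<in> matrices n I"
  using mat_val_in by (auto simp: codes_instance_def)

lemma poly_mapping_sum:
  "(\<Sum>k \<in> Poly_Mapping.keys p. Poly_Mapping.single k (Poly_Mapping.lookup p k)) = p"
  by (rule poly_mapping_eqI)
     (auto simp: lookup_sum lookup_single when_def in_keys_iff)

lemma mono_expr_ex:
  assumes "Poly_Mapping.keys m \<subseteq> I"
  shows "\<exists>ml. (\<forall>(i, e) \<in> set ml. i \<in> I) \<and> mono_val ml = m"
proof -
  obtain ks where ks: "set ks = Poly_Mapping.keys m" "distinct ks"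
    using finite_distinct_list[OF Poly_Mapping.finite_keys] by metis
  have "mono_val (map (\<lambda>i. (i, Poly_Mapping.lookup m i)) ks) = m"
    using poly_mapping_sum[of m] ks
    by (simp add: mono_val_def o_def sum_list_distinct_conv_sum_set)
  then show ?thesis
    using ks assms by (intro exI[of _ "map (\<lambda>i. (i, Poly_Mapping.lookup m i)) ks"]) auto
qed

lemma of_int_times_single:
  "of_int a * Poly_Mapping.single k c = Poly_Mapping.single k (of_int a * c)"
  by (metis add_0 mult_single single_of_int)

lemma poly_val_scale: "poly_val (map (\<lambda>(c, m). (d * c, m)) p) = of_int d * poly_val p"
  by (induction p) (auto simp: poly_val_def distrib_left of_int_times_single)

lemma poly_expr_ok_scale: "poly_expr_ok I (map (\<lambda>(c, m). (d * c, m)) p) \<longleftrightarrow> poly_expr_ok I p"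
  by (induction p) (auto simp: poly_expr_ok_def)

lemma poly_expr_sum_ex:
  assumes "finite K" "\<And>k. k \<in> K \<Longrightarrow> Poly_Mapping.keys k \<subseteq> I"
  shows "\<exists>d pe. d > (0::int) \<and> poly_expr_ok I pe \<and>
    poly_val pe = of_int d * (\<Sum>k\<in>K. Poly_Mapping.single k (f k))"
  using assms
proof (induction K rule: finite_induct)
  case empty
  show ?case
    by (intro exI[of _ 1] exI[of _ "[]"]) (simp add: poly_val_def poly_expr_ok_def)
next
  case (insert k K)
  then obtain d pe where pe: "d > (0::int)" "poly_expr_ok I pe"
    "poly_val pe = of_int d * (\<Sum>k\<in>K. Poly_Mapping.single k (f k))"
    by auto
  obtain ml where ml: "\<forall>(i, e) \<in> set ml. i \<in> I" "mono_val ml = k"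
    using mono_expr_ex[of k I] insert.prems by auto
  obtain a b where ab: "quotient_of (f k) = (a, b)" by force
  have b: "b > 0" and f: "f k = of_int a / of_int b"
    using quotient_of_denom_pos[OF ab] quotient_of_div[OF ab] by auto
  let ?pe = "(d * a, ml) # map (\<lambda>(c, m). (b * c, m)) pe"
  have c: "of_int (d * a) = of_int (d * b) * f k" using b f by simp
  have "poly_val ?pe = Poly_Mapping.single k (of_int (d * a)) + of_int b * poly_val pe"
    using poly_val_scale[of b pe] ml by (simp add: poly_val_def)
  also have "\<dots> = of_int (d * b) * (\<Sum>k\<in>insert k K. Poly_Mapping.single k (f k))"
    unfolding c of_int_times_single[symmetric] pe(3)
    using insert.hyps by (simp add: distrib_left mult_ac)
  finally have "poly_val ?pe = of_int (d * b) * (\<Sum>k\<in>insert k K. Poly_Mapping.single k (f k))" .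
  moreover have "poly_expr_ok I (map (\<lambda>(c, m). (b * c, m)) pe)"
    using pe(2) by (simp add: poly_expr_ok_scale)
  then have "poly_expr_ok I ?pe"
    using ml(1) by (simp add: poly_expr_ok_def)
  moreover have "d * b > 0" using pe(1) b by simp
  ultimately show ?case by blast
qed

lemma poly_expr_ex:
  assumes "p \<in> polys I"
  shows "\<exists>d pe. d > (0::int) \<and> poly_expr_ok I pe \<and> poly_val pe = of_int d * p"
  using poly_expr_sum_ex[of "Poly_Mapping.keys p" I "Poly_Mapping.lookup p"] assms
  by (auto simp: polys_def poly_mapping_sum)

lemma ratfun_expr_ex:
  assumes "x \<in> ratfuns I"
  shows "\<exists>r. ratfun_expr_ok I r \<and> ratfun_val r = x"
proof -
  obtain p q where pq: "x = Fract p q" "p \<in> polys I" "q \<in> polys I" "q \<noteq> 0"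
    using assms by (auto simp: ratfuns_def)
  obtain d pe where pe: "d > (0::int)" "poly_expr_ok I pe" "poly_val pe = of_int d * p"
    using poly_expr_ex[OF pq(2)] by auto
  obtain d' qe where qe: "d' > (0::int)" "poly_expr_ok I qe" "poly_val qe = of_int d' * q"
    using poly_expr_ex[OF pq(3)] by auto
  let ?r = "(map (\<lambda>(c, m). (d' * c, m)) pe, map (\<lambda>(c, m). (d * c, m)) qe)"
  have v: "poly_val (fst ?r) = of_int (d * d') * p" "poly_val (snd ?r) = of_int (d * d') * q"
    unfolding fst_conv snd_conv poly_val_scale pe(3) qe(3) by (simp_all add: mult_ac)
  have c: "(of_int (d * d') :: qpoly) \<noteq> 0"
    using pe(1) qe(1) by (metis mult_pos_pos less_irrefl of_int_eq_0_iff)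
  have "ratfun_val ?r = x"
    unfolding ratfun_val_def v pq(1) using c by (rule mult_fract_cancel)
  moreover have "ratfun_expr_ok I ?r"
    unfolding ratfun_expr_ok_def v using c pq(4) pe(2) qe(2)
    by (simp add: poly_expr_ok_scale)
  ultimately show ?thesis by blast
qed

lemma mat_expr_ex:
  assumes "A \<in> matrices n I"
  shows "\<exists>rss. mat_expr_ok n I rss \<and> mat_val n rss = A"
proof -
  have A: "A \<in> carrier_mat n n" and "\<And>i j. i < n \<Longrightarrow> j < n \<Longrightarrow> A $$ (i, j) \<in> ratfuns I"
    using assms by (auto simp: matrices_def)
  then have "\<forall>i j. \<exists>r. i < n \<and> j < n \<longrightarrow> ratfun_expr_ok I r \<and> ratfun_val r = A $$ (i, j)"
    using ratfun_expr_ex by blast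
  then obtain r where r: "\<And>i j. i < n \<Longrightarrow> j < n \<Longrightarrow>
      ratfun_expr_ok I (r i j) \<and> ratfun_val (r i j) = A $$ (i, j)"
    by metis
  let ?rss = "map (\<lambda>i. map (r i) [0..<n]) [0..<n]"
  have "mat_expr_ok n I ?rss"
    using r by (auto simp: mat_expr_ok_def)
  moreover have "mat_val n ?rss = A"
    using r A by (intro eq_matI) (auto simp: mat_val_def mat_of_rows_list_def)
  ultimately show ?thesis by blast
qed

lemma codes_instance_ex:
  "A \<in> matrices n I \<Longrightarrow> B \<in> matrices n I \<Longrightarrow> \<exists>x. codes_instance I x n A B"
  unfolding codes_instance_def using mat_expr_ex by blast

end

theory Submission
  imports Defs "Jordan_Normal_Form.Schur_Decomposition" "Berlekamp_Zassenhaus.Factor_Bound"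
begin

text \<open>
  It suffices to search for certificates of \<open>A ^ i = B\<close> and of \<open>\<forall>i. A ^ i \<noteq> B\<close> that can be checked
  by a primitive recursive function.  An equation between rational functions is tested at
  sufficiently many points of the form \<open>X\<^sub>j = t ^ (G ^ j)\<close> (Kronecker substitution).  If no power of
  \<open>A\<close> equals \<open>B\<close>, then for every \<open>L\<close> some point separates \<open>B\<close> from all \<open>A ^ i\<close> with \<open>i \<le> L\<close>, so it
  remains to certify a bound \<open>L\<close> on the exponents.  This is done for a rational matrix obtained by
  specialising \<open>A\<close>.  If it has an eigenvalue that is neither zero nor a root of unity, a
  quantitative form of Kronecker's theorem bounds \<open>i\<close> in terms of \<open>B\<close>; otherwise, either the powers
  of \<open>A\<close> are eventually periodic, or a unipotent part of rank two has an entry that is linear in \<open>i\<close>.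
\<close>

text \<open>A single specialisation cannot settle the question: at a given point \<open>B\<close>
  may become a power of \<open>A\<close> although it is none over the function field. A refusal
  therefore uses two points with separate roles: one where \<open>L\<close> bounds every exponent
  that could work, hence also every exponent that works generically, and one where all exponents up
  to \<open>L\<close> fail. A periodicity certificate bounds nothing but lowers an exponent at its
  own point, so it has to sit at the second one.

  No algebraic number is ever computed. That all eigenvalues are zero or roots of unity is expressed
  by the nilpotency of \<open>A ^ (L + L!) - A ^ L\<close>, where the factorial is a common multiple
  of all orders in reach. The pigeonhole argument behind the effective Kronecker theorem also shows
  that one value of \<open>L\<close>, depending on \<open>n\<close> alone, decides this for all
  rational matrices of size \<open>n\<close>. So the cases can be separated over the polynomial
  ring, independently of \<open>B\<close> and of the points.\<close>

declare step.simps [simp del]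

hide_const (open) up_ring.coeff up_ring.monom module.smult Divisibility.prime

section \<open>While programs on Turing machines\<close>

datatype prog =
    Skip
  | Inc nat
  | Seq prog prog (infixr ";;" 60)
  | Branch nat prog prog
  | Loop nat prog

text \<open>A successful test decrements the tested register.\<close>

inductive exec :: "prog \<Rightarrow> (nat \<Rightarrow> nat) \<Rightarrow> (nat \<Rightarrow> nat) \<Rightarrow> bool" where
  Skip: "exec Skip s s"
| Inc: "exec (Inc r) s (s(r := Suc (s r)))"
| Seq: "exec P s s' \<Longrightarrow> exec Q s' s'' \<Longrightarrow> exec (P ;; Q) s s''"
| BranchSuc: "s r = Suc m \<Longrightarrow> exec P (s(r := m)) s' \<Longrightarrow> exec (Branch r P Q) s s'"
| Branch0: "s r = 0 \<Longrightarrow> exec Q s s' \<Longrightarrow> exec (Branch r P Q) s s'"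
| LoopSuc: "s r = Suc m \<Longrightarrow> exec P (s(r := m)) s' \<Longrightarrow> exec (Loop r P) s' s'' \<Longrightarrow> exec (Loop r P) s s''"
| Loop0: "s r = 0 \<Longrightarrow> exec (Loop r P) s s"

text \<open>Every instruction names its successors: \<open>DEC r n z\<close> continues at \<open>z\<close> if register \<open>r\<close> is
  zero, and otherwise decrements it and continues at \<open>n\<close>.\<close>

datatype instr = GOTO nat | INC nat nat | DEC nat nat nat

fun exec_instr :: "instr \<Rightarrow> (nat \<Rightarrow> nat) \<Rightarrow> nat \<times> (nat \<Rightarrow> nat)" where
  "exec_instr (GOTO n) s = (n, s)"
| "exec_instr (INC r n) s = (n, s(r := Suc (s r)))"
| "exec_instr (DEC r n z) s = (if s r = 0 then (z, s) else (n, s(r := s r - 1)))"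

inductive reach :: "instr list \<Rightarrow> nat \<times> (nat \<Rightarrow> nat) \<Rightarrow> nat \<times> (nat \<Rightarrow> nat) \<Rightarrow> bool" for C where
  Refl: "reach C c c"
| Step: "p < length C \<Longrightarrow> reach C (exec_instr (C ! p) s) c \<Longrightarrow> reach C (p, s) c"

lemma reach_trans: "reach C a b \<Longrightarrow> reach C b c \<Longrightarrow> reach C a c"
  by (induction rule: reach.induct) (auto intro: reach.Step)

fun prog_len :: "prog \<Rightarrow> nat" where
  "prog_len Skip = 1"
| "prog_len (Inc r) = 1"
| "prog_len (P ;; Q) = prog_len P + prog_len Q"
| "prog_len (Branch r P Q) = 1 + prog_len P + prog_len Q"
| "prog_len (Loop r P) = 1 + prog_len P"

text \<open>\<open>compile P a e\<close> is the code of \<open>P\<close> for the addresses from \<open>a\<close> on, leaving to address \<open>e\<close>.\<close>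

fun compile :: "prog \<Rightarrow> nat \<Rightarrow> nat \<Rightarrow> instr list" where
  "compile Skip a e = [GOTO e]"
| "compile (Inc r) a e = [INC r e]"
| "compile (P ;; Q) a e = compile P a (a + prog_len P) @ compile Q (a + prog_len P) e"
| "compile (Branch r P Q) a e =
     DEC r (a + 1) (a + 1 + prog_len P) # compile P (a + 1) e @ compile Q (a + 1 + prog_len P) e"
| "compile (Loop r P) a e = DEC r (a + 1) e # compile P (a + 1) a"

lemma length_compile [simp]: "length (compile P a e) = prog_len P"
  by (induction P arbitrary: a e) auto

definition code_at :: "instr list \<Rightarrow> nat \<Rightarrow> instr list \<Rightarrow> bool" where
  "code_at C a D \<longleftrightarrow> (\<exists>X Y. C = X @ D @ Y \<and> length X = a)"

lemma code_at_append:
  "code_at C a (D @ E) \<longleftrightarrow> code_at C a D \<and> code_at C (a + length D) E"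
proof
  assume "code_at C a (D @ E)"
  then obtain X Y where "C = X @ D @ E @ Y" "length X = a" by (auto simp: code_at_def)
  then show "code_at C a D \<and> code_at C (a + length D) E"
    unfolding code_at_def
    by (intro conjI exI[of _ X] exI[of _ "E @ Y"] exI[of _ "X @ D"] exI[of _ Y]) auto
next
  assume "code_at C a D \<and> code_at C (a + length D) E"
  then obtain X Y X' Y' where XY: "C = X @ D @ Y" "length X = a"
    and XY': "C = X' @ E @ Y'" "length X' = a + length D"
    unfolding code_at_def by blast
  have "take (a + length D) C = X @ D" using XY by simp
  moreover have "take (a + length D) C = X'" using XY' by simp
  ultimately show "code_at C a (D @ E)"
    using XY XY' unfolding code_at_def by (intro exI[of _ X] exI[of _ Y']) auto
qed

lemma code_at_Cons: "code_at C a (i # D) \<longleftrightarrow> a < length C \<and> C ! a = i \<and> code_at C (Suc a) D"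
proof -
  have "code_at C a [i] \<longleftrightarrow> a < length C \<and> C ! a = i"
    unfolding code_at_def
    by (auto simp: nth_append) (metis append_Cons append_Nil id_take_nth_drop length_take min.absorb4)
  then show ?thesis using code_at_append[of C a "[i]" D] by simp
qed

text \<open>Only terminating runs matter, so the induction is along \<open>exec\<close>. The
  addresses stay arbitrary because the body of a loop is entered one address later and exits to the
  test of the loop instead of \<open>e\<close>.\<close>

lemma reach_compile:
  "exec P s s' \<Longrightarrow> code_at C a (compile P a e) \<Longrightarrow> reach C (a, s) (e, s')"
proof (induction arbitrary: a e rule: exec.induct)
  case (Seq P s s' Q s'')
  then show ?case unfolding compile.simps code_at_append length_compile by (blast intro: reach_trans)
next
  case (BranchSuc s r m P s' Q)
  have "reach C (Suc a, s(r := m)) (e, s')"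
    by (rule BranchSuc.IH) (use BranchSuc.prems in \<open>simp add: code_at_append code_at_Cons\<close>)
  with BranchSuc show ?case by (intro reach.Step) (auto simp: code_at_Cons)
next
  case (Branch0 s r Q s' P)
  then have "reach C (Suc (a + prog_len P), s) (e, s')"
    by (auto simp: code_at_append code_at_Cons)
  with Branch0 show ?case by (intro reach.Step) (auto simp: code_at_Cons)
next
  case (LoopSuc s r m P s' s'')
  have "reach C (Suc a, s(r := m)) (a, s')"
    by (rule LoopSuc.IH(1)) (use LoopSuc.prems in \<open>simp add: code_at_Cons\<close>)
  moreover have "reach C (a, s') (e, s'')"
    by (rule LoopSuc.IH(2)) (rule LoopSuc.prems)
  ultimately have "reach C (Suc a, s(r := m)) (e, s'')" by (rule reach_trans)
  with LoopSuc show ?case by (intro reach.Step) (auto simp: code_at_Cons)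
next
  case (Loop0 s r P)
  then show ?case by (intro reach.Step) (auto simp: code_at_Cons intro: reach.Refl)
next
  case (Skip s)
  then show ?case by (intro reach.Step) (auto simp: code_at_Cons intro: reach.Refl)
next
  case (Inc r s)
  then show ?case by (intro reach.Step) (auto simp: code_at_Cons fun_upd_def intro: reach.Refl)
qed

text \<open>The address \<open>N\<close> just behind the code is a legal target: arriving there
  means that the program has ended.\<close>

fun instr_ok :: "nat \<Rightarrow> nat \<Rightarrow> instr \<Rightarrow> bool" where
  "instr_ok R N (GOTO n) \<longleftrightarrow> n \<le> N"
| "instr_ok R N (INC r n) \<longleftrightarrow> r < R \<and> n \<le> N"
| "instr_ok R N (DEC r n z) \<longleftrightarrow> r < R \<and> n \<le> N \<and> z \<le> N"

fun regs_bound :: "prog \<Rightarrow> nat" where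
  "regs_bound Skip = 0"
| "regs_bound (Inc r) = Suc r"
| "regs_bound (P ;; Q) = max (regs_bound P) (regs_bound Q)"
| "regs_bound (Branch r P Q) = max (Suc r) (max (regs_bound P) (regs_bound Q))"
| "regs_bound (Loop r P) = max (Suc r) (regs_bound P)"

lemma instr_ok_compile:
  "regs_bound P \<le> R \<Longrightarrow> a + prog_len P \<le> N \<Longrightarrow> e \<le> N \<Longrightarrow> i \<in> set (compile P a e) \<Longrightarrow> instr_ok R N i"
proof (induction P arbitrary: a e)
  case (Seq P Q)
  show ?case using Seq.prems Seq.IH(1)[of a "a + prog_len P"] Seq.IH(2)[of "a + prog_len P" e]
    by auto
next
  case (Branch r P Q)
  show ?case using Branch.prems Branch.IH(1)[of "a + 1" e] Branch.IH(2)[of "a + 1 + prog_len P" e]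
    by auto
next
  case (Loop r P)
  show ?case using Loop.prems Loop.IH[of "a + 1" a] by auto
qed auto

text \<open>The registers below \<open>R\<close> are kept in unary on \<open>R\<close> tracks of the tape: a symbol is the binary
  code of the set of the tracks that are marked in the cell.  Track \<open>R\<close> marks the home position.\<close>

definition cell :: "nat \<Rightarrow> (nat \<Rightarrow> nat) \<Rightarrow> int \<Rightarrow> nat set" where
  "cell R s i = {r. r < R \<and> 0 \<le> i \<and> i < int (s r)} \<union> (if i = 0 then {R} else {})"

definition tape :: "nat \<Rightarrow> (nat \<Rightarrow> nat) \<Rightarrow> int \<Rightarrow> nat" where
  "tape R s i = set_encode (cell R s i)"

lemma finite_cell [simp]: "finite (cell R s i)"
  by (auto simp: cell_def)

lemma set_decode_tape [simp]: "set_decode (tape R s i) = cell R s i"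
  by (simp add: tape_def)

text \<open>State \<open>4 p\<close> begins the instruction at address \<open>p\<close>; in state \<open>4 p + 1\<close> the head returns home
  and continues with the next instruction; in states \<open>4 p + 2\<close> and \<open>4 p + 3\<close> it finds and
  erases the last mark of the register that is decremented.\<close>

fun tm_instr :: "nat \<Rightarrow> instr \<Rightarrow> nat \<Rightarrow> nat \<Rightarrow> nat set \<Rightarrow> nat \<times> nat set \<times> move" where
  "tm_instr R (GOTO n) p j A = (4 * n, A, Stay)"
| "tm_instr R (INC r n) p j A =
     (if j = 0 then (if r \<in> A then (4 * p, A, Right) else (4 * p + 1, insert r A, Stay))
      else if R \<in> A then (4 * n, A, Stay) else (4 * p + 1, A, Left))"
| "tm_instr R (DEC r n z) p j A =
     (if j = 0 then (if r \<in> A then (4 * p + 2, A, Right) else (4 * z, A, Stay))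
      else if j = 1 then (if R \<in> A then (4 * n, A, Stay) else (4 * p + 1, A, Left))
      else if j = 2 then (if r \<in> A then (4 * p + 2, A, Right) else (4 * p + 3, A, Left))
      else (4 * p + 1, A - {r}, Stay))"

text \<open>Behind the instructions there are four more states. In \<open>4 * N\<close> the program
  has ended, and the mark of register 0 in the home cell chooses between the accepting state
  \<open>4 * N + 1\<close> and the rejecting state \<open>4 * N + 2\<close>. The start state
  \<open>4 * N + 3\<close> only sets the home mark: the input is already in place, since the blank
  codes the empty set of tracks and the symbol 1 codes \<open>{0}\<close>.\<close>

definition tm_delta :: "nat \<Rightarrow> instr list \<Rightarrow> nat \<Rightarrow> nat set \<Rightarrow> nat \<times> nat set \<times> move" where
  "tm_delta R C q A =
     (let N = length C in
      if q < 4 * N then tm_instr R (C ! (q div 4)) (q div 4) (q mod 4) A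
      else if q = 4 * N then (if 0 \<in> A then 4 * N + 1 else 4 * N + 2, A, Stay)
      else (0, insert R A, Stay))"

definition tm_of :: "nat \<Rightarrow> instr list \<Rightarrow> turing_machine" where
  "tm_of R C = \<lparr>states = 4 * length C + 4, symbols = 2 ^ Suc R, start = 4 * length C + 3,
     accepting = 4 * length C + 1, rejecting = 4 * length C + 2,
     delta = (\<lambda>q a. case tm_delta R C q (set_decode a) of (q', A, d) \<Rightarrow> (q', set_encode A, d))\<rparr>"

lemma set_encode_less_iff: "finite A \<Longrightarrow> set_encode A < 2 ^ Suc R \<longleftrightarrow> A \<subseteq> {..R}"
proof
  assume "finite A" "A \<subseteq> {..R}"
  have "set_encode A \<le> (\<Sum>i\<in>{..R}. 2 ^ i)"
    using \<open>A \<subseteq> {..R}\<close> by (auto simp: set_encode_def intro: sum_mono2)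
  also have "\<dots> < 2 ^ Suc R" by (induction R) auto
  finally show "set_encode A < 2 ^ Suc R" .
next
  assume A: "finite A" "set_encode A < 2 ^ Suc R"
  show "A \<subseteq> {..R}"
  proof (rule ccontr)
    assume "\<not> A \<subseteq> {..R}"
    then obtain r where r: "r \<in> A" "Suc R \<le> r" by (auto simp: subset_iff not_le Suc_le_eq)
    have "2 ^ Suc R \<le> (2::nat) ^ r" using r by (intro power_increasing) auto
    also have "\<dots> \<le> set_encode A"
      using r A(1) by (auto simp: set_encode_def intro: member_le_sum)
    finally show False using A(2) by simp
  qed
qed

lemma tm_instr_ok:
  assumes "instr_ok R N i" "p < N" "A \<subseteq> {..R}" "finite A" "tm_instr R i p j A = (q', A', d)"
  shows "q' < 4 * N + 4 \<and> A' \<subseteq> {..R} \<and> finite A'"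
  using assms by (cases i) (auto split: if_splits)

lemma wf_tm_of:
  assumes "\<forall>i \<in> set C. instr_ok R (length C) i"
  shows "wf_tm (tm_of R C)"
proof -
  have "q' < 4 * length C + 4 \<and> set_encode A' < 2 ^ Suc R"
    if q: "q < 4 * length C + 4" "a < 2 ^ Suc R"
      "tm_delta R C q (set_decode a) = (q', A', d)" for q a q' A' d
  proof -
    have A: "set_decode a \<subseteq> {..R}" "finite (set_decode a)"
      using q(2) set_encode_less_iff[of "set_decode a" R] by auto
    have "q' < 4 * length C + 4 \<and> A' \<subseteq> {..R} \<and> finite A'"
    proof (cases "q < 4 * length C")
      case True
      then have "q div 4 < length C" by auto
      moreover have "tm_instr R (C ! (q div 4)) (q div 4) (q mod 4) (set_decode a) = (q', A', d)"
        using q(3) True by (simp add: tm_delta_def)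
      ultimately show ?thesis
        using tm_instr_ok A assms nth_mem by metis
    next
      case False
      then show ?thesis using q(3) A by (auto simp: tm_delta_def Let_def split: if_splits)
    qed
    then show ?thesis using set_encode_less_iff by auto
  qed
  moreover have "(2::nat) \<le> 2 * 2 ^ R" by simp
  ultimately show ?thesis
    unfolding wf_tm_def tm_of_def by (auto split: prod.splits)
qed

section \<open>Simulation of the instructions by runs of the machine\<close>

definition steps_to :: "turing_machine \<Rightarrow> config \<Rightarrow> config \<Rightarrow> bool" where
  "steps_to M c c' \<longleftrightarrow> (\<exists>k. (step M ^^ k) c = c')"

lemma steps_to_refl [simp]: "steps_to M c c"
  unfolding steps_to_def by (rule exI[of _ 0]) simp

lemma steps_to_trans:
  assumes "steps_to M a b" "steps_to M b c"
  shows "steps_to M a c"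
proof -
  obtain j k where "(step M ^^ j) a = b" "(step M ^^ k) b = c"
    using assms by (auto simp only: steps_to_def)
  then have "(step M ^^ (k + j)) a = c" by (simp add: funpow_add)
  then show ?thesis unfolding steps_to_def by blast
qed

lemma steps_to_step: "step M a = b \<Longrightarrow> steps_to M b c \<Longrightarrow> steps_to M a c"
  unfolding steps_to_def by (metis comp_apply funpow_Suc_right)

lemma step_tm_of:
  assumes "tm_delta R C q (cell R s h) = (q', A, d)" "q \<noteq> 4 * length C + 1" "q \<noteq> 4 * length C + 2"
    "A = cell R s' h" "\<And>i. i \<noteq> h \<Longrightarrow> cell R s' i = cell R s i"
  shows "step (tm_of R C) (q, tape R s, h) = (q', tape R s', h + offset d)"
proof -
  have "(tape R s)(h := set_encode A) = tape R s'"
    using assms(4,5) by (auto simp: tape_def fun_eq_iff)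
  then show ?thesis
    using assms by (simp add: step.simps halted_def tm_of_def)
qed

text \<open>The marks of a register form an interval from the home cell on. An increment marks the
  first free cell of the track and a decrement erases the last marked one, so the head walks to the
  end of the interval and back; the home mark on track \<open>R\<close> tells it where to
  stop.\<close>

lemma reach_tm_instr:
  assumes p: "p < length C" and ok: "instr_ok R (length C) (C ! p)"
    and e: "exec_instr (C ! p) s = (p', s')"
  shows "steps_to (tm_of R C) (4 * p, tape R s, 0) (4 * p', tape R s', 0)"
proof -
  let ?M = "tm_of R C"
  have delta: "tm_delta R C (4 * p + j) A = tm_instr R (C ! p) p j A" if "j < 4" for j A
    using p that by (simp add: tm_delta_def)
  have stay: "tm_instr R (C ! p) p j (cell R s h) = (q', cell R s h, d) \<Longrightarrow> j < 4 \<Longrightarrow>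
      step ?M (4 * p + j, tape R s, h) = (q', tape R s, h + offset d)" for s h j q' d
    using p delta by (intro step_tm_of) auto
  have home: "steps_to ?M (4 * p + 1, tape R t, int h) (4 * n, tape R t, 0)"
    if "\<And>A. tm_instr R (C ! p) p (Suc 0) A =
          (if R \<in> A then (4 * n, A, Stay) else (4 * p + 1, A, Left))" for n t h
  proof (induction h)
    case 0
    show ?case
      by (rule steps_to_step[OF stay[of 1, where q' = "4 * n" and d = Stay]]) (auto simp: that cell_def)
  next
    case (Suc h)
    show ?case
      by (rule steps_to_step[OF stay[of 1, where q' = "4 * p + 1" and d = Left]])
        (use Suc in \<open>auto simp: that cell_def\<close>)
  qed
  have scan: "h \<le> s r \<Longrightarrow> h0 \<le> h \<Longrightarrow>
      steps_to ?M (4 * p + j, tape R s, int h0) (4 * p + j, tape R s, int h)"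
    if "\<And>A. r \<in> A \<Longrightarrow> tm_instr R (C ! p) p j A = (4 * p + j, A, Right)" "j < 4" "r < R" for j r h h0
  proof (induction h)
    case (Suc h)
    show ?case
    proof (cases "h0 = Suc h")
      case False
      then have *: "steps_to ?M (4 * p + j, tape R s, int h0) (4 * p + j, tape R s, int h)"
        using Suc by auto
      have "step ?M (4 * p + j, tape R s, int h) = (4 * p + j, tape R s, int h + offset Right)"
        by (rule stay) (use that Suc.prems in \<open>auto simp: cell_def\<close>)
      then have "step ?M (4 * p + j, tape R s, int h) = (4 * p + j, tape R s, int (Suc h))"
        by (simp add: add.commute)
      from steps_to_trans[OF * steps_to_step[OF this steps_to_refl]] show ?thesis .
    qed simp
  qed simp
  show ?thesis
  proof (cases "C ! p")
    case (GOTO n)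
    then show ?thesis using e
      by (intro steps_to_step[OF stay[of 0, where q' = "4 * n" and d = Stay, simplified]]) auto
  next
    case (INC r n)
    have r: "r < R" using ok INC by simp
    have "steps_to ?M (4 * p + 0, tape R s, int 0) (4 * p + 0, tape R s, int (s r))"
      by (rule scan[where r = r]) (simp_all add: INC r)
    then have 1: "steps_to ?M (4 * p, tape R s, 0) (4 * p, tape R s, int (s r))" by simp
    have s': "p' = n" "s' = s(r := Suc (s r))" using e INC by auto
    have "insert r (cell R s (int (s r))) = cell R s' (int (s r))"
      using r s' by (auto simp: cell_def)
    then have "tm_delta R C (4 * p + 0) (cell R s (int (s r))) = (4 * p + 1, cell R s' (int (s r)), Stay)"
      using delta[of 0] INC r by (simp add: cell_def)
    then have "step ?M (4 * p + 0, tape R s, int (s r)) =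
        (4 * p + 1, tape R s', int (s r) + offset Stay)"
      by (rule step_tm_of) (use s' p in \<open>auto simp: cell_def\<close>)
    then have 2: "step ?M (4 * p, tape R s, int (s r)) = (4 * p + 1, tape R s', int (s r))" by simp
    have 3: "steps_to ?M (4 * p + 1, tape R s', int (s r)) (4 * n, tape R s', 0)"
      by (rule home) (simp add: INC)
    show ?thesis unfolding s'(1) by (rule steps_to_trans[OF 1 steps_to_step[OF 2 3]])
  next
    case (DEC r n z)
    have r: "r < R" using ok DEC by simp
    show ?thesis
    proof (cases "s r")
      case 0
      then show ?thesis using e DEC r
        by (intro steps_to_step[OF stay[of 0, where q' = "4 * z" and d = Stay, simplified]])
           (auto simp: cell_def)
    next
      case (Suc m)
      have s': "p' = n" "s' = s(r := m)" using e DEC Suc by auto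
      have 1: "step ?M (4 * p, tape R s, 0) = (4 * p + 2, tape R s, int 1)"
        using stay[of 0 s 0 "4 * p + 2" Right] DEC r Suc by (auto simp: cell_def)
      have 2: "steps_to ?M (4 * p + 2, tape R s, int 1) (4 * p + 2, tape R s, int (s r))"
        by (rule scan[where r = r]) (simp_all add: DEC r Suc)
      have 3: "step ?M (4 * p + 2, tape R s, int (s r)) = (4 * p + 3, tape R s, int m)"
        using stay[of 2 s "int (s r)" "4 * p + 3" Left] DEC r Suc by (auto simp: cell_def)
      have "cell R s (int m) - {r} = cell R s' (int m)"
        using r s' Suc by (auto simp: cell_def)
      then have "tm_delta R C (4 * p + 3) (cell R s (int m)) = (4 * p + 1, cell R s' (int m), Stay)"
        using delta[of 3] DEC by simp
      then have "step ?M (4 * p + 3, tape R s, int m) = (4 * p + 1, tape R s', int m + offset Stay)"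
        by (rule step_tm_of) (use s' p Suc in \<open>auto simp: cell_def\<close>)
      then have 4: "step ?M (4 * p + 3, tape R s, int m) = (4 * p + 1, tape R s', int m)" by simp
      have 5: "steps_to ?M (4 * p + 1, tape R s', int m) (4 * n, tape R s', 0)"
        by (rule home) (simp add: DEC)
      show ?thesis unfolding s'(1)
        by (rule steps_to_step[OF 1 steps_to_trans[OF 2 steps_to_step[OF 3 steps_to_step[OF 4 5]]]])
    qed
  qed
qed

lemma reach_tm_of:
  assumes "reach C c c'" "\<forall>i \<in> set C. instr_ok R (length C) i"
  shows "steps_to (tm_of R C) (4 * fst c, tape R (snd c), 0) (4 * fst c', tape R (snd c'), 0)"
  using assms(1)
proof (induction rule: reach.induct)
  case (Step p s c)
  then show ?case
    using reach_tm_instr[of p C R s "fst (exec_instr (C ! p) s)" "snd (exec_instr (C ! p) s)"] assms(2)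
    by (auto intro: steps_to_trans)
qed simp

lemma accepts_iff: "accepts M x \<longleftrightarrow> (\<exists>c. steps_to M (initial M x) c \<and> fst c = accepting M)"
  unfolding accepts_def steps_to_def by blast

lemma rejects_iff: "rejects M x \<longleftrightarrow> (\<exists>c. steps_to M (initial M x) c \<and> fst c = rejecting M)"
  unfolding rejects_def steps_to_def by blast

lemma decidable_exec:
  assumes "\<And>x. \<exists>s. exec P ((\<lambda>_. 0)(0 := x)) s \<and> (s 0 \<noteq> 0 \<longleftrightarrow> x \<in> S)"
  shows "decidable S"
proof -
  define C where "C = compile P 0 (prog_len P)"
  \<comment> \<open>The successor reserves a track for register 0, which carries the input and the
    answer even if \<open>P\<close> never mentions it.\<close>
  define R where "R = Suc (regs_bound P)"
  have ok: "\<forall>i \<in> set C. instr_ok R (length C) i"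
    using instr_ok_compile[of P R 0 "length C"] by (auto simp: C_def R_def)
  let ?M = "tm_of R C"
  have "(x \<in> S \<longrightarrow> accepts ?M x) \<and> (x \<notin> S \<longrightarrow> rejects ?M x)" for x
  proof -
    let ?s = "(\<lambda>_. 0)(0 := x)"
    obtain s where s: "exec P ?s s" "s 0 \<noteq> 0 \<longleftrightarrow> x \<in> S" using assms by blast
    have "code_at C 0 C" by (auto simp: code_at_def)
    then have "reach C (0, ?s) (length C, s)"
      using reach_compile[OF s(1), of C 0 "prog_len P"] by (auto simp: C_def)
    from reach_tm_of[OF this ok]
    have main: "steps_to ?M (0, tape R ?s, 0) (4 * length C, tape R s, 0)" by simp
    have init: "step ?M (initial ?M x) = (0, tape R ?s, 0)"
    proof -
      let ?f = "\<lambda>i. if 0 \<le> i \<and> i < int x then 1 else 0"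
      have cell: "cell R ?s i = (if 0 \<le> i \<and> i < int x then {0} else {}) \<union> (if i = 0 then {R} else {})" for i
        by (auto simp: cell_def R_def split: if_splits)
      have "step ?M (initial ?M x) = (0, ?f(0 := set_encode (insert R (set_decode (?f 0)))), 0)"
        by (simp add: step.simps initial_def halted_def tm_of_def tm_delta_def Let_def)
      also have "set_decode (?f 0) = (if x = 0 then {} else {0})"
        using set_encode_inverse[of "{0}"] by simp
      also have "?f(0 := set_encode (insert R (if x = 0 then {} else {0}))) = tape R ?s"
        unfolding tape_def cell by (auto simp: fun_eq_iff insert_commute)
      finally show ?thesis .
    qed
    have final: "step ?M (4 * length C, tape R s, 0) =
        (if x \<in> S then 4 * length C + 1 else 4 * length C + 2, tape R s, 0 + offset Stay)"
      by (rule step_tm_of) (use s(2) in \<open>auto simp: tm_delta_def cell_def R_def\<close>)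
    have "steps_to ?M (initial ?M x) (if x \<in> S then 4 * length C + 1 else 4 * length C + 2, tape R s, 0)"
      by (rule steps_to_step[OF init], rule steps_to_trans[OF main], rule steps_to_step[OF final]) simp
    moreover have "accepting ?M = 4 * length C + 1" "rejecting ?M = 4 * length C + 2"
      by (auto simp: tm_of_def)
    ultimately show ?thesis unfolding accepts_iff rejects_iff by (metis fst_conv)
  qed
  then show ?thesis using wf_tm_of[OF ok] unfolding decidable_def by blast
qed

section \<open>Primitive recursive functions\<close>

lemma exec_Seq: "exec P s s' \<Longrightarrow> exec Q s' s'' \<Longrightarrow> t = s'' \<Longrightarrow> exec (P ;; Q) s t"
  by (auto intro: exec.Seq)

lemma exec_cong: "exec P s s' \<Longrightarrow> t = s' \<Longrightarrow> exec P s t"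
  by simp

text \<open>Covers loops that act as for-loops. \<open>S k\<close> is the state after
  \<open>k\<close> passes; since the test decrements the counter, the body starts with
  \<open>r\<close> already at \<open>s r - Suc k\<close> and has to end with that same
  value.\<close>

lemma exec_Loop:
  assumes "\<And>k. k < s r \<Longrightarrow> exec P ((S k)(r := s r - Suc k)) (S (Suc k))"
    and "\<And>k. k \<le> s r \<Longrightarrow> S k r = s r - k" and "S 0 = s" and "t = S (s r)"
  shows "exec (Loop r P) s t"
proof -
  \<comment> \<open>Induction on the number \<open>k\<close> of passes still to come.\<close>
  have "k \<le> s r \<Longrightarrow> exec (Loop r P) (S (s r - k)) (S (s r))" for k
  proof (induction k)
    case 0
    then show ?case using assms(2)[of "s r"] by (simp add: exec.Loop0)
  next
    case (Suc k)
    define j where "j = s r - Suc k"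
    have j: "j < s r" "Suc j = s r - k" "s r - Suc j = k" "s r - j = Suc k"
      using Suc.prems by (auto simp: j_def)
    have "S j r = Suc k" using assms(2)[of j] j by simp
    moreover have "exec P ((S j)(r := k)) (S (s r - k))"
      using assms(1)[OF j(1), unfolded j(3), unfolded j(2)] .
    moreover have "exec (Loop r P) (S (s r - k)) (S (s r))" using Suc by simp
    ultimately show ?case unfolding j_def[symmetric] by (rule exec.LoopSuc)
  qed
  from this[of "s r"] show ?thesis using assms(3,4) by simp
qed

definition clear :: "nat \<Rightarrow> prog" where
  "clear a = Loop a Skip"

definition move :: "nat \<Rightarrow> nat \<Rightarrow> prog" where
  "move a b = Loop a (Inc b)"

text \<open>Reading a register empties it, hence the detour: \<open>a\<close> is emptied into
  \<open>b\<close> and the scratch register \<open>c\<close>, and then refilled from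
  \<open>c\<close>.\<close>

definition copy :: "nat \<Rightarrow> nat \<Rightarrow> nat \<Rightarrow> prog" where
  "copy a b c = Loop a (Inc b ;; Inc c) ;; move c a"

lemma exec_clear: "exec (clear a) s (s(a := 0))"
  unfolding clear_def
  by (rule exec_Loop[where S = "\<lambda>k. s(a := s a - k)"]) (auto intro: exec.Skip)

lemma exec_move: "a \<noteq> b \<Longrightarrow> exec (move a b) s (s(a := 0, b := s b + s a))"
  unfolding move_def
  by (rule exec_Loop[where S = "\<lambda>k. s(a := s a - k, b := s b + k)"])
     (auto intro!: exec_cong[OF exec.Inc] simp: fun_eq_iff)

lemma exec_copy:
  assumes "a \<noteq> b" "a \<noteq> c" "b \<noteq> c" "s c = 0"
  shows "exec (copy a b c) s (s(b := s b + s a))"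
  unfolding copy_def
proof (rule exec_Seq)
  show "exec (Loop a (Inc b ;; Inc c)) s (s(a := 0, b := s b + s a, c := s a))"
    by (rule exec_Loop[where S = "\<lambda>k. s(a := s a - k, b := s b + k, c := k)"])
       (use assms in \<open>auto intro!: exec_Seq[OF exec.Inc exec.Inc] simp: fun_eq_iff\<close>)
  show "exec (move c a) (s(a := 0, b := s b + s a, c := s a)) (s(b := s b + s a))"
    by (rule exec_cong[OF exec_move]) (use assms in \<open>auto simp: fun_eq_iff\<close>)
qed auto

text \<open>\<open>decode a b\<close> enumerates the pairs in the order of their codes; registers \<open>a\<close> and \<open>b\<close>
  are initially zero.\<close>

definition decode :: "nat \<Rightarrow> nat \<Rightarrow> prog" where
  "decode a b = Loop 0 (Branch b (Inc a) (move a b ;; Inc b))"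

text \<open>Follows \<open>prod_encode (x, y) = triangle (x + y) + x\<close>: register 0 receives
  \<open>x\<close>, \<open>c\<close> collects \<open>x + y\<close>, and the outer loop adds
  \<open>c + (c - 1) + ... + 1\<close> to register 0. The inner loop saves the counter in
  \<open>d\<close> while adding it.\<close>

definition encode :: "nat \<Rightarrow> nat \<Rightarrow> nat \<Rightarrow> nat \<Rightarrow> prog" where
  "encode a b c d = Loop a (Inc 0 ;; Inc c) ;; Loop b (Inc c) ;;
     Loop c (Inc 0 ;; Loop c (Inc 0 ;; Inc d) ;; move d c)"

text \<open>The pairing runs along the antidiagonals: after the last pair \<open>(a, 0)\<close> of
  one of them comes the first pair \<open>(0, Suc a)\<close> of the next.\<close>

lemma prod_decode_Suc:
  "prod_decode (Suc n) = (case prod_decode n of (a, b) \<Rightarrow> if b = 0 then (0, Suc a) else (Suc a, b - 1))"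
proof -
  obtain a b where ab: "prod_decode n = (a, b)" by force
  then have n: "n = prod_encode (a, b)" by (metis prod_decode_inverse)
  have "Suc n = prod_encode (if b = 0 then (0, Suc a) else (Suc a, b - 1))"
    unfolding n by (cases b) (auto simp: prod_encode_def)
  then show ?thesis using ab by (metis (no_types, lifting) case_prod_conv prod_encode_inverse)
qed

lemma exec_decode:
  assumes "0 < a" "0 < b" "a \<noteq> b" "s a = 0" "s b = 0"
  shows "exec (decode a b) s (s(0 := 0, a := fst (prod_decode (s 0)), b := snd (prod_decode (s 0))))"
  unfolding decode_def
proof (rule exec_Loop[where S = "\<lambda>k. s(0 := s 0 - k, a := fst (prod_decode k), b := snd (prod_decode k))"])
  have "prod_decode 0 = (0, 0)" by (simp add: prod_decode_def prod_decode_aux.simps)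
  then show "s(0 := s 0 - 0, a := fst (prod_decode 0), b := snd (prod_decode 0)) = s"
    using assms by (auto simp: fun_eq_iff)
next
  fix k assume "k < s 0"
  obtain x y where xy: "prod_decode k = (x, y)" by force
  let ?s = "s(0 := s 0 - Suc k, a := x, b := y)"
  let ?t = "s(0 := s 0 - Suc k, a := fst (prod_decode (Suc k)), b := snd (prod_decode (Suc k)))"
  have "exec (Branch b (Inc a) (move a b ;; Inc b)) ?s ?t"
  proof (cases y)
    case 0
    have "exec (move a b ;; Inc b) ?s ?t"
      by (rule exec_Seq[OF exec_move exec.Inc])
         (use assms 0 xy in \<open>auto simp: prod_decode_Suc fun_eq_iff\<close>)
    then show ?thesis using 0 by (intro exec.Branch0) auto
  next
    case (Suc m)
    have "exec (Inc a) (?s(b := m)) ?t"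
      by (rule exec_cong[OF exec.Inc]) (use assms Suc xy in \<open>auto simp: prod_decode_Suc fun_eq_iff\<close>)
    then show ?thesis using Suc by (intro exec.BranchSuc[where m = m]) auto
  qed
  moreover have "(s(0 := s 0 - k, a := x, b := y)) (0 := s 0 - Suc k) = ?s"
    using assms by (auto simp: fun_eq_iff)
  ultimately show "exec (Branch b (Inc a) (move a b ;; Inc b))
      ((s(0 := s 0 - k, a := fst (prod_decode k), b := snd (prod_decode k)))(0 := s 0 - Suc k)) ?t"
    by (simp add: xy)
qed (use assms in auto)

lemma exec_encode:
  assumes "distinct [0, a, b, c, d]" "s 0 = 0" "s c = 0" "s d = 0"
  shows "exec (encode a b c d) s (s(0 := prod_encode (s a, s b), a := 0, b := 0))"
  unfolding encode_def
proof (rule exec_Seq)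
  let ?s1 = "s(0 := s a, a := 0, c := s a)"
  show "exec (Loop a (Inc 0 ;; Inc c)) s ?s1"
    by (rule exec_Loop[where S = "\<lambda>k. s(0 := k, a := s a - k, c := k)"])
       (use assms in \<open>auto intro!: exec_Seq[OF exec.Inc exec.Inc] simp: fun_eq_iff\<close>)
  let ?n = "s a + s b"
  let ?s2 = "s(0 := s a, a := 0, b := 0, c := ?n)"
  let ?s3 = "s(0 := s a + triangle ?n, a := 0, b := 0)"
  show "exec (Loop b (Inc c) ;; Loop c (Inc 0 ;; Loop c (Inc 0 ;; Inc d) ;; move d c)) ?s1 ?s3"
  proof (rule exec_Seq)
    show "exec (Loop b (Inc c)) ?s1 ?s2"
      by (rule exec_Loop[where S = "\<lambda>k. s(0 := s a, a := 0, b := s b - k, c := s a + k)"])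
         (use assms in \<open>auto intro!: exec_cong[OF exec.Inc] simp: fun_eq_iff\<close>)
    \<comment> \<open>The difference of triangular numbers is what the first \<open>k\<close> passes
      have added: \<open>?n + (?n - 1) + ...\<close> with \<open>k\<close> summands.\<close>
    let ?S = "\<lambda>k. s(0 := s a + (triangle ?n - triangle (?n - k)), a := 0, b := 0, c := ?n - k)"
    show "exec (Loop c (Inc 0 ;; Loop c (Inc 0 ;; Inc d) ;; move d c)) ?s2 ?s3"
    proof (rule exec_Loop[where S = ?S])
      fix k assume "k < ?s2 c"
      then have k: "k < ?n" by simp
      define m where "m = ?n - Suc k"
      have m: "?n - k = Suc m" using k by (simp add: m_def)
      have mono: "triangle j \<le> triangle (i + j)" for i j by (induction i) auto
      have "k + Suc m = ?n" using k m by simp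
      then have le: "triangle (Suc m) \<le> triangle ?n" using mono[of "Suc m" k] by metis
      let ?x = "s a + (triangle ?n - triangle (Suc m))"
      let ?t1 = "s(0 := ?x, a := 0, b := 0, c := m)"
      let ?t2 = "s(0 := Suc ?x, a := 0, b := 0, c := m)"
      let ?t3 = "s(0 := Suc ?x + m, a := 0, b := 0, c := 0, d := m)"
      let ?t4 = "s(0 := s a + (triangle ?n - triangle m), a := 0, b := 0, c := m)"
      have "exec (Inc 0 ;; Loop c (Inc 0 ;; Inc d) ;; move d c) ?t1 ?t4"
      proof (rule exec_Seq)
        show "exec (Inc 0) ?t1 ?t2"
          by (rule exec_cong[OF exec.Inc]) (use assms in \<open>auto simp: fun_eq_iff\<close>)
        show "exec (Loop c (Inc 0 ;; Inc d) ;; move d c) ?t2 ?t4"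
        proof (rule exec_Seq)
          show "exec (Loop c (Inc 0 ;; Inc d)) ?t2 ?t3"
            by (rule exec_Loop[where S = "\<lambda>k. s(0 := Suc ?x + k, a := 0, b := 0, c := m - k, d := k)"])
               (use assms in \<open>auto intro!: exec_Seq[OF exec.Inc exec.Inc] simp: fun_eq_iff\<close>)
          show "exec (move d c) ?t3 ?t4"
            by (rule exec_cong[OF exec_move]) (use assms le in \<open>auto simp: fun_eq_iff\<close>)
        qed simp
      qed simp
      moreover have "(?S k)(c := ?s2 c - Suc k) = ?t1" "?S (Suc k) = ?t4"
        using m assms by (auto simp: m_def)
      ultimately show "exec (Inc 0 ;; Loop c (Inc 0 ;; Inc d) ;; move d c)
          ((?S k)(c := ?s2 c - Suc k)) (?S (Suc k))" by simp
    qed (use assms in \<open>auto simp: fun_eq_iff\<close>)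
  qed simp
qed (use assms in \<open>auto simp: prod_encode_def fun_eq_iff\<close>)

text \<open>A unary function is computed in place in register 0, by programs that preserve the registers
  below any given bound and use those from the bound on as scratch, zero before and after.\<close>

definition computable :: "(nat \<Rightarrow> nat) \<Rightarrow> bool" where
  "computable f \<longleftrightarrow>
     (\<forall>K > 0. \<exists>P. \<forall>s. (\<forall>r \<ge> K. s r = 0) \<longrightarrow> exec P s (s(0 := f (s 0))))"

lemma computableE:
  assumes "computable f" "K > 0"
  obtains P where "\<And>s. (\<And>r. r \<ge> K \<Longrightarrow> s r = 0) \<Longrightarrow> exec P s (s(0 := f (s 0)))"
  using assms unfolding computable_def by blast

lemma computable_zero: "computable (\<lambda>_. 0)"
  unfolding computable_def by (auto intro!: exI[of _ "clear 0"] exec_clear)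

lemma computable_Suc: "computable Suc"
  unfolding computable_def by (auto intro!: exI[of _ "Inc 0"] exec.Inc)

lemma computable_fst: "computable (\<lambda>x. fst (prod_decode x))"
  unfolding computable_def
proof (intro allI impI)
  fix K :: nat assume K: "K > 0"
  have "exec (decode K (Suc K) ;; clear (Suc K) ;; move K 0) s (s(0 := fst (prod_decode (s 0))))"
    if "\<forall>r \<ge> K. s r = 0" for s
    by (rule exec_Seq[OF exec_decode exec.Seq[OF exec_clear exec_move]])
       (use K that in \<open>auto simp: fun_eq_iff\<close>)
  then show "\<exists>P. \<forall>s. (\<forall>r \<ge> K. s r = 0) \<longrightarrow> exec P s (s(0 := fst (prod_decode (s 0))))"
    by blast
qed

lemma computable_snd: "computable (\<lambda>x. snd (prod_decode x))"
  unfolding computable_def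
proof (intro allI impI)
  fix K :: nat assume K: "K > 0"
  have "exec (decode K (Suc K) ;; clear K ;; move (Suc K) 0) s (s(0 := snd (prod_decode (s 0))))"
    if "\<forall>r \<ge> K. s r = 0" for s
    by (rule exec_Seq[OF exec_decode exec.Seq[OF exec_clear exec_move]])
       (use K that in \<open>auto simp: fun_eq_iff\<close>)
  then show "\<exists>P. \<forall>s. (\<forall>r \<ge> K. s r = 0) \<longrightarrow> exec P s (s(0 := snd (prod_decode (s 0))))"
    by blast
qed

lemma computable_comp:
  assumes "computable f" "computable g"
  shows "computable (\<lambda>x. f (g x))"
  unfolding computable_def
proof (intro allI impI)
  fix K :: nat assume K: "K > 0"
  obtain P where P: "\<And>s. (\<And>r. r \<ge> K \<Longrightarrow> s r = 0) \<Longrightarrow> exec P s (s(0 := f (s 0)))"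
    using computableE[OF assms(1) K] by blast
  obtain Q where Q: "\<And>s. (\<And>r. r \<ge> K \<Longrightarrow> s r = 0) \<Longrightarrow> exec Q s (s(0 := g (s 0)))"
    using computableE[OF assms(2) K] by blast
  show "\<exists>P. \<forall>s. (\<forall>r \<ge> K. s r = 0) \<longrightarrow> exec P s (s(0 := f (g (s 0))))"
    by (intro exI[of _ "Q ;; P"] allI impI exec_Seq[OF Q P]) (use K in auto)
qed

lemma computable_pair:
  assumes "computable f" "computable g"
  shows "computable (\<lambda>x. prod_encode (f x, g x))"
  unfolding computable_def
proof (intro allI impI)
  fix K :: nat assume K: "K > 0"
  obtain P where P: "\<And>s. (\<And>r. r \<ge> Suc K \<Longrightarrow> s r = 0) \<Longrightarrow> exec P s (s(0 := f (s 0)))"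
    using computableE[OF assms(1) zero_less_Suc] by blast
  obtain Q where Q: "\<And>s. (\<And>r. r \<ge> Suc (Suc K) \<Longrightarrow> s r = 0) \<Longrightarrow> exec Q s (s(0 := g (s 0)))"
    using computableE[OF assms(2) zero_less_Suc] by blast
  \<comment> \<open>The scratch bounds of \<open>P\<close> and \<open>Q\<close> are raised by one
    and two, because register \<open>K\<close> keeps the argument while \<open>P\<close> runs and
    \<open>K + 1\<close> keeps the first result while \<open>Q\<close> runs.\<close>
  let ?P = "copy 0 K (K + 1) ;; P ;; move 0 (K + 1) ;; move K 0 ;; Q ;; move 0 (K + 2) ;;
    encode (K + 1) (K + 2) (K + 3) (K + 4)"
  have "exec ?P s (s(0 := prod_encode (f (s 0), g (s 0))))" if "\<forall>r \<ge> K. s r = 0" for s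
    by (rule exec_Seq[OF exec_copy exec.Seq[OF P exec.Seq[OF exec_move exec.Seq[OF exec_move
          exec.Seq[OF Q exec.Seq[OF exec_move exec_encode]]]]]])
       (use K that in \<open>auto simp: fun_eq_iff\<close>)
  then show "\<exists>P. \<forall>s. (\<forall>r \<ge> K. s r = 0) \<longrightarrow> exec P s (s(0 := prod_encode (f (s 0), g (s 0))))"
    by blast
qed

text \<open>Together with projections, pairing and composition, iteration is enough to obtain
  primitive recursion. Since all functions are unary, the number of iterations is part of the coded
  argument.\<close>

lemma computable_funpow:
  assumes "computable f"
  shows "computable (\<lambda>x. (f ^^ snd (prod_decode x)) (fst (prod_decode x)))"
  unfolding computable_def
proof (intro allI impI)
  fix K :: nat assume K: "K > 0"
  obtain P where P: "\<And>s. (\<And>r. r \<ge> Suc (Suc K) \<Longrightarrow> s r = 0) \<Longrightarrow> exec P s (s(0 := f (s 0)))"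
    using computableE[OF assms zero_less_Suc] by blast
  let ?P = "(decode K (K + 1) ;; move K 0) ;; Loop (K + 1) P"
  let ?f = "\<lambda>x. (f ^^ snd (prod_decode x)) (fst (prod_decode x))"
  have "exec ?P s (s(0 := ?f (s 0)))" if s: "\<forall>r \<ge> K. s r = 0" for s
  proof -
    obtain a n where an: "prod_decode (s 0) = (a, n)" by force
    have "exec (decode K (K + 1) ;; move K 0) s (s(0 := a, K + 1 := n))"
      by (rule exec_Seq[OF exec_decode exec_move]) (use an K s in \<open>auto simp: fun_eq_iff\<close>)
    moreover have "exec (Loop (K + 1) P) (s(0 := a, K + 1 := n)) (s(0 := ?f (s 0)))"
      by (rule exec_Loop[where S = "\<lambda>k. s(0 := (f ^^ k) a, K + 1 := n - k)"])
         (use an K s in \<open>auto intro!: exec_cong[OF P] simp: fun_eq_iff\<close>)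
    ultimately show ?thesis by (rule exec.Seq)
  qed
  then show "\<exists>P. \<forall>s. (\<forall>r \<ge> K. s r = 0) \<longrightarrow> exec P s (s(0 := ?f (s 0)))" by blast
qed


lemma computable_id: "computable (\<lambda>x. x)"
  using computable_pair[OF computable_fst computable_snd] by simp

text \<open>The unbounded search for the least \<open>w\<close> with a nonzero verdict is one loop,
  kept alive by a flag. Testing the verdict decrements it, which leaves 0 for "no" and a positive
  number for "yes", as the acceptance convention demands.\<close>

lemma decidable_search:
  assumes "computable f"
    and halt: "\<And>x. \<exists>w. f (prod_encode (x, w)) \<noteq> 0"
    and no: "\<And>x w. f (prod_encode (x, w)) = 1 \<Longrightarrow> x \<notin> S"
    and yes: "\<And>x w. f (prod_encode (x, w)) > 1 \<Longrightarrow> x \<in> S"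
  shows "decidable S"
proof -
  let ?g = "\<lambda>x. prod_encode (x, 0)"
  let ?h = "\<lambda>z. prod_encode (fst (prod_decode z), Suc (snd (prod_decode z)))"
  have g: "computable ?g" by (intro computable_pair computable_id computable_zero)
  have h: "computable ?h"
    by (intro computable_pair computable_fst computable_comp[OF computable_Suc computable_snd])
  obtain F where F: "\<And>s. (\<And>r. r \<ge> 3 \<Longrightarrow> s r = 0) \<Longrightarrow> exec F s (s(0 := f (s 0)))"
    by (rule computableE[OF assms(1), of 3]) (simp, blast)
  obtain G where G: "\<And>s. (\<And>r. r \<ge> 3 \<Longrightarrow> s r = 0) \<Longrightarrow> exec G s (s(0 := ?g (s 0)))"
    by (rule computableE[OF g, of 3]) (simp, blast)
  obtain H where H: "\<And>s. (\<And>r. r \<ge> 3 \<Longrightarrow> s r = 0) \<Longrightarrow> exec H s (s(0 := ?h (s 0)))"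
    by (rule computableE[OF h, of 3]) (simp, blast)
  \<comment> \<open>Register 1 holds the pair of the instance and the current candidate, register 2
    the flag. The loop test has just cleared the flag when the body starts, so \<open>copy\<close>
    may use register 2 as scratch.\<close>
  let ?T = "\<lambda>x w k. (\<lambda>_. 0)(1 := prod_encode (x, w), 2 := k)"
  let ?B = "copy 1 0 2 ;; F ;; Branch 0 Skip (Inc 2 ;; move 1 0 ;; H ;; move 0 1)"
  have eval: "exec (copy 1 0 2 ;; F) (?T x w 0) ((?T x w 0)(0 := f (prod_encode (x, w))))" for x w
    by (rule exec_Seq[OF exec_copy F]) (auto simp: fun_eq_iff)
  have next_w: "exec ?B (?T x w 0) (?T x (Suc w) 1)" if "f (prod_encode (x, w)) = 0" for x w
  proof -
    have "exec (Inc 2 ;; move 1 0 ;; H ;; move 0 1) ((?T x w 0)(0 := 0)) (?T x (Suc w) 1)"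
      by (rule exec_Seq[OF exec.Inc exec.Seq[OF exec_move exec.Seq[OF H exec_move]]])
         (auto simp: fun_eq_iff)
    then have "exec (Branch 0 Skip (Inc 2 ;; move 1 0 ;; H ;; move 0 1)) ((?T x w 0)(0 := 0)) (?T x (Suc w) 1)"
      by (intro exec.Branch0) auto
    from exec.Seq[OF eval[of x w, unfolded that] this] show ?thesis
      by (auto elim!: exec.cases[of "_ ;; _"] intro: exec.Seq)
  qed
  have last_w: "exec ?B (?T x w 0) ((?T x w 0)(0 := m))" if "f (prod_encode (x, w)) = Suc m" for x w m
  proof -
    have "exec (Branch 0 Skip (Inc 2 ;; move 1 0 ;; H ;; move 0 1)) ((?T x w 0)(0 := Suc m)) ((?T x w 0)(0 := m))"
      by (rule exec.BranchSuc[where m = m]) (auto intro: exec.Skip simp: fun_upd_twist)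
    from exec.Seq[OF eval[of x w, unfolded that] this] show ?thesis
      by (auto elim!: exec.cases[of "_ ;; _"] intro: exec.Seq)
  qed
  have "\<exists>s. exec (G ;; Inc 2 ;; move 0 1 ;; Loop 2 ?B) ((\<lambda>_. 0)(0 := x)) s \<and> (s 0 \<noteq> 0 \<longleftrightarrow> x \<in> S)" for x
  proof -
    define w where "w = (LEAST w. f (prod_encode (x, w)) \<noteq> 0)"
    have w: "f (prod_encode (x, w)) \<noteq> 0" unfolding w_def by (rule LeastI_ex[OF halt])
    then obtain m where m: "f (prod_encode (x, w)) = Suc m" by (cases "f (prod_encode (x, w))") auto
    have before: "f (prod_encode (x, v)) = 0" if "v < w" for v
      using that not_less_Least unfolding w_def by blast
    have up: "(?T x v 1)(2 := 0) = ?T x v 0" for v by auto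
    have "exec (Loop 2 ?B) (?T x w 1) ((?T x w 0)(0 := m))"
      by (rule exec.LoopSuc[where m = 0, OF _ _ exec.Loop0], simp, unfold up, rule last_w[OF m], simp)
    moreover have "exec (Loop 2 ?B) (?T x v 1) s"
      if "exec (Loop 2 ?B) (?T x (Suc v) 1) s" "v < w" for v s
      by (rule exec.LoopSuc[where m = 0, OF _ _ that(1)], simp, unfold up, rule next_w[OF before[OF that(2)]])
    \<comment> \<open>Backwards from the successful candidate \<open>w\<close>: started at any
      earlier candidate, the loop ends in the same state.\<close>
    ultimately have "v \<le> w \<Longrightarrow> exec (Loop 2 ?B) (?T x (w - v) 1) ((?T x w 0)(0 := m))" for v
    proof (induction v)
      case (Suc v)
      then have "Suc (w - Suc v) = w - v" "w - Suc v < w" by auto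
      with Suc show ?case by (metis Suc_leD)
    qed simp
    from this[of w] have loop: "exec (Loop 2 ?B) (?T x 0 1) ((?T x w 0)(0 := m))" by simp
    have "exec (G ;; Inc 2 ;; move 0 1) ((\<lambda>_. 0)(0 := x)) (?T x 0 1)"
      by (rule exec_Seq[OF G exec.Seq[OF exec.Inc exec_move]]) (auto simp: fun_eq_iff)
    from exec.Seq[OF this loop]
    have "exec (G ;; Inc 2 ;; move 0 1 ;; Loop 2 ?B) ((\<lambda>_. 0)(0 := x)) ((?T x w 0)(0 := m))"
      by (auto elim!: exec.cases[of "_ ;; _"] intro: exec.Seq)
    moreover have "m \<noteq> 0 \<longleftrightarrow> x \<in> S" using no[of x w] yes[of x w] m by auto
    ultimately show ?thesis by (intro exI[of _ "(?T x w 0)(0 := m)"]) simp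
  qed
  then show ?thesis by (rule decidable_exec)
qed

section \<open>Closure of the computable functions under arithmetic and recursion\<close>

abbreviation p1 :: "nat \<Rightarrow> nat" where "p1 x \<equiv> fst (prod_decode x)"
abbreviation p2 :: "nat \<Rightarrow> nat" where "p2 x \<equiv> snd (prod_decode x)"

text \<open>The closure rules are stated for open terms: all parameters of a term are coded in the one
  argument \<open>x\<close>, and the rules for binders push the bound variable onto it with the pairing.\<close>

lemma computable_p1: "computable f \<Longrightarrow> computable (\<lambda>x. p1 (f x))"
  and computable_p2: "computable f \<Longrightarrow> computable (\<lambda>x. p2 (f x))"
  and computable_Suc': "computable f \<Longrightarrow> computable (\<lambda>x. Suc (f x))"
  by (rule computable_comp[OF computable_fst] computable_comp[OF computable_snd]
        computable_comp[OF computable_Suc], assumption)+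

lemma computable_const: "computable (\<lambda>_. c)"
  by (induction c) (auto intro: computable_zero computable_Suc')

text \<open>The parameter \<open>x\<close> is carried along unchanged in the first component, so
  that a single function without parameters is iterated.\<close>

lemma computable_iter:
  assumes F: "computable (\<lambda>z. F (p1 z) (p2 z))" and N: "computable N" and A: "computable A"
  shows "computable (\<lambda>x. (F x ^^ N x) (A x))"
proof -
  let ?G = "\<lambda>z. prod_encode (p1 z, F (p1 z) (p2 z))"
  have "(?G ^^ n) (prod_encode (x, a)) = prod_encode (x, (F x ^^ n) a)" for n x a
    by (induction n) auto
  then have "(F x ^^ N x) (A x) = p2 ((\<lambda>z. (?G ^^ p2 z) (p1 z)) (prod_encode (prod_encode (x, A x), N x)))" for x
    by simp
  moreover have "computable (\<lambda>x. p2 ((\<lambda>z. (?G ^^ p2 z) (p1 z)) (prod_encode (prod_encode (x, A x), N x))))"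
    by (intro computable_p2 computable_comp[OF computable_funpow] computable_pair computable_id
        computable_fst F N A)
  ultimately show ?thesis by simp
qed

text \<open>Primitive recursion is iteration on the pair of the recursion counter and the value
  reached so far.\<close>

lemma computable_rec:
  assumes H: "computable (\<lambda>z. H (p1 (p1 z)) (p2 (p1 z)) (p2 z))" and N: "computable N" and A: "computable A"
  shows "computable (\<lambda>x. rec_nat (A x) (H x) (N x))"
proof -
  let ?G = "\<lambda>x s. prod_encode (Suc (p1 s), H x (p1 s) (p2 s))"
  have "(?G x ^^ n) (prod_encode (0, a)) = prod_encode (n, rec_nat a (H x) n)" for n x a
    by (induction n) auto
  then have "rec_nat (A x) (H x) (N x) = p2 ((?G x ^^ N x) (prod_encode (0, A x)))" for x
    by simp
  moreover have "computable (\<lambda>x. p2 ((?G x ^^ N x) (prod_encode (0, A x))))"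
  proof (intro computable_p2 computable_iter computable_pair computable_const N A computable_Suc'
      computable_p1 computable_id)
    have "computable (\<lambda>z. (\<lambda>z. H (p1 (p1 z)) (p2 (p1 z)) (p2 z))
        (prod_encode (prod_encode (p1 z, p1 (p2 z)), p2 (p2 z))))"
      by (intro computable_comp[OF H] computable_pair computable_p1 computable_p2 computable_id)
    then show "computable (\<lambda>z. H (p1 z) (p1 (p2 z)) (p2 (p2 z)))" by simp
  qed
  ultimately show ?thesis by simp
qed

lemma computable_add: "computable f \<Longrightarrow> computable g \<Longrightarrow> computable (\<lambda>x. f x + g x)"
proof -
  assume "computable f" "computable g"
  then have "computable (\<lambda>x. (Suc ^^ g x) (f x))"
    by (intro computable_iter computable_Suc' computable_p2 computable_id)
  moreover have "(Suc ^^ n) m = m + n" for n m by (induction n) auto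
  ultimately show ?thesis by (simp add: add.commute)
qed

lemma computable_mult: "computable f \<Longrightarrow> computable g \<Longrightarrow> computable (\<lambda>x. f x * g x)"
proof -
  assume f: "computable f" and g: "computable g"
  have "computable (\<lambda>x. ((\<lambda>a. a + f x) ^^ g x) 0)"
    by (intro computable_iter computable_add computable_p2 computable_id computable_const g
        computable_comp[OF f] computable_fst)
  moreover have "((\<lambda>a. a + m) ^^ n) 0 = m * n" for n m :: nat by (induction n) auto
  ultimately show ?thesis by simp
qed

lemma computable_power: "computable f \<Longrightarrow> computable g \<Longrightarrow> computable (\<lambda>x. f x ^ g x)"
proof -
  assume f: "computable f" and g: "computable g"
  have "computable (\<lambda>x. ((\<lambda>a. a * f x) ^^ g x) 1)"
    by (intro computable_iter computable_mult computable_p2 computable_id computable_const g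
        computable_comp[OF f] computable_fst)
  moreover have "((\<lambda>a. a * m) ^^ n) 1 = m ^ n" for n m :: nat by (induction n) auto
  ultimately show ?thesis by simp
qed

lemma computable_diff: "computable f \<Longrightarrow> computable g \<Longrightarrow> computable (\<lambda>x. f x - g x)"
proof -
  assume f: "computable f" and g: "computable g"
  have "computable (\<lambda>x. rec_nat 0 (\<lambda>k _. k) (h x))" if "computable h" for h
    by (intro computable_rec computable_const that computable_p1 computable_p2 computable_id)
  moreover have "rec_nat 0 (\<lambda>k _. k) n = n - 1" for n by (cases n) auto
  ultimately have pred: "computable (\<lambda>x. h x - 1)" if "computable h" for h using that by simp
  have "computable (\<lambda>x. ((\<lambda>a. a - 1) ^^ g x) (f x))"
    by (intro computable_iter pred computable_p2 computable_id f g)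
  moreover have "((\<lambda>a. a - 1) ^^ n) m = m - n" for n m :: nat by (induction n) auto
  ultimately show ?thesis by simp
qed

lemma computable_fact: "computable f \<Longrightarrow> computable (\<lambda>x. fact (f x))"
proof -
  assume f: "computable f"
  have "computable (\<lambda>x. rec_nat 1 (\<lambda>k a. Suc k * a) (f x))"
    by (intro computable_rec computable_const f computable_mult computable_Suc' computable_p1
        computable_p2 computable_id)
  moreover have "rec_nat 1 (\<lambda>k a. Suc k * a) n = fact n" for n by (induction n) auto
  ultimately show ?thesis by simp
qed

section \<open>Decidable predicates and bounded quantifiers\<close>

definition decides :: "(nat \<Rightarrow> bool) \<Rightarrow> bool" where
  "decides P \<longleftrightarrow> computable (\<lambda>x. of_bool (P x))"

lemma computable_if_0:
  assumes c: "computable c" and f: "computable f" and g: "computable g"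
  shows "computable (\<lambda>x. if c x = 0 then f x else g x)"
proof -
  have "computable (\<lambda>x. rec_nat (f x) (\<lambda>_ _. g x) (c x))"
    by (intro computable_rec c f computable_comp[OF g] computable_p1 computable_id)
  moreover have "rec_nat a (\<lambda>_ _. b) n = (if n = 0 then a else b)" for a b n :: nat by (cases n) auto
  ultimately show ?thesis by simp
qed

lemma computable_if: "decides P \<Longrightarrow> computable f \<Longrightarrow> computable g \<Longrightarrow> computable (\<lambda>x. if P x then f x else g x)"
proof -
  assume "decides P" "computable f" "computable g"
  then have "computable (\<lambda>x. if of_bool (P x) = (0::nat) then g x else f x)"
    by (intro computable_if_0) (simp_all add: decides_def)
  moreover have "(if of_bool Q = (0::nat) then b else a) = (if Q then a else b)" for Q and a b :: nat
    by simp
  ultimately show ?thesis by simp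
qed

lemma decides_eq_0: "computable f \<Longrightarrow> decides (\<lambda>x. f x = 0)"
  unfolding decides_def of_bool_def by (intro computable_if_0 computable_const)

lemma decides_const: "decides (\<lambda>_. P)"
  unfolding decides_def by (rule computable_const)

lemma decides_not: "decides P \<Longrightarrow> decides (\<lambda>x. \<not> P x)"
  using decides_eq_0[of "\<lambda>x. of_bool (P x)"] unfolding decides_def by simp

lemma decides_conj: "decides P \<Longrightarrow> decides Q \<Longrightarrow> decides (\<lambda>x. P x \<and> Q x)"
  unfolding decides_def of_bool_conj by (rule computable_mult)

lemma decides_disj: "decides P \<Longrightarrow> decides Q \<Longrightarrow> decides (\<lambda>x. P x \<or> Q x)"
proof -
  assume "decides P" "decides Q"
  then have "decides (\<lambda>x. \<not> (\<not> P x \<and> \<not> Q x))" by (intro decides_not decides_conj)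
  then show ?thesis by simp
qed

lemma decides_imp: "decides P \<Longrightarrow> decides Q \<Longrightarrow> decides (\<lambda>x. P x \<longrightarrow> Q x)"
proof -
  assume "decides P" "decides Q"
  then have "decides (\<lambda>x. \<not> P x \<or> Q x)" by (intro decides_not decides_disj)
  then show ?thesis by simp
qed

lemma decides_le: "computable f \<Longrightarrow> computable g \<Longrightarrow> decides (\<lambda>x. f x \<le> g x)"
proof -
  assume "computable f" "computable g"
  then have "decides (\<lambda>x. f x - g x = 0)" by (intro decides_eq_0 computable_diff)
  then show ?thesis by simp
qed

lemma decides_less: "computable f \<Longrightarrow> computable g \<Longrightarrow> decides (\<lambda>x. f x < g x)"
proof -
  assume "computable f" "computable g"
  then have "decides (\<lambda>x. \<not> g x \<le> f x)" by (intro decides_not decides_le)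
  then show ?thesis by (simp add: not_le)
qed

lemma decides_eq: "computable f \<Longrightarrow> computable g \<Longrightarrow> decides (\<lambda>x. f x = g x)"
proof -
  assume "computable f" "computable g"
  then have "decides (\<lambda>x. f x \<le> g x \<and> g x \<le> f x)" by (intro decides_conj decides_le)
  then show ?thesis by (simp add: eq_iff)
qed

lemma decides_comp: "decides P \<Longrightarrow> computable f \<Longrightarrow> decides (\<lambda>x. P (f x))"
  unfolding decides_def by (rule computable_comp[of "\<lambda>x. of_bool (P x)"])

lemma computable_sum:
  assumes f: "computable (\<lambda>z. f (p1 z) (p2 z))" and n: "computable n"
  shows "computable (\<lambda>x. \<Sum>i<n x. f x i)"
proof -
  have "computable (\<lambda>z. (\<lambda>z. f (p1 z) (p2 z)) (prod_encode (p1 (p1 z), p2 (p1 z))))"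
    by (intro computable_comp[OF f] computable_pair computable_p1 computable_p2 computable_id)
  then have "computable (\<lambda>x. rec_nat 0 (\<lambda>i a. a + f x i) (n x))"
    by (intro computable_rec computable_const n computable_add computable_p2 computable_id) simp
  moreover have "rec_nat 0 (\<lambda>i a. a + g i) m = (\<Sum>i<m. g i)" for g :: "nat \<Rightarrow> nat" and m
    by (induction m) auto
  ultimately show ?thesis by simp
qed

lemma computable_prod:
  assumes f: "computable (\<lambda>z. f (p1 z) (p2 z))" and n: "computable n"
  shows "computable (\<lambda>x. \<Prod>i<n x. f x i)"
proof -
  have "computable (\<lambda>z. (\<lambda>z. f (p1 z) (p2 z)) (prod_encode (p1 (p1 z), p2 (p1 z))))"
    by (intro computable_comp[OF f] computable_pair computable_p1 computable_p2 computable_id)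
  then have "computable (\<lambda>x. rec_nat 1 (\<lambda>i a. a * f x i) (n x))"
    by (intro computable_rec computable_const n computable_mult computable_p2 computable_id) simp
  moreover have "rec_nat 1 (\<lambda>i a. a * g i) m = (\<Prod>i<m. g i)" for g :: "nat \<Rightarrow> nat" and m
    by (induction m) auto
  ultimately show ?thesis by simp
qed

lemma decides_all:
  assumes "decides (\<lambda>z. P (p1 z) (p2 z))" and n: "computable n"
  shows "decides (\<lambda>x. \<forall>i<n x. P x i)"
proof -
  have "computable (\<lambda>x. \<Prod>i<n x. of_bool (P x i))"
    using assms unfolding decides_def by (intro computable_prod)
  moreover have "(\<Prod>i<m. of_bool (Q i)) = (of_bool (\<forall>i<m. Q i) :: nat)" for Q and m :: nat
    by (induction m) (auto simp: less_Suc_eq)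
  ultimately show ?thesis by (simp add: decides_def)
qed

lemma decides_ex:
  assumes "decides (\<lambda>z. P (p1 z) (p2 z))" and n: "computable n"
  shows "decides (\<lambda>x. \<exists>i<n x. P x i)"
proof -
  have "decides (\<lambda>x. \<not> (\<forall>i<n x. \<not> P x i))"
    using assms by (intro decides_not decides_all)
  then show ?thesis by simp
qed

lemma computable_mod: "computable f \<Longrightarrow> computable g \<Longrightarrow> computable (\<lambda>x. f x mod g x)"
proof -
  assume f: "computable f" and g: "computable g"
  have "computable (\<lambda>x. rec_nat 0 (\<lambda>_ r. if Suc r = g x then 0 else Suc r) (f x))"
    by (intro computable_rec computable_const f computable_if decides_eq computable_Suc'
        computable_p2 computable_p1 computable_id computable_comp[OF g])
  moreover have "rec_nat 0 (\<lambda>_ r. if Suc r = m then 0 else Suc r) n = n mod m" for n m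
    by (induction n) (auto simp: mod_Suc)
  ultimately show ?thesis by simp
qed

lemma computable_div: "computable f \<Longrightarrow> computable g \<Longrightarrow> computable (\<lambda>x. f x div g x)"
proof -
  assume f: "computable f" and g: "computable g"
  have "computable (\<lambda>x. rec_nat 0 (\<lambda>k r. if Suc k mod g x = 0 then Suc r else r) (f x))"
    by (intro computable_rec computable_const f computable_if decides_eq computable_Suc' computable_mod
        computable_p2 computable_p1 computable_id computable_comp[OF g])
  moreover have "rec_nat 0 (\<lambda>k r. if Suc k mod m = 0 then Suc r else r) n = n div m" for n m
    by (induction n) (auto simp: div_Suc)
  ultimately show ?thesis by simp
qed

section \<open>Integer-valued functions\<close>

definition computable_int :: "(nat \<Rightarrow> int) \<Rightarrow> bool" where
  "computable_int f \<longleftrightarrow> computable (\<lambda>x. nat (f x)) \<and> computable (\<lambda>x. nat (- f x))"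

text \<open>Any representation as a difference suffices: truncated subtraction in both orders
  recovers the positive and the negative part.\<close>

lemma computable_intI:
  assumes "computable a" "computable b" "\<And>x. f x = int (a x) - int (b x)"
  shows "computable_int f"
proof -
  have "(\<lambda>x. nat (f x)) = (\<lambda>x. a x - b x)" "(\<lambda>x. nat (- f x)) = (\<lambda>x. b x - a x)"
    using assms(3) by (auto simp: fun_eq_iff)
  then show ?thesis unfolding computable_int_def
    using computable_diff[OF assms(1,2)] computable_diff[OF assms(2,1)] by simp
qed

lemma computable_intE:
  assumes "computable_int f"
  obtains a b where "computable a" "computable b" "\<And>x. f x = int (a x) - int (b x)"
  using assms that[of "\<lambda>x. nat (f x)" "\<lambda>x. nat (- f x)"] unfolding computable_int_def by auto

lemma computable_int_of_nat: "computable f \<Longrightarrow> computable_int (\<lambda>x. int (f x))"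
  by (rule computable_intI[OF _ computable_const[of 0]]) auto

lemma computable_int_const: "computable_int (\<lambda>_. c)"
  by (rule computable_intI[OF computable_const[of "nat c"] computable_const[of "nat (- c)"]]) auto

lemma computable_nat_abs: "computable_int f \<Longrightarrow> computable (\<lambda>x. nat \<bar>f x\<bar>)"
proof -
  assume "computable_int f"
  then have "computable (\<lambda>x. nat (f x) + nat (- f x))"
    unfolding computable_int_def by (intro computable_add) auto
  moreover have "nat a + nat (- a) = nat \<bar>a\<bar>" for a :: int by simp
  ultimately show ?thesis by simp
qed

lemma computable_int_uminus: "computable_int f \<Longrightarrow> computable_int (\<lambda>x. - f x)"
  unfolding computable_int_def by simp

lemma computable_int_add:
  assumes "computable_int f" "computable_int g"
  shows "computable_int (\<lambda>x. f x + g x)"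
proof -
  obtain a b where f: "computable a" "computable b" "\<And>x. f x = int (a x) - int (b x)"
    using computable_intE[OF assms(1)] by blast
  obtain c d where g: "computable c" "computable d" "\<And>x. g x = int (c x) - int (d x)"
    using computable_intE[OF assms(2)] by blast
  show ?thesis
    by (rule computable_intI[OF computable_add[OF f(1) g(1)] computable_add[OF f(2) g(2)]])
       (simp add: f(3) g(3))
qed

lemma computable_int_diff: "computable_int f \<Longrightarrow> computable_int g \<Longrightarrow> computable_int (\<lambda>x. f x - g x)"
proof -
  assume "computable_int f" "computable_int g"
  then have "computable_int (\<lambda>x. f x + - g x)" by (intro computable_int_add computable_int_uminus)
  then show ?thesis by simp
qed

lemma computable_int_mult:
  assumes "computable_int f" "computable_int g"
  shows "computable_int (\<lambda>x. f x * g x)"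
proof -
  obtain a b where f: "computable a" "computable b" "\<And>x. f x = int (a x) - int (b x)"
    using computable_intE[OF assms(1)] by blast
  obtain c d where g: "computable c" "computable d" "\<And>x. g x = int (c x) - int (d x)"
    using computable_intE[OF assms(2)] by blast
  show ?thesis
    by (rule computable_intI[OF
          computable_add[OF computable_mult[OF f(1) g(1)] computable_mult[OF f(2) g(2)]]
          computable_add[OF computable_mult[OF f(1) g(2)] computable_mult[OF f(2) g(1)]]])
       (simp add: f(3) g(3) algebra_simps)
qed

lemma decides_int_le:
  assumes "computable_int f" "computable_int g"
  shows "decides (\<lambda>x. f x \<le> g x)"
proof -
  have "decides (\<lambda>x. nat (f x - g x) = 0)"
    using computable_int_diff[OF assms] unfolding computable_int_def by (intro decides_eq_0) blast
  then show ?thesis by simp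
qed

lemma decides_int_eq: "computable_int f \<Longrightarrow> computable_int g \<Longrightarrow> decides (\<lambda>x. f x = g x)"
proof -
  assume "computable_int f" "computable_int g"
  then have "decides (\<lambda>x. f x \<le> g x \<and> g x \<le> f x)" by (intro decides_conj decides_int_le)
  then show ?thesis by (simp add: eq_iff)
qed

lemma computable_int_if:
  assumes "decides P" "computable_int f" "computable_int g"
  shows "computable_int (\<lambda>x. if P x then f x else g x)"
proof (rule computable_intI)
  show "computable (\<lambda>x. if P x then nat (f x) else nat (g x))"
    "computable (\<lambda>x. if P x then nat (- f x) else nat (- g x))"
    using assms unfolding computable_int_def by (auto intro: computable_if)
qed auto

lemma computable_int_sum:
  assumes f: "computable_int (\<lambda>z. f (p1 z) (p2 z))" and n: "computable n"
  shows "computable_int (\<lambda>x. \<Sum>i<n x. f x i)"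
  by (rule computable_intI[of "\<lambda>x. \<Sum>i<n x. nat (f x i)" "\<lambda>x. \<Sum>i<n x. nat (- f x i)"])
     (use f n in \<open>auto simp: computable_int_def sum_subtractf[symmetric] intro!: computable_sum sum.cong\<close>)

text \<open>Reduced to natural numbers: the sign is the parity of the number of negative factors,
  the absolute value is the product of the absolute values.\<close>

lemma computable_int_prod:
  assumes f: "computable_int (\<lambda>z. f (p1 z) (p2 z))" and n: "computable n"
  shows "computable_int (\<lambda>x. \<Prod>i<n x. f x i)"
proof -
  let ?m = "\<lambda>x. \<Sum>i<n x. of_bool (\<not> 0 \<le> f x i) :: nat"
  let ?a = "\<lambda>x. \<Prod>i<n x. nat \<bar>f x i\<bar>"
  have eq: "(\<Prod>i<k. g i) = (if (\<Sum>i<k. of_bool (\<not> 0 \<le> g i)) mod 2 = (0::nat) then 1 else - 1) * int (\<Prod>i<k. nat \<bar>g i\<bar>)"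
    for g :: "nat \<Rightarrow> int" and k
    by (induction k) (auto simp: mod_Suc)
  have "decides (\<lambda>z. \<not> 0 \<le> f (p1 z) (p2 z))"
    by (intro decides_not decides_int_le computable_int_const f)
  then have "computable ?m" using n unfolding decides_def by (rule computable_sum)
  then have m: "decides (\<lambda>x. ?m x mod 2 = 0)"
    by (intro decides_eq computable_mod computable_const)
  have "computable ?a" by (rule computable_prod[OF computable_nat_abs[OF f] n])
  with m have "computable_int (\<lambda>x. (if ?m x mod 2 = 0 then 1 else - 1) * int (?a x))"
    by (intro computable_int_mult computable_int_if computable_int_const computable_int_of_nat)
  then show ?thesis unfolding eq .
qed

lemma computable_int_comp: "computable_int f \<Longrightarrow> computable g \<Longrightarrow> computable_int (\<lambda>x. f (g x))"
  unfolding computable_int_def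
  by (auto intro: computable_comp[of "\<lambda>x. nat (f x)"] computable_comp[of "\<lambda>x. nat (- f x)"])

lemma computable_int_power:
  assumes "computable_int f" "computable n"
  shows "computable_int (\<lambda>x. f x ^ n x)"
proof -
  have "computable_int (\<lambda>z. f (p1 z))"
    by (rule computable_int_comp[OF assms(1) computable_fst])
  then have "computable_int (\<lambda>x. \<Prod>i<n x. f x)" using assms(2) by (rule computable_int_prod)
  then show ?thesis by simp
qed

lemma computable_int_decode:
  assumes "computable f"
  shows "computable_int (\<lambda>x. int_decode (f x))"
proof (rule computable_intI)
  show "computable (\<lambda>x. if f x mod 2 = 0 then f x div 2 else 0)"
    "computable (\<lambda>x. if f x mod 2 = 0 then 0 else Suc (f x div 2))"
    by (intro computable_if decides_eq computable_mod computable_div computable_const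
        computable_Suc' assms)+
  have "int_decode n = int (if n mod 2 = 0 then n div 2 else 0) - int (if n mod 2 = 0 then 0 else Suc (n div 2))" for n
    by (simp add: int_decode_def sum_decode_def even_iff_mod_2_eq_zero)
  then show "int_decode (f x) = int (if f x mod 2 = 0 then f x div 2 else 0) -
      int (if f x mod 2 = 0 then 0 else Suc (f x div 2))" for x .
qed

lemmas computable_intros =
  computable_id computable_const computable_p1 computable_p2 computable_Suc' computable_pair
  computable_add computable_mult computable_power computable_diff computable_fact computable_if
  computable_sum computable_prod computable_mod computable_div computable_nat_abs
  decides_const decides_not decides_conj decides_disj decides_imp decides_le decides_less decides_eq
  decides_all decides_ex decides_int_le decides_int_eq
  computable_int_of_nat computable_int_const computable_int_uminus computable_int_add
  computable_int_diff computable_int_mult computable_int_if computable_int_sum computable_int_prod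
  computable_int_power computable_int_decode

section \<open>Eigenvalues of the powers of a rational matrix\<close>

lemma pow_mat_add:
  fixes A :: "'a :: semiring_1 mat"
  assumes A: "A \<in> carrier_mat n n"
  shows "A ^\<^sub>m (k + l) = A ^\<^sub>m k * A ^\<^sub>m l"
proof (induction l)
  case (Suc l)
  then show ?case
    using assoc_mult_mat[OF pow_carrier_mat[OF A] pow_carrier_mat[OF A] A, of k l] by simp
qed (use A in simp)

lemma smult_smult_mat: "a \<cdot>\<^sub>m (b \<cdot>\<^sub>m A) = (a * b :: 'a :: semigroup_mult) \<cdot>\<^sub>m A"
  by (rule eq_matI) (auto simp: mult.assoc)

lemma upper_triangular_mult:
  fixes A B :: "'a :: comm_ring_1 mat"
  assumes A: "A \<in> carrier_mat n n" "upper_triangular A" and B: "B \<in> carrier_mat n n" "upper_triangular B"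
  shows "upper_triangular (A * B)" and "i < n \<Longrightarrow> (A * B) $$ (i, i) = A $$ (i, i) * B $$ (i, i)"
proof -
  have entry: "(A * B) $$ (i, j) = (\<Sum>k = 0..<n. A $$ (i, k) * B $$ (k, j))" if "i < n" "j < n" for i j
    using that A B by (simp add: scalar_prod_def)
  have zero: "A $$ (i, j) = 0" "B $$ (i, j) = 0" if "j < i" "i < n" for i j
    using upper_triangularD[OF A(2), of j i] upper_triangularD[OF B(2), of j i] that A(1) B(1) by auto
  show "upper_triangular (A * B)"
  proof
    fix i j assume ij: "j < i" "i < dim_row (A * B)"
    have "A $$ (i, k) * B $$ (k, j) = 0" if "k < n" for k
      using that ij A B zero by (cases "k < i") auto
    then show "(A * B) $$ (i, j) = 0" using ij A entry by auto
  qed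
  assume i: "i < n"
  have "A $$ (i, k) * B $$ (k, i) = (if k = i then A $$ (i, i) * B $$ (i, i) else 0)" if "k < n" for k
    using that i zero by (cases k i rule: linorder_cases) auto
  then have "(A * B) $$ (i, i) = (\<Sum>k = 0..<n. if k = i then A $$ (i, i) * B $$ (i, i) else 0)"
    unfolding entry[OF i i] by (intro sum.cong) auto
  then show "(A * B) $$ (i, i) = A $$ (i, i) * B $$ (i, i)" using i by simp
qed

lemma upper_triangular_pow:
  fixes A :: "'a :: comm_ring_1 mat"
  assumes A: "A \<in> carrier_mat n n" "upper_triangular A"
  shows "upper_triangular (A ^\<^sub>m k) \<and> (\<forall>i<n. (A ^\<^sub>m k) $$ (i, i) = A $$ (i, i) ^ k)"
proof (induction k)
  case (Suc k)
  have "A ^\<^sub>m k \<in> carrier_mat n n" using A by simp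
  then show ?case using Suc upper_triangular_mult[of "A ^\<^sub>m k" n A] A by (auto simp: mult.commute)
qed (use A in auto)

text \<open>Every factor pushes the support up by one diagonal: the entry \<open>(i, j)\<close> of
  \<open>T ^ k\<close> vanishes for \<open>j < i + k\<close>.\<close>

lemma strictly_upper_triangular_pow:
  fixes T :: "'a :: comm_ring_1 mat"
  assumes T: "T \<in> carrier_mat n n" "\<And>i j. i < n \<Longrightarrow> j \<le> i \<Longrightarrow> T $$ (i, j) = 0"
  shows "T ^\<^sub>m n = 0\<^sub>m n n"
proof -
  have "(T ^\<^sub>m k) $$ (i, j) = 0" if "i < n" "j < n" "j < i + k" for i j k
    using that
  proof (induction k arbitrary: j)
    case (Suc k)
    have "(T ^\<^sub>m Suc k) $$ (i, j) = (\<Sum>m = 0..<n. (T ^\<^sub>m k) $$ (i, m) * T $$ (m, j))"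
      using Suc.prems T by (simp add: scalar_prod_def)
    also have "\<dots> = 0"
    proof (rule sum.neutral, rule ballI)
      fix m assume "m \<in> {0..<n}"
      then show "(T ^\<^sub>m k) $$ (i, m) * T $$ (m, j) = 0"
        using Suc.IH[of m] Suc.prems T(2)[of m j] by (cases "m < i + k") auto
    qed
    finally show ?case .
  qed (use T in auto)
  then show ?thesis using T(1) by (intro eq_matI) auto
qed

text \<open>The list of the complex eigenvalues with their multiplicities, read off a Schur form.\<close>

definition eigs :: "complex mat \<Rightarrow> complex list \<Rightarrow> bool" where
  "eigs A es \<longleftrightarrow> (\<exists>B P Q. similar_mat_wit A B P Q \<and> upper_triangular B \<and> diag_mat B = es)"

lemma eigs_ex:
  assumes "A \<in> carrier_mat n n"
  obtains es where "eigs A es"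
proof -
  obtain es where es: "char_poly A = (\<Prod>a\<leftarrow>es. [:- a, 1:])"
    using char_poly_factorized[OF assms] by blast
  obtain B P Q where "schur_decomposition A es = (B, P, Q)" by (cases "schur_decomposition A es")
  from schur_decomposition[OF assms es this] show ?thesis using that unfolding eigs_def by blast
qed

context
  fixes A :: "complex mat" and n es
  assumes A: "A \<in> carrier_mat n n" and eigs: "eigs A es"
begin

lemma eigs_wit:
  obtains B P Q where "similar_mat_wit A B P Q" "upper_triangular B" "B \<in> carrier_mat n n"
    "P \<in> carrier_mat n n" "Q \<in> carrier_mat n n" "P * Q = 1\<^sub>m n" "Q * P = 1\<^sub>m n"
    "\<forall>i<n. B $$ (i, i) = es ! i" "length es = n"
proof -
  obtain B P Q where w: "similar_mat_wit A B P Q" "upper_triangular B" "diag_mat B = es"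
    using eigs unfolding eigs_def by blast
  note c = similar_mat_witD2[OF A w(1)]
  show ?thesis
    by (rule that[OF w(1,2)]) (use c w(3) in \<open>auto simp: diag_mat_def\<close>)
qed

lemma length_eigs: "length es = n"
  using eigs_wit by blast

text \<open>Powers and multiples of the triangular form are triangular with \<open>c * e ^ m\<close>
  on the diagonal. The factor \<open>c\<close> is there for the denominator that makes a rational
  matrix integral.\<close>

lemma char_poly_smult_pow: "char_poly (c \<cdot>\<^sub>m A ^\<^sub>m m) = (\<Prod>a\<leftarrow>es. [:- (c * a ^ m), 1:])"
proof -
  obtain B P Q where w: "similar_mat_wit A B P Q" "upper_triangular B" "B \<in> carrier_mat n n"
    "P \<in> carrier_mat n n" "Q \<in> carrier_mat n n" "P * Q = 1\<^sub>m n" "Q * P = 1\<^sub>m n"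
    "\<forall>i<n. B $$ (i, i) = es ! i" "length es = n" by (rule eigs_wit)
  have Am: "A ^\<^sub>m m = P * B ^\<^sub>m m * Q" by (rule similar_mat_wit_pow_id[OF w(1)])
  have Bm: "B ^\<^sub>m m \<in> carrier_mat n n" using w(3) by simp
  have "c \<cdot>\<^sub>m A ^\<^sub>m m = P * (c \<cdot>\<^sub>m B ^\<^sub>m m) * Q"
    unfolding Am using Bm w(4,5)
    by (simp add: mult_smult_assoc_mat[of _ n n] mult_smult_distrib[of _ n n])
  then have "similar_mat (c \<cdot>\<^sub>m A ^\<^sub>m m) (c \<cdot>\<^sub>m B ^\<^sub>m m)"
    unfolding similar_mat_def similar_mat_wit_def Let_def using w A Bm
    by (intro exI[of _ P] exI[of _ Q]) auto
  then have "char_poly (c \<cdot>\<^sub>m A ^\<^sub>m m) = char_poly (c \<cdot>\<^sub>m B ^\<^sub>m m)" by (rule char_poly_similar)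
  also have "\<dots> = (\<Prod>a\<leftarrow>diag_mat (c \<cdot>\<^sub>m B ^\<^sub>m m). [:- a, 1:])"
    by (rule char_poly_upper_triangular[of _ n])
       (use Bm w(3) upper_triangular_pow[OF w(3,2), of m] in \<open>auto simp: upper_triangular_def\<close>)
  also have "diag_mat (c \<cdot>\<^sub>m B ^\<^sub>m m) = map (\<lambda>a. c * a ^ m) es"
    using Bm w(3,8,9) upper_triangular_pow[OF w(3,2), of m] by (auto simp: diag_mat_def intro!: nth_equalityI)
  finally show ?thesis by (simp add: o_def)
qed

text \<open>In triangular form the difference has the numbers \<open>e ^ (k + q) - e ^ k\<close> on
  the diagonal, and a triangular matrix is nilpotent exactly if its diagonal is zero. This turns a
  condition on algebraic numbers into a matrix identity that can be checked without them.\<close>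

lemma pow_diff_nilpotent_iff:
  "(A ^\<^sub>m (k + q) - A ^\<^sub>m k) ^\<^sub>m n = 0\<^sub>m n n \<longleftrightarrow> (\<forall>e \<in> set es. e ^ (k + q) = e ^ k)"
proof -
  obtain B P Q where w: "similar_mat_wit A B P Q" "upper_triangular B" "B \<in> carrier_mat n n"
    "P \<in> carrier_mat n n" "Q \<in> carrier_mat n n" "P * Q = 1\<^sub>m n" "Q * P = 1\<^sub>m n"
    "\<forall>i<n. B $$ (i, i) = es ! i" "length es = n" by (rule eigs_wit)
  define T where "T = B ^\<^sub>m (k + q) - B ^\<^sub>m k"
  define N where "N = A ^\<^sub>m (k + q) - A ^\<^sub>m k"
  have T: "T \<in> carrier_mat n n" unfolding T_def by (intro minus_carrier_mat pow_carrier_mat w(3))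
  have N: "N \<in> carrier_mat n n" unfolding N_def by (intro minus_carrier_mat pow_carrier_mat A)
  have Bm: "B ^\<^sub>m m \<in> carrier_mat n n" for m using w(3) by simp
  have Bt: "upper_triangular (B ^\<^sub>m m)" "i < n \<Longrightarrow> (B ^\<^sub>m m) $$ (i, i) = es ! i ^ m" for m i
    using upper_triangular_pow[OF w(3,2), of m] w(8) by auto
  have "N = P * B ^\<^sub>m (k + q) * Q - P * B ^\<^sub>m k * Q"
    unfolding N_def using similar_mat_wit_pow_id[OF w(1)] by simp
  also have "\<dots> = P * T * Q"
    unfolding T_def mult_minus_distrib_mat[OF w(4) Bm Bm]
    by (rule minus_mult_distrib_mat[symmetric, OF mult_carrier_mat[OF w(4) Bm] mult_carrier_mat[OF w(4) Bm] w(5)])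
  finally have "similar_mat_wit N T P Q"
    unfolding similar_mat_wit_def Let_def using w N T by auto
  then have NT: "N ^\<^sub>m n = P * T ^\<^sub>m n * Q" and TN: "T ^\<^sub>m n = Q * N ^\<^sub>m n * P"
    using similar_mat_wit_pow_id similar_mat_wit_sym by blast+
  have Tu: "upper_triangular T" using T Bt(1) Bm w(3) unfolding T_def upper_triangular_def by auto
  have Td: "T $$ (i, i) = es ! i ^ (k + q) - es ! i ^ k" if "i < n" for i
    using that Bm Bt w(3) by (simp add: T_def)
  have "N ^\<^sub>m n = 0\<^sub>m n n \<longleftrightarrow> T ^\<^sub>m n = 0\<^sub>m n n"
    using NT TN w(4,5) by (metis left_mult_zero_mat right_mult_zero_mat)
  also have "\<dots> \<longleftrightarrow> (\<forall>i<n. T $$ (i, i) = 0)"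
  proof
    assume "T ^\<^sub>m n = 0\<^sub>m n n"
    then show "\<forall>i<n. T $$ (i, i) = 0" using upper_triangular_pow[OF T Tu, of n] by auto
  next
    assume "\<forall>i<n. T $$ (i, i) = 0"
    then show "T ^\<^sub>m n = 0\<^sub>m n n" using T Tu
      by (intro strictly_upper_triangular_pow) (auto simp: le_less)
  qed
  also have "\<dots> \<longleftrightarrow> (\<forall>e \<in> set es. e ^ (k + q) = e ^ k)"
    using Td w(9) by (auto simp: all_set_conv_all_nth)
  finally show ?thesis unfolding N_def .
qed

end

section \<open>Integrality and periodicity of power sums of eigenvalues\<close>

lemma monic_prod_linear: "monic (\<Prod>a\<leftarrow>as. [:- a, 1 :: 'a :: idom:])"
  by (rule monic_prod_list) auto

lemma coeff_prod_linear:
  fixes as :: "'a :: idom list"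
  shows "as \<noteq> [] \<Longrightarrow> coeff (\<Prod>a\<leftarrow>as. [:- a, 1:]) (length as - 1) = - sum_list as"
proof (induction as)
  case (Cons a as)
  have lead: "coeff (\<Prod>a\<leftarrow>as. [:- a, 1:]) (length as) = 1" for as :: "'a list"
    using monic_prod_linear[of as] unfolding degree_linear_factors[of uminus as] .
  show ?case
  proof (cases as)
    case (Cons b bs)
    then have "coeff (\<Prod>a\<leftarrow>as. [:- a, 1:]) (length as - 1) = - sum_list as" using Cons.IH by simp
    then show ?thesis using lead[of as] Cons by (simp add: coeff_pCons')
  qed simp
qed simp

text \<open>Gauss's lemma: the primitive integral multiple of \<open>f\<close> divides
  \<open>h\<close> over the integers, so its leading coefficient divides 1 and is a unit.\<close>

lemma monic_rat_dvd_int: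
  fixes f :: "rat poly" and h :: "int poly"
  assumes "monic f" "monic h" "f dvd map_poly of_int h"
  shows "\<exists>g :: int poly. f = map_poly of_int g"
proof -
  obtain f' where f': "map_poly rat_of_int h = f * f'" using assms(3) by blast
  obtain r g where rg: "rat_to_normalized_int_poly f = (r, g)" by force
  from rat_to_normalized_int_poly[OF rg] have f: "f = Polynomial.smult r (map_poly of_int g)" by blast
  have "content h dvd coeff h (degree h)" by (rule content_dvd_coeff)
  then have "content h = 1" using assms(2) by (simp add: content_ge_0_int zdvd1_eq)
  then obtain g' where "h = g * g'" using rat_to_int_factor_explicit[OF f' rg] by auto
  then have "lead_coeff g * lead_coeff g' = 1" using assms(2) by (simp add: lead_coeff_mult)
  then have "lead_coeff g = 1 \<or> lead_coeff g = - 1" using zmult_eq_1_iff by blast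
  moreover have "1 = r * of_int (lead_coeff g)"
    using assms(1) f rat_to_normalized_int_poly(2)[OF rg] by (simp add: lead_coeff_smult degree_map_poly coeff_map_poly)
  ultimately have "r = 1 \<or> r = - 1" by auto
  then show ?thesis
  proof
    assume "r = - 1"
    then have "f = map_poly of_int (- g)" unfolding f by (simp add: of_int_poly_hom.hom_uminus)
    then show ?thesis by blast
  qed (use f in auto)
qed

text \<open>The product of monic integral polynomials with the given roots is a monic integral
  multiple of \<open>f\<close>. By Gauss's lemma \<open>f\<close> itself is integral, and by Vieta's
  formula the sum is the negative of one of its coefficients.\<close>

lemma sum_list_algebraic_int:
  fixes as :: "complex list" and f :: "rat poly"
  assumes f: "(\<Prod>a\<leftarrow>as. [:- a, 1:]) = map_poly of_rat f" and int: "\<forall>a \<in> set as. algebraic_int a"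
  shows "sum_list as \<in> \<int>"
proof (cases "as = []")
  case False
  have "\<exists>h :: int poly. monic h \<and> (\<Prod>a\<leftarrow>as. [:- a, 1:]) dvd map_poly of_int h"
    using int
  proof (induction as)
    case (Cons a as)
    then obtain h :: "int poly" where h: "monic h" "(\<Prod>a\<leftarrow>as. [:- a, 1:]) dvd map_poly of_int h" by auto
    obtain p :: "int poly" where p: "poly (map_poly of_int p) a = 0" "monic p"
      using Cons.prems by (auto simp: algebraic_int_altdef_ipoly)
    have "[:- a, 1:] dvd map_poly of_int p" using p(1) by (simp add: poly_eq_0_iff_dvd)
    from mult_dvd_mono[OF this h(2)]
    have "(\<Prod>a\<leftarrow>a # as. [:- a, 1:]) dvd map_poly of_int (p * h)"
      by (simp add: of_int_poly_hom.hom_mult)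
    moreover have "monic (p * h)" using p h by (simp add: monic_mult)
    ultimately show ?case by blast
  qed (auto intro!: exI[of _ 1])
  then obtain h :: "int poly" where h: "monic h" "map_poly of_rat f dvd (map_poly of_int h :: complex poly)"
    unfolding f by blast
  interpret of_rat_poly: map_poly_inj_idom_hom "of_rat :: rat \<Rightarrow> complex" ..
  have monic: "monic f"
    using monic_prod_linear[of as] unfolding f by (simp add: of_rat_hom.degree_map_poly_hom of_rat_hom.coeff_map_poly_hom)
  have "(map_poly of_int h :: complex poly) = map_poly of_rat (map_poly of_int h)"
    by (simp add: map_poly_map_poly o_def)
  with h(2) have "f dvd map_poly of_int h"
    by (simp add: of_rat_hom.dvd_map_poly_hom_imp_dvd)
  from monic_rat_dvd_int[OF monic h(1) this] obtain g :: "int poly" where g: "f = map_poly of_int g" by blast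
  have "sum_list as = - coeff (map_poly of_rat f) (length as - 1)"
    using coeff_prod_linear[OF False] unfolding f by simp
  also have "\<dots> = of_int (- coeff g (length as - 1))" unfolding g by simp
  finally show ?thesis by simp
qed simp

text \<open>Pigeonhole on the windows of \<open>n\<close> consecutive power sums.\<close>

lemma power_sums_pigeonhole:
  fixes es :: "complex list" and c :: complex
  assumes n: "length es = n" and c: "c \<noteq> 0"
    and int: "\<And>k. k \<le> (2 * H + 1) ^ n + n \<Longrightarrow> c * (\<Sum>e\<leftarrow>es. e ^ k) \<in> \<int>"
    and bound: "\<And>k. k \<le> (2 * H + 1) ^ n + n \<Longrightarrow> norm (c * (\<Sum>e\<leftarrow>es. e ^ k)) \<le> real H"
  shows "\<exists>k q. 0 < q \<and> k + q \<le> (2 * H + 1) ^ n \<and> (\<forall>e \<in> set es. e ^ (k + q) = e ^ k)"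
proof -
  let ?K = "(2 * H + 1) ^ n"
  let ?s = "\<lambda>k. c * (\<Sum>e\<leftarrow>es. e ^ k)"
  let ?I = "of_int ` {- int H .. int H} :: complex set"
  let ?w = "\<lambda>k. map (\<lambda>t. ?s (k + t)) [0..<n]"
  have s: "?s k \<in> ?I" if k: "k \<le> ?K + n" for k
  proof -
    obtain z where z: "?s k = of_int z" using int[OF k] Ints_cases by blast
    have "\<bar>z\<bar> \<le> int H" using bound[OF k] unfolding z by simp
    then have "z \<in> {- int H..int H}" by auto
    then show ?thesis using z by blast
  qed
  have "card ?I \<le> 2 * H + 1" by (rule order.trans[OF card_image_le]) auto
  then have "card {xs. set xs \<subseteq> ?I \<and> length xs = n} \<le> ?K"
    by (simp add: card_lists_length_eq power_mono)
  moreover have "?w ` {..?K} \<subseteq> {xs. set xs \<subseteq> ?I \<and> length xs = n}" using s by auto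
  then have "card (?w ` {..?K}) \<le> card {xs. set xs \<subseteq> ?I \<and> length xs = n}"
    by (rule card_mono[rotated]) (simp add: finite_lists_length_eq)
  \<comment> \<open>There are \<open>?K + 1\<close> starting positions but at most \<open>?K\<close>
    windows: \<open>n\<close> integers, each between \<open>- H\<close> and \<open>H\<close>. A
    window starting at \<open>?K\<close> stays within the exponents covered by the
    hypotheses.\<close>
  ultimately have "card (?w ` {..?K}) < card {..?K}" by simp
  from pigeonhole[OF this] obtain k k' where k: "k \<le> ?K" "k' \<le> ?K" "?w k = ?w k'" "k < k'"
    unfolding inj_on_def by (metis atMost_iff linorder_neqE_nat)
  define q where "q = k' - k"
  define g where "g e = e ^ (k + q) - e ^ k" for e :: complex
  have k': "k' = k + q" using k by (simp add: q_def)
  \<comment> \<open>Equality of the two windows, with \<open>c\<close> cancelled: giving each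
    \<open>e\<close> the weight \<open>g e\<close> makes the first \<open>n\<close> moments vanish,
    hence the weighted sum of every polynomial of degree below \<open>n\<close>.\<close>
  have zero: "(\<Sum>e\<leftarrow>es. e ^ t * g e) = 0" if "t < n" for t
  proof -
    have "?w k ! t = ?w k' ! t" unfolding k(3) ..
    then have "(\<Sum>e\<leftarrow>es. e ^ (k + t)) = (\<Sum>e\<leftarrow>es. e ^ (k + q + t))"
      using that c unfolding k' by simp
    then show ?thesis
      by (simp add: g_def algebra_simps power_add sum_list_subtractf)
  qed
  have poly_zero: "(\<Sum>e\<leftarrow>es. poly p e * g e) = 0" if "degree p < n" for p
  proof -
    have "(\<Sum>e\<leftarrow>es. poly p e * g e) = (\<Sum>e\<leftarrow>es. \<Sum>t\<le>degree p. coeff p t * (e ^ t * g e))"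
      by (simp add: poly_altdef sum_distrib_right mult.assoc)
    also have "\<dots> = (\<Sum>t\<le>degree p. coeff p t * (\<Sum>e\<leftarrow>es. e ^ t * g e))"
      by (induction es) (auto simp: sum.distrib algebra_simps)
    also have "\<dots> = 0" using zero that by (intro sum.neutral) auto
    finally show ?thesis .
  qed
  have "g e0 = 0" if "e0 \<in> set es" for e0
  proof -
    \<comment> \<open>As in Lagrange interpolation, \<open>p\<close> vanishes at all other distinct
      members of the list and isolates \<open>e0\<close>. What remains is \<open>g e0\<close> times
      a nonzero value and the multiplicity of \<open>e0\<close>.\<close>
    define p where "p = (\<Prod>a \<in> set es - {e0}. [:- a, 1:])"
    have "degree p \<le> (\<Sum>a \<in> set es - {e0}. degree [:- a, 1:])"
      unfolding p_def by (rule degree_prod_sum_le[unfolded o_def]) auto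
    also have "\<dots> = card (set es) - 1" using that by simp
    also have "\<dots> < n" using that n card_length[of es]
      by (metis One_nat_def Suc_pred card_gt_0_iff empty_iff finite_set le_less_trans less_Suc_eq_le
          less_le_trans lessI)
    finally have "(\<Sum>e\<leftarrow>es. poly p e * g e) = 0" by (rule poly_zero)
    moreover have "(\<Sum>e\<leftarrow>es. poly p e * g e) = (\<Sum>e\<leftarrow>es. if e = e0 then poly p e0 * g e0 else 0)"
      by (intro arg_cong[where f = sum_list] map_cong) (auto simp: p_def poly_prod)
    moreover have "(\<Sum>e\<leftarrow>xs. if e = e0 then x else 0) = of_nat (count_list xs e0) * x"
      for xs and x :: complex
      by (induction xs) (auto simp: algebra_simps)
    moreover have "poly p e0 \<noteq> 0" by (auto simp: p_def poly_prod)
    moreover have "count_list es e0 \<noteq> 0" using that by (simp add: count_list_0_iff)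
    ultimately show "g e0 = 0" by simp
  qed
  then show ?thesis using k unfolding g_def k' by (intro exI[of _ k] exI[of _ q]) auto
qed

text \<open>\<open>L\<close> is at least the preperiod \<open>k\<close>, and \<open>fact L\<close>
  is a multiple of every possible period \<open>q\<close>. Thus one pair of exponents serves all
  eigenvalues, whatever \<open>k\<close> and \<open>q\<close> the pigeonhole yields.\<close>

lemma pow_fact_eq:
  fixes e :: complex
  assumes "e ^ (k + q) = e ^ k" "0 < q" "k + q \<le> L"
  shows "e ^ (L + fact L) = e ^ L"
proof (cases "e = 0")
  case True
  moreover have "0 < L" "L + fact L \<noteq> 0" using assms by auto
  ultimately show ?thesis by (simp add: power_0_left)
next
  case False
  then have "e ^ q = 1" using assms(1) by (simp add: power_add)
  moreover have "q dvd fact L" using assms by (intro dvd_fact) auto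
  ultimately have "e ^ fact L = 1" by (auto simp: power_mult elim!: dvdE)
  then show ?thesis by (simp add: power_add)
qed

lemma map_mat_of_rat_smult: "map_mat of_rat (c \<cdot>\<^sub>m A) = (of_rat c :: complex) \<cdot>\<^sub>m map_mat of_rat A"
  by (rule eq_matI) (auto simp: of_rat_mult)

lemma map_mat_of_int_smult: "map_mat of_int (c \<cdot>\<^sub>m A) = (of_int c :: complex) \<cdot>\<^sub>m map_mat of_int A"
  by (rule eq_matI) auto

lemma norm_sum_list_le: "norm (sum_list xs) \<le> (\<Sum>x\<leftarrow>xs. norm (x :: complex))"
  by (induction xs) (auto intro: norm_triangle_mono)

lemma char_poly_smult_pow_rat:
  fixes A :: "rat mat"
  assumes A: "A \<in> carrier_mat n n" and es: "eigs (map_mat of_rat A) es"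
  shows "(\<Prod>a\<leftarrow>map (\<lambda>a. of_rat c * a ^ m) es. [:- a, 1:]) = map_poly of_rat (char_poly (c \<cdot>\<^sub>m A ^\<^sub>m m))"
proof -
  let ?A = "map_mat complex_of_rat A"
  have A': "?A \<in> carrier_mat n n" using A by simp
  have "map_mat of_rat (c \<cdot>\<^sub>m A ^\<^sub>m m) = of_rat c \<cdot>\<^sub>m ?A ^\<^sub>m m"
    using A by (simp add: map_mat_of_rat_smult of_rat_hom.mat_hom_pow[OF A])
  then have "char_poly (of_rat c \<cdot>\<^sub>m ?A ^\<^sub>m m) = map_poly of_rat (char_poly (c \<cdot>\<^sub>m A ^\<^sub>m m))"
    using A by (metis of_rat_hom.char_poly_hom pow_carrier_mat smult_carrier_mat)
  then show ?thesis unfolding char_poly_smult_pow[OF A' es] by (simp add: o_def)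
qed

lemma nilpotent_rat_iff:
  fixes A :: "rat mat"
  assumes A: "A \<in> carrier_mat n n" and es: "eigs (map_mat of_rat A) es"
  shows "(A ^\<^sub>m (k + q) - A ^\<^sub>m k) ^\<^sub>m n = 0\<^sub>m n n \<longleftrightarrow> (\<forall>e \<in> set es. e ^ (k + q) = e ^ k)"
proof -
  let ?h = "map_mat complex_of_rat"
  have A': "?h A \<in> carrier_mat n n" using A by simp
  have c: "A ^\<^sub>m (k + q) - A ^\<^sub>m k \<in> carrier_mat n n"
    by (intro minus_carrier_mat pow_carrier_mat A)
  have "?h (X - Y) = ?h X - ?h Y" if "X \<in> carrier_mat n n" "Y \<in> carrier_mat n n" for X Y
    using that by (intro eq_matI) (auto simp: of_rat_diff)
  from this[OF pow_carrier_mat[OF A] pow_carrier_mat[OF A], of "k + q" k]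
  have "?h (A ^\<^sub>m (k + q) - A ^\<^sub>m k) = ?h A ^\<^sub>m (k + q) - ?h A ^\<^sub>m k"
    by (simp add: of_rat_hom.mat_hom_pow[OF A])
  then have "?h ((A ^\<^sub>m (k + q) - A ^\<^sub>m k) ^\<^sub>m n) = (?h A ^\<^sub>m (k + q) - ?h A ^\<^sub>m k) ^\<^sub>m n"
    by (simp add: of_rat_hom.mat_hom_pow[OF c])
  moreover have "?h (0\<^sub>m n n) = 0\<^sub>m n n" by (intro eq_matI) auto
  then have "M = 0\<^sub>m n n \<longleftrightarrow> ?h M = 0\<^sub>m n n" for M
    using of_rat_hom.mat_hom_inj[of M "0\<^sub>m n n"] by metis
  ultimately show ?thesis
    using pow_diff_nilpotent_iff[OF A' es] c by (metis pow_carrier_mat)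
qed

text \<open>The number is a root of \<open>char_poly Z\<close>, which is monic with integer
  coefficients.\<close>

lemma algebraic_int_eig_of_int_mat:
  fixes A :: "complex mat" and Z :: "int mat"
  assumes A: "A \<in> carrier_mat n n" and es: "eigs A es" and Z: "c \<cdot>\<^sub>m A ^\<^sub>m m = map_mat of_int Z"
    and "e \<in> set es"
  shows "algebraic_int (c * e ^ m)"
proof -
  have "map_mat complex_of_int Z \<in> carrier_mat n n"
    unfolding Z[symmetric] using pow_carrier_mat[OF A] by simp
  then have c: "Z \<in> carrier_mat n n" by simp
  have "(\<Prod>a\<leftarrow>es. [:- (c * a ^ m), 1:]) = map_poly of_int (char_poly Z)"
    unfolding char_poly_smult_pow[OF A es, symmetric] Z of_int_hom.char_poly_hom[OF c] ..
  moreover have "poly (\<Prod>a\<leftarrow>es. [:- (c * a ^ m), 1:]) (c * e ^ m) = 0"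
    using \<open>e \<in> set es\<close> by (auto simp: poly_prod_list prod_list_zero_iff o_def)
  ultimately show ?thesis
    unfolding algebraic_int_altdef_ipoly using degree_monic_char_poly[OF c] by metis
qed

lemma algebraic_int_power_imp:
  fixes x :: "'a :: field"
  assumes "algebraic_int (x ^ i)" "0 < i"
  shows "algebraic_int x"
  by (rule algebraic_int_root[OF assms(1), of "monom 1 i"])
     (use assms(2) in \<open>auto simp: poly_monom degree_monom_eq\<close>)

text \<open>The common core of the two nilpotency results below. Integrality of all
  \<open>c * e ^ k\<close> makes their sums, the traces of \<open>c A ^ k\<close>, integers; the
  factor \<open>n\<close> in the size bound lets \<open>n\<close> summands together stay within
  \<open>H\<close>. So the pigeonhole argument applies.\<close>

lemma nilpotent_bound_aux:
  fixes A :: "rat mat"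
  assumes A: "A \<in> carrier_mat n n" and c: "c \<noteq> 0"
    and es: "eigs (map_mat of_rat A) es"
    and int: "\<And>e k. e \<in> set es \<Longrightarrow> k \<le> (2 * H + 1) ^ n + n \<Longrightarrow> algebraic_int (of_rat c * e ^ k)"
    and bound: "\<And>e k. e \<in> set es \<Longrightarrow> k \<le> (2 * H + 1) ^ n + n \<Longrightarrow> real n * norm (of_rat c * e ^ k) \<le> real H"
    and L: "(2 * H + 1) ^ n + n \<le> L"
  shows "(A ^\<^sub>m (L + fact L) - A ^\<^sub>m L) ^\<^sub>m n = 0\<^sub>m n n"
proof -
  have A': "map_mat complex_of_rat A \<in> carrier_mat n n" using A by simp
  have len: "length es = n" by (rule length_eigs[OF A' es])
  have sum: "of_rat c * (\<Sum>e\<leftarrow>es. e ^ k) = sum_list (map (\<lambda>a. of_rat c * a ^ k) es)" for k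
    by (simp add: sum_list_const_mult)
  have "\<exists>k q. 0 < q \<and> k + q \<le> (2 * H + 1) ^ n \<and> (\<forall>e \<in> set es. e ^ (k + q) = e ^ k)"
  proof (rule power_sums_pigeonhole[OF len, of "of_rat c"])
    fix k assume k: "k \<le> (2 * H + 1) ^ n + n"
    show "of_rat c * (\<Sum>e\<leftarrow>es. e ^ k) \<in> \<int>" unfolding sum
      by (rule sum_list_algebraic_int[OF char_poly_smult_pow_rat[OF A es]]) (use int k in auto)
    have "norm (sum_list (map (\<lambda>a. of_rat c * a ^ k) es)) \<le> (\<Sum>e\<leftarrow>es. norm (of_rat c * e ^ k))"
      using norm_sum_list_le[of "map (\<lambda>a. of_rat c * a ^ k) es"] by (simp add: o_def)
    also have "\<dots> \<le> (\<Sum>e\<leftarrow>es. real H / real n)"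
    proof (rule sum_list_mono)
      fix e assume e: "e \<in> set es"
      then have "0 < n" using len by (cases es) auto
      then show "norm (of_rat c * e ^ k) \<le> real H / real n"
        using bound[OF e k] by (simp add: field_simps)
    qed
    also have "\<dots> \<le> real H" using len by (simp add: sum_list_triv)
    finally show "norm (of_rat c * (\<Sum>e\<leftarrow>es. e ^ k)) \<le> real H" unfolding sum .
  qed (use c in auto)
  then show ?thesis
    unfolding nilpotent_rat_iff[OF A es] using L pow_fact_eq by (meson add_leD1 order.trans)
qed

text \<open>Roots of unity among the eigenvalues have bounded order.\<close>

lemma nilpotent_uniform:
  fixes A :: "rat mat"
  assumes A: "A \<in> carrier_mat n n" and nil: "(A ^\<^sub>m (k + q) - A ^\<^sub>m k) ^\<^sub>m n = 0\<^sub>m n n" and q: "0 < q"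
  defines "W \<equiv> (2 * n + 1) ^ n + n"
  shows "(A ^\<^sub>m (W + fact W) - A ^\<^sub>m W) ^\<^sub>m n = 0\<^sub>m n n"
proof -
  have A': "map_mat complex_of_rat A \<in> carrier_mat n n" using A by simp
  obtain es where es: "eigs (map_mat of_rat A) es" using eigs_ex[OF A'] .
  have e: "e = 0 \<or> e ^ q = 1" if "e \<in> set es" for e
    using nil that unfolding nilpotent_rat_iff[OF A es] by (auto simp: power_add)
  \<comment> \<open>Here \<open>c = 1\<close> and \<open>H = n\<close>: powers of zero and of roots
    of unity are algebraic integers of modulus at most 1, so \<open>n\<close> of them add up to at
    most \<open>n\<close>.\<close>
  show ?thesis
  proof (rule nilpotent_bound_aux[OF A _ es, of 1 n])
    fix e j assume "e \<in> set es"
    then consider "e = 0" | "e ^ q = 1" using e by blast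
    then have "algebraic_int (e ^ j) \<and> norm (e ^ j) \<le> 1"
    proof cases
      case 1
      then show ?thesis by (cases j) (auto simp: int_imp_algebraic_int)
    next
      case 2
      have "(e ^ j) ^ q = 1" using 2 by (metis mult.commute power_mult power_one)
      then have "algebraic_int (e ^ j)" using algebraic_int_power_imp[of "e ^ j" q] q by simp
      moreover have "norm e = 1" using 2 q
        by (metis norm_ge_zero norm_one norm_power power_eq_1_iff zero_less_iff_neq_zero)
      ultimately show ?thesis by (simp add: norm_power)
    qed
    then show "algebraic_int (of_rat 1 * e ^ j)" "real n * norm (of_rat 1 * e ^ j) \<le> real n"
      by (auto simp: mult_left_le)
  qed (auto simp: W_def)
qed

text \<open>Reading the eigenvector equation in a coordinate of largest modulus bounds the
  eigenvalue by a row sum of absolute values, and the sum over all entries dominates every row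
  sum.\<close>

lemma norm_eig_le:
  fixes A :: "complex mat"
  assumes A: "A \<in> carrier_mat n n" and es: "eigs A es" and e: "e \<in> set es"
  shows "norm (c * e ^ m) \<le> (\<Sum>i<n. \<Sum>j<n. norm ((c \<cdot>\<^sub>m A ^\<^sub>m m) $$ (i, j)))"
proof -
  let ?M = "c \<cdot>\<^sub>m A ^\<^sub>m m" and ?\<mu> = "c * e ^ m"
  have M: "?M \<in> carrier_mat n n" using A by simp
  have "poly (char_poly ?M) ?\<mu> = 0"
    unfolding char_poly_smult_pow[OF A es] using e by (auto simp: poly_prod_list prod_list_zero_iff o_def)
  then have "eigenvalue ?M ?\<mu>" using eigenvalue_root_char_poly[OF M] by simp
  then obtain v where v: "v \<in> carrier_vec n" "v \<noteq> 0\<^sub>v n" "?M *\<^sub>v v = ?\<mu> \<cdot>\<^sub>v v"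
    using M unfolding eigenvalue_def eigenvector_def by auto
  have "{..<n} \<noteq> {}" using v by (auto intro!: eq_vecI)
  then obtain l where l: "l < n" "\<And>i. i < n \<Longrightarrow> norm (v $ i) \<le> norm (v $ l)"
    using Max_in[of "(\<lambda>i. norm (v $ i)) ` {..<n}"] Max_ge[of "(\<lambda>i. norm (v $ i)) ` {..<n}"] by fastforce
  have pos: "0 < norm (v $ l)"
  proof (rule ccontr)
    assume "\<not> ?thesis"
    then have "v $ i = 0" if "i < n" for i using l(2)[OF that] by auto
    then show False using v(1,2) by (auto intro!: eq_vecI)
  qed
  have "?\<mu> * v $ l = (?\<mu> \<cdot>\<^sub>v v) $ l" using v(1) l by simp
  also have "(M' *\<^sub>v v) $ l = (\<Sum>j<n. M' $$ (l, j) * v $ j)" if "M' \<in> carrier_mat n n" for M'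
    using that v(1) l(1) by (simp add: scalar_prod_def atLeast0LessThan)
  from this[OF M] have "(?\<mu> \<cdot>\<^sub>v v) $ l = (\<Sum>j<n. ?M $$ (l, j) * v $ j)" unfolding v(3) .
  finally have "norm ?\<mu> * norm (v $ l) \<le> (\<Sum>j<n. norm (?M $$ (l, j)) * norm (v $ j))"
    by (metis (no_types, lifting) norm_mult norm_sum sum.cong)
  also have "\<dots> \<le> (\<Sum>j<n. norm (?M $$ (l, j)) * norm (v $ l))"
    using l by (intro sum_mono mult_left_mono) auto
  finally have "norm ?\<mu> \<le> (\<Sum>j<n. norm (?M $$ (l, j)))"
    using pos by (simp add: sum_distrib_right[symmetric])
  also have "\<dots> \<le> (\<Sum>i<n. \<Sum>j<n. norm (?M $$ (i, j)))"
    using l(1) by (intro member_le_sum) (auto intro: sum_nonneg)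
  finally show ?thesis .
qed

text \<open>Kronecker's theorem, made effective: if \<open>A ^ i = B / \<delta>\<close> then \<open>\<delta> e ^ k\<close> is an algebraic integer
  for every eigenvalue \<open>e\<close> and all \<open>k \<le> i\<close>, since its \<open>i\<close>-th power is an eigenvalue of
  \<open>\<delta> ^ (i - k) B ^ k\<close>, and it is bounded in terms of \<open>B\<close>.\<close>

lemma nilpotent_of_large_power:
  fixes A :: "rat mat" and B :: "int mat" and d :: int
  assumes A: "A \<in> carrier_mat n n" and B: "B \<in> carrier_mat n n" and d: "d \<noteq> 0"
    and AB: "of_int d \<cdot>\<^sub>m A ^\<^sub>m i = map_mat of_int B"
  defines "L \<equiv> (2 * (n * nat \<bar>d\<bar> * (nat (\<Sum>i<n. \<Sum>j<n. \<bar>B $$ (i, j)\<bar>) + 1)) + 1) ^ n + n"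
  assumes i: "L < i"
  shows "(A ^\<^sub>m (L + fact L) - A ^\<^sub>m L) ^\<^sub>m n = 0\<^sub>m n n"
proof -
  let ?A = "map_mat complex_of_rat A"
  let ?S = "\<Sum>i<n. \<Sum>j<n. \<bar>B $$ (i, j)\<bar>"
  let ?H = "n * nat \<bar>d\<bar> * (nat ?S + 1)"
  have S: "0 \<le> ?S" by (intro sum_nonneg) auto
  have A': "?A \<in> carrier_mat n n" using A by simp
  obtain es where es: "eigs ?A es" using eigs_ex[OF A'] .
  have AB': "of_int d \<cdot>\<^sub>m ?A ^\<^sub>m i = map_mat of_int B"
  proof -
    have "map_mat complex_of_rat (of_int d \<cdot>\<^sub>m A ^\<^sub>m i) = of_int d \<cdot>\<^sub>m ?A ^\<^sub>m i"
      using A by (simp add: map_mat_of_rat_smult of_rat_hom.mat_hom_pow[OF A])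
    moreover have "map_mat complex_of_rat (map_mat of_int B) = map_mat of_int B" by auto
    ultimately show ?thesis using AB by metis
  qed
  have int: "algebraic_int (of_int d * e ^ k)" if e: "e \<in> set es" and k: "k \<le> i" for e k
  proof -
    \<comment> \<open>This is the \<open>k\<close>-th power of \<open>d A ^ i = B\<close>. The
      missing factor \<open>d ^ (i - k)\<close> is then supplied to reach
      \<open>(d e ^ k) ^ i = d ^ i e ^ (i k)\<close>.\<close>
    have "of_int d ^ k \<cdot>\<^sub>m ?A ^\<^sub>m (i * k) = map_mat of_int (B ^\<^sub>m k)"
    proof (induction k)
      case (Suc k)
      have c: "?A ^\<^sub>m m \<in> carrier_mat n n" for m using A' by simp
      have "of_int d ^ Suc k \<cdot>\<^sub>m ?A ^\<^sub>m (i * Suc k) = of_int d ^ Suc k \<cdot>\<^sub>m (?A ^\<^sub>m (i * k) * ?A ^\<^sub>m i)"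
        by (simp add: pow_mat_add[OF A', symmetric] add.commute)
      also have "\<dots> = (of_int d ^ k \<cdot>\<^sub>m ?A ^\<^sub>m (i * k)) * (of_int d \<cdot>\<^sub>m ?A ^\<^sub>m i)"
        unfolding mult_smult_assoc_mat[OF c smult_carrier_mat[OF c]] mult_smult_distrib[OF c c]
        by (simp add: smult_smult_mat mult.commute)
      also have "\<dots> = map_mat of_int (B ^\<^sub>m Suc k)"
        unfolding Suc.IH AB' using B by (simp add: of_int_hom.mat_hom_mult[of _ n n])
      finally show ?case .
    qed (use A B in \<open>auto simp: of_int_hom.mat_hom_one\<close>)
    then have "of_int d ^ (i - k) \<cdot>\<^sub>m (of_int d ^ k \<cdot>\<^sub>m ?A ^\<^sub>m (i * k)) =
        of_int d ^ (i - k) \<cdot>\<^sub>m map_mat of_int (B ^\<^sub>m k)" by simp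
    then have "of_int d ^ i \<cdot>\<^sub>m ?A ^\<^sub>m (i * k) = map_mat of_int (d ^ (i - k) \<cdot>\<^sub>m B ^\<^sub>m k)"
      using k by (simp add: smult_smult_mat power_add[symmetric] map_mat_of_int_smult)
    from algebraic_int_eig_of_int_mat[OF A' es this e]
    have "algebraic_int ((of_int d * e ^ k) ^ i)"
      unfolding power_mult_distrib power_mult[symmetric] mult.commute[of k i] by simp
    then show ?thesis by (rule algebraic_int_power_imp[OF _ le_less_trans[OF le0 i]])
  qed
  \<comment> \<open>From \<open>d A ^ i = B\<close> and \<open>d \<noteq> 0\<close>,
    \<open>norm e ^ i\<close> is at most \<open>?S\<close>. If \<open>norm e > 1\<close>, lower
    powers are smaller still; otherwise they are at most 1, which is why 1 is added.\<close>
  have bound: "norm (e ^ k) \<le> real_of_int ?S + 1" if e: "e \<in> set es" and k: "k \<le> i" for e k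
  proof -
    have "norm (of_int d * e ^ i) \<le> (\<Sum>i<n. \<Sum>j<n. norm (map_mat complex_of_int B $$ (i, j)))"
      using norm_eig_le[OF A' es e, of "of_int d" i] unfolding AB' .
    also have "\<dots> = real_of_int ?S" using B by simp
    finally have "\<bar>real_of_int d\<bar> * norm (e ^ i) \<le> real_of_int ?S" by (simp add: norm_mult)
    moreover have "1 * norm (e ^ i) \<le> \<bar>real_of_int d\<bar> * norm (e ^ i)"
      using d by (intro mult_right_mono) auto
    ultimately have *: "norm e ^ i \<le> real_of_int ?S" by (simp add: norm_power)
    show ?thesis
    proof (cases "norm e \<le> 1")
      case True
      then have "norm (e ^ k) \<le> 1" by (simp add: norm_power power_le_one)
      moreover have "0 \<le> real_of_int ?S" using S by (rule of_int_nonneg)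
      ultimately show ?thesis by linarith
    next
      case False
      then have "norm e ^ k \<le> norm e ^ i" using k by (intro power_increasing) auto
      then show ?thesis using * by (simp add: norm_power)
    qed
  qed
  have L: "(2 * ?H + 1) ^ n + n = L" unfolding L_def ..
  show ?thesis
  proof (rule nilpotent_bound_aux[OF A _ es, of "of_int d" ?H])
    fix e k assume e: "e \<in> set es" and "k \<le> (2 * ?H + 1) ^ n + n"
    then have k: "k \<le> i" using i unfolding L by linarith
    show "algebraic_int (of_rat (of_int d) * e ^ k)" using int[OF e k] by simp
    have "real n * norm (of_rat (of_int d) * e ^ k) = real n * \<bar>real_of_int d\<bar> * norm (e ^ k)"
      by (simp add: norm_mult)
    also have "\<dots> \<le> real n * \<bar>real_of_int d\<bar> * (real_of_int ?S + 1)"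
      by (intro mult_left_mono bound e k) auto
    also have "\<dots> = real ?H" using S by (simp add: algebra_simps)
    finally show "real n * norm (of_rat (of_int d) * e ^ k) \<le> real ?H" .
  qed (use d L in \<open>simp_all only: of_int_eq_0_iff not_False_eq_True order.refl\<close>)
qed

section \<open>Kronecker substitution\<close>

text \<open>Substituting \<open>X ^ (G ^ i)\<close> for the \<open>i\<close>-th indeterminate turns
  the monomial \<open>m\<close> into \<open>X ^ kron_exp G m\<close>: the exponents of
  \<open>m\<close> become digits in base \<open>G\<close>.\<close>

definition kron_exp :: "nat \<Rightarrow> (nat \<Rightarrow>\<^sub>0 nat) \<Rightarrow> nat" where
  "kron_exp G m = (\<Sum>i \<in> Poly_Mapping.keys m. Poly_Mapping.lookup m i * G ^ i)"

definition kron :: "nat \<Rightarrow> qpoly \<Rightarrow> rat poly" where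
  "kron G p = (\<Sum>m \<in> Poly_Mapping.keys p. Polynomial.monom (Poly_Mapping.lookup p m) (kron_exp G m))"

lemma kron_exp_superset:
  "finite S \<Longrightarrow> Poly_Mapping.keys m \<subseteq> S \<Longrightarrow> kron_exp G m = (\<Sum>i\<in>S. Poly_Mapping.lookup m i * G ^ i)"
  unfolding kron_exp_def by (rule sum.mono_neutral_left) (auto simp: in_keys_iff)

lemma kron_superset:
  "finite S \<Longrightarrow> Poly_Mapping.keys p \<subseteq> S \<Longrightarrow>
    kron G p = (\<Sum>m\<in>S. Polynomial.monom (Poly_Mapping.lookup p m) (kron_exp G m))"
  unfolding kron_def by (rule sum.mono_neutral_left) (auto simp: in_keys_iff)

lemma kron_exp_0 [simp]: "kron_exp G 0 = 0"
  by (simp add: kron_exp_def)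

lemma kron_exp_add: "kron_exp G (m + m') = kron_exp G m + kron_exp G m'"
proof -
  let ?S = "Poly_Mapping.keys m \<union> Poly_Mapping.keys m'"
  have "finite ?S" by simp
  moreover have "Poly_Mapping.keys (m + m') \<subseteq> ?S" by (rule Poly_Mapping.keys_add)
  ultimately show ?thesis
    by (simp add: kron_exp_superset[of ?S] lookup_add distrib_right sum.distrib)
qed

lemma kron_exp_single [simp]: "kron_exp G (Poly_Mapping.single i e) = e * G ^ i"
  by (simp add: kron_exp_def)

lemma kron_0 [simp]: "kron G 0 = 0"
  by (simp add: kron_def)

lemma kron_single [simp]: "kron G (Poly_Mapping.single m c) = Polynomial.monom c (kron_exp G m)"
  by (simp add: kron_def)

lemma kron_add: "kron G (p + q) = kron G p + kron G q"
proof -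
  let ?S = "Poly_Mapping.keys p \<union> Poly_Mapping.keys q"
  have "finite ?S" by simp
  moreover have "Poly_Mapping.keys (p + q) \<subseteq> ?S" by (rule Poly_Mapping.keys_add)
  ultimately show ?thesis
    by (simp add: kron_superset[of ?S] lookup_add add_monom[symmetric] sum.distrib)
qed

lemma kron_sum: "kron G (\<Sum>x\<in>S. f x) = (\<Sum>x\<in>S. kron G (f x))"
  by (induction S rule: infinite_finite_induct) (auto simp: kron_add)

lemma kron_mult: "kron G (p * q) = kron G p * kron G q"
proof -
  let ?t = "\<lambda>p m. Poly_Mapping.single m (Poly_Mapping.lookup p m)"
  have "p * q = (\<Sum>m \<in> Poly_Mapping.keys p. ?t p m) * (\<Sum>m \<in> Poly_Mapping.keys q. ?t q m)"
    by (simp add: poly_mapping_sum)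
  also have "\<dots> = (\<Sum>m \<in> Poly_Mapping.keys p. \<Sum>m' \<in> Poly_Mapping.keys q. ?t p m * ?t q m')"
    by (rule sum_product)
  finally have "kron G (p * q) = (\<Sum>m \<in> Poly_Mapping.keys p. \<Sum>m' \<in> Poly_Mapping.keys q.
      Polynomial.monom (Poly_Mapping.lookup p m) (kron_exp G m) *
      Polynomial.monom (Poly_Mapping.lookup q m') (kron_exp G m'))"
    by (simp add: kron_sum mult_single kron_exp_add mult_monom)
  then show ?thesis by (simp add: kron_def sum_product)
qed

lemma kron_1 [simp]: "kron G 1 = 1"
  by (simp add: kron_def single_one[symmetric] one_poly_eq_simps(2)[symmetric] monom_0 del: single_one)

text \<open>The value at the point whose \<open>j\<close>-th coordinate is \<open>t ^ (G ^ j)\<close>:\<close>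

definition ev :: "nat \<Rightarrow> nat \<Rightarrow> qpoly \<Rightarrow> rat" where
  "ev G t p = poly (kron G p) (of_nat t)"

lemma ev_hom: "comm_ring_hom (ev G t)"
  by unfold_locales (simp_all add: ev_def kron_add kron_mult)

text \<open>Each exponent is bounded separately, instead of the total degree: exponents below the
  base are legal digits. \<open>N\<close> bounds the indices and thereby the number of
  digits.\<close>

definition deg_le :: "nat \<Rightarrow> nat \<Rightarrow> qpoly \<Rightarrow> bool" where
  "deg_le N d p \<longleftrightarrow> (\<forall>m \<in> Poly_Mapping.keys p. Poly_Mapping.keys m \<subseteq> {..<N} \<and> (\<forall>i. Poly_Mapping.lookup m i \<le> d))"

lemma deg_le_0 [simp]: "deg_le N d 0"
  by (simp add: deg_le_def)

lemma deg_le_1 [simp]: "deg_le N d 1"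
  by (simp add: deg_le_def)

lemma deg_le_mono: "deg_le N d p \<Longrightarrow> d \<le> d' \<Longrightarrow> deg_le N d' p"
  unfolding deg_le_def using le_trans by blast

lemma deg_le_add: "deg_le N d p \<Longrightarrow> deg_le N d q \<Longrightarrow> deg_le N d (p + q)"
  unfolding deg_le_def using Poly_Mapping.keys_add[of p q] by blast

lemma deg_le_diff: "deg_le N d p \<Longrightarrow> deg_le N d q \<Longrightarrow> deg_le N d (p - q)"
  unfolding deg_le_def using keys_diff[of p q] by blast

lemma deg_le_mult:
  assumes "deg_le N d p" "deg_le N d' q"
  shows "deg_le N (d + d') (p * q)"
  unfolding deg_le_def
proof
  fix m assume "m \<in> Poly_Mapping.keys (p * q)"
  then obtain a b where ab: "m = a + b" "a \<in> Poly_Mapping.keys p" "b \<in> Poly_Mapping.keys q"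
    using keys_mult[of p q] by blast
  then have "Poly_Mapping.keys a \<subseteq> {..<N}" "Poly_Mapping.keys b \<subseteq> {..<N}"
    "\<And>i. Poly_Mapping.lookup a i \<le> d" "\<And>i. Poly_Mapping.lookup b i \<le> d'"
    using assms by (auto simp: deg_le_def)
  then show "Poly_Mapping.keys m \<subseteq> {..<N} \<and> (\<forall>i. Poly_Mapping.lookup m i \<le> d + d')"
    unfolding ab(1) using Poly_Mapping.keys_add[of a b] by (auto simp: lookup_add intro: add_mono)
qed

lemma deg_le_sum: "(\<And>x. x \<in> S \<Longrightarrow> deg_le N d (f x)) \<Longrightarrow> deg_le N d (\<Sum>x\<in>S. f x)"
  by (induction S rule: infinite_finite_induct) (auto intro: deg_le_add)

lemma deg_le_prod: "(\<And>x. x \<in> S \<Longrightarrow> deg_le N d (f x)) \<Longrightarrow> deg_le N (card S * d) (\<Prod>x\<in>S. f x)"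
  by (induction S rule: infinite_finite_induct) (auto intro: deg_le_mult)

lemma deg_le_power: "deg_le N d p \<Longrightarrow> deg_le N (i * d) (p ^ i)"
  by (induction i) (auto intro: deg_le_mult)

lemma deg_le_ex: "\<exists>N d. deg_le N d p"
proof -
  let ?K = "\<Union>m \<in> Poly_Mapping.keys p. Poly_Mapping.keys m"
  obtain N where N: "?K \<subseteq> {..<N}" using finite_nat_iff_bounded[of ?K] by auto
  define d where "d = Max (insert 0 (\<Union>m \<in> Poly_Mapping.keys p. Poly_Mapping.lookup m ` Poly_Mapping.keys m))"
  have "Poly_Mapping.lookup m i \<le> d" if "m \<in> Poly_Mapping.keys p" for m i
  proof (cases "i \<in> Poly_Mapping.keys m")
    case True
    then show ?thesis using that unfolding d_def by (intro Max_ge) auto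
  qed (simp add: in_keys_iff)
  then show ?thesis using N unfolding deg_le_def by blast
qed

lemma digits_less: "(\<And>i. i < N \<Longrightarrow> a i < G) \<Longrightarrow> (\<Sum>i<N. a i * G ^ i) < (G :: nat) ^ N"
proof (induction N)
  case (Suc N)
  then have "Suc (a N) * G ^ N \<le> G * G ^ N" by (intro mult_right_mono) (auto simp: Suc_leI)
  with Suc show ?case by auto
qed simp

lemma digits_inj:
  assumes "(\<Sum>i<N. a i * G ^ i) = (\<Sum>i<N. b i * G ^ i)"
    "\<And>i. i < N \<Longrightarrow> a i < G" "\<And>i. i < N \<Longrightarrow> b i < (G :: nat)" "i < N"
  shows "a i = b i"
  using assms
proof (induction N)
  case (Suc N)
  let ?s = "\<lambda>a. \<Sum>i<N. a i * G ^ i"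
  have less: "?s a < G ^ N" "?s b < G ^ N" using Suc.prems(2,3) by (auto intro: digits_less)
  then have pos: "G ^ N \<noteq> 0" by (metis not_less_zero)
  have eq: "?s a + a N * G ^ N = ?s b + b N * G ^ N" using Suc.prems(1) by simp
  have "a N = (?s a + a N * G ^ N) div G ^ N" using less pos by simp
  also have "\<dots> = b N" unfolding eq using less pos by simp
  finally have "a N = b N" .
  moreover have "?s a = ?s b" using eq \<open>a N = b N\<close> by simp
  then have "i < N \<Longrightarrow> a i = b i" using Suc by auto
  ultimately show ?case using Suc.prems(4) by (auto simp: less_Suc_eq)
qed simp

lemma kron_exp_inj:
  assumes "kron_exp G m = kron_exp G m'" "Poly_Mapping.keys m \<subseteq> {..<N}" "Poly_Mapping.keys m' \<subseteq> {..<N}"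
    "\<And>i. Poly_Mapping.lookup m i < G" "\<And>i. Poly_Mapping.lookup m' i < G"
  shows "m = m'"
proof (rule poly_mapping_eqI)
  fix i
  show "Poly_Mapping.lookup m i = Poly_Mapping.lookup m' i"
  proof (cases "i < N")
    case True
    then show ?thesis
      using digits_inj[of "Poly_Mapping.lookup m" G N "Poly_Mapping.lookup m'" i] assms
        kron_exp_superset[OF _ assms(2)] kron_exp_superset[OF _ assms(3)] by auto
  next
    case False
    then have "i \<notin> Poly_Mapping.keys m" "i \<notin> Poly_Mapping.keys m'" using assms(2,3) by auto
    then show ?thesis by (simp add: in_keys_iff)
  qed
qed

text \<open>Since base \<open>G\<close> digits are unique, distinct monomials of \<open>p\<close>
  keep distinct exponents and no coefficients are merged.\<close>

lemma kron_eq_0_iff: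
  assumes "deg_le N d p" "d < G"
  shows "kron G p = 0 \<longleftrightarrow> p = 0"
proof
  assume 0: "kron G p = 0"
  have "Poly_Mapping.keys p = {}"
  proof (rule ccontr)
    assume "Poly_Mapping.keys p \<noteq> {}"
    then obtain m where m: "m \<in> Poly_Mapping.keys p" by blast
    have small: "Poly_Mapping.lookup k i < G" if "k \<in> Poly_Mapping.keys p" for k i
      using assms that unfolding deg_le_def by (meson le_less_trans)
    have "kron_exp G k = kron_exp G m \<longleftrightarrow> k = m" if "k \<in> Poly_Mapping.keys p" for k
      using kron_exp_inj[of G k m N] assms(1) that m small unfolding deg_le_def by blast
    then have "coeff (kron G p) (kron_exp G m) =
        (\<Sum>k \<in> Poly_Mapping.keys p. if k = m then Poly_Mapping.lookup p m else 0)"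
      unfolding kron_def coeff_sum by (intro sum.cong) (auto simp: coeff_monom)
    then have "coeff (kron G p) (kron_exp G m) = Poly_Mapping.lookup p m" using m by simp
    then show False using m 0 by (simp add: in_keys_iff)
  qed
  then show "p = 0" by simp
qed simp

lemma degree_kron:
  assumes "deg_le N d p" "d < G" "p \<noteq> 0"
  shows "degree (kron G p) < G ^ N"
proof -
  have "kron_exp G m < G ^ N" if "m \<in> Poly_Mapping.keys p" for m
  proof -
    have "Poly_Mapping.keys m \<subseteq> {..<N}" "\<And>i. Poly_Mapping.lookup m i < G"
      using assms(1,2) that unfolding deg_le_def by (auto intro: le_less_trans)
    then show ?thesis using digits_less[of N "Poly_Mapping.lookup m" G] kron_exp_superset[of "{..<N}" m G] by simp
  qed
  then have "degree (Polynomial.monom c (kron_exp G m)) \<le> G ^ N - 1" if "m \<in> Poly_Mapping.keys p" for m and c :: rat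
    using degree_monom_le[of c "kron_exp G m"] that by fastforce
  then have "degree (kron G p) \<le> G ^ N - 1"
    unfolding kron_def by (intro degree_sum_le) auto
  moreover have "0 < G ^ N" using assms(2) by simp
  ultimately show ?thesis by linarith
qed

text \<open>After the substitution a nonzero polynomial has degree below \<open>G ^ N\<close>, hence
  fewer than \<open>G ^ N\<close> roots. This makes an identity of polynomials a bounded
  test.\<close>

lemma eq_0_iff_ev:
  assumes "deg_le N d p" "d < G"
  shows "p = 0 \<longleftrightarrow> (\<forall>t < G ^ N. ev G t p = 0)"
proof
  assume *: "\<forall>t < G ^ N. ev G t p = 0"
  show "p = 0"
  proof (rule ccontr)
    assume p: "p \<noteq> 0"
    then have k: "kron G p \<noteq> 0" using kron_eq_0_iff[OF assms] by simp
    have "of_nat ` {..<G ^ N} \<subseteq> {x. poly (kron G p) x = 0}" using * by (auto simp: ev_def)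
    then have "card (of_nat ` {..<G ^ N} :: rat set) \<le> card {x. poly (kron G p) x = 0}"
      using poly_roots_finite[OF k] by (intro card_mono)
    also have "\<dots> \<le> degree (kron G p)" by (rule card_poly_roots_bound[OF k])
    also have "\<dots> < G ^ N" by (rule degree_kron[OF assms p])
    finally show False by (simp add: card_image inj_on_def)
  qed
qed (simp add: ev_def)

text \<open>A point for the product, which is nonzero in an integral domain, works for all factors
  at once.\<close>

lemma ev_nonzero_ex:
  assumes "finite F" "0 \<notin> F"
  shows "\<exists>G t. \<forall>p \<in> F. ev G t p \<noteq> 0"
proof -
  interpret ev: comm_ring_hom "ev G t" for G t by (rule ev_hom)
  have "(\<Prod>p\<in>F. p) \<noteq> 0" using assms by simp
  moreover obtain N d where "deg_le N d (\<Prod>p\<in>F. p)" using deg_le_ex by blast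
  ultimately obtain t where t: "ev (Suc d) t (\<Prod>p\<in>F. p) \<noteq> 0" using eq_0_iff_ev by blast
  have "ev (Suc d) t p \<noteq> 0" if "p \<in> F" for p
  proof
    assume "ev (Suc d) t p = 0"
    moreover have "(\<Prod>p\<in>F. p) = p * (\<Prod>p\<in>F - {p}. p)" using assms that by (intro prod.remove)
    ultimately show False using t by (simp add: ev.hom_mult)
  qed
  then show ?thesis by blast
qed

text \<open>\<open>A ^ i = a ^ i / c ^ i\<close> and \<open>B = b / c\<close>; multiplication by
  \<open>c * c ^ i\<close> leaves an equation in the ring, to which evaluation can be
  applied.\<close>

lemma fract_mat_pow_eq_iff:
  fixes a b :: "'a :: idom mat" and A B :: "'a fract mat"
  assumes a: "a \<in> carrier_mat n n" and b: "b \<in> carrier_mat n n" and c: "c \<noteq> 0"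
    and A: "A = map_mat (\<lambda>p. Fract p c) a" and B: "B = map_mat (\<lambda>p. Fract p c) b"
  shows "A ^\<^sub>m i = B \<longleftrightarrow> c \<cdot>\<^sub>m a ^\<^sub>m i = c ^ i \<cdot>\<^sub>m b"
proof -
  interpret emb: inj_comm_ring_hom "\<lambda>p :: 'a. Fract p 1"
    by unfold_locales (auto simp: eq_fract Zero_fract_def One_fract_def)
  have emb_smult: "map_mat (\<lambda>p. Fract p 1) (k \<cdot>\<^sub>m M) = Fract k 1 \<cdot>\<^sub>m map_mat (\<lambda>p. Fract p 1) M"
    for k :: 'a and M
    by (rule eq_matI) auto
  have cA: "A \<in> carrier_mat n n" using a A by simp
  have c': "Fract c 1 \<noteq> 0" using c unfolding Zero_fract_def by (subst eq_fract(1)) simp_all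
  have sA: "Fract c 1 \<cdot>\<^sub>m A = map_mat (\<lambda>p. Fract p 1) a" and sB: "Fract c 1 \<cdot>\<^sub>m B = map_mat (\<lambda>p. Fract p 1) b"
  proof -
    have *: "Fract c 1 * Fract p c = Fract p 1" for p using c by (simp add: eq_fract)
    show "Fract c 1 \<cdot>\<^sub>m A = map_mat (\<lambda>p. Fract p 1) a" "Fract c 1 \<cdot>\<^sub>m B = map_mat (\<lambda>p. Fract p 1) b"
      unfolding A B by (rule eq_matI; simp add: * del: mult_fract)+
  qed
  have pow: "Fract c 1 ^ i \<cdot>\<^sub>m A ^\<^sub>m i = map_mat (\<lambda>p. Fract p 1) (a ^\<^sub>m i)" for i
  proof (induction i)
    case (Suc i)
    have "Fract c 1 ^ Suc i \<cdot>\<^sub>m A ^\<^sub>m Suc i = (Fract c 1 ^ i \<cdot>\<^sub>m A ^\<^sub>m i) * (Fract c 1 \<cdot>\<^sub>m A)"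
      unfolding mult_smult_assoc_mat[OF pow_carrier_mat[OF cA] smult_carrier_mat[OF cA]]
        mult_smult_distrib[OF pow_carrier_mat[OF cA] cA]
      by (simp add: smult_smult_mat mult.commute)
    also have "\<dots> = map_mat (\<lambda>p. Fract p 1) (a ^\<^sub>m Suc i)"
      unfolding Suc.IH sA using a by (simp add: emb.mat_hom_mult[of _ n n])
    finally show ?case .
  qed (use a cA in \<open>auto simp: emb.mat_hom_one\<close>)
  have cancel: "k \<cdot>\<^sub>m M = k \<cdot>\<^sub>m M' \<longleftrightarrow> M = M'" if "k \<noteq> 0" for k :: "'a fract" and M M'
  proof
    assume "k \<cdot>\<^sub>m M = k \<cdot>\<^sub>m M'"
    then have "inverse k \<cdot>\<^sub>m (k \<cdot>\<^sub>m M) = inverse k \<cdot>\<^sub>m (k \<cdot>\<^sub>m M')" by simp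
    moreover have "1 \<cdot>\<^sub>m M = M" for M :: "'a fract mat" by (rule eq_matI) auto
    ultimately show "M = M'" using that by (simp add: smult_smult_mat)
  qed simp
  have "Fract c 1 ^ i \<noteq> 0"
    by (induction i) (use c' in \<open>simp_all only: power_0 power_Suc mult_eq_0_iff one_neq_zero simp_thms\<close>)
  with c' have "Fract c 1 * Fract c 1 ^ i \<noteq> 0" by (rule no_zero_divisors)
  from cancel[OF this, of "A ^\<^sub>m i" B]
  have "A ^\<^sub>m i = B \<longleftrightarrow> (Fract c 1 * Fract c 1 ^ i) \<cdot>\<^sub>m A ^\<^sub>m i = (Fract c 1 ^ i * Fract c 1) \<cdot>\<^sub>m B"
    unfolding mult.commute[of "Fract c 1 ^ i"] by (rule sym)
  also have "\<dots> \<longleftrightarrow> map_mat (\<lambda>p. Fract p 1) (c \<cdot>\<^sub>m a ^\<^sub>m i) = map_mat (\<lambda>p. Fract p 1) (c ^ i \<cdot>\<^sub>m b)"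
    unfolding smult_smult_mat[symmetric] pow sB emb_smult emb.hom_power ..
  also have "\<dots> \<longleftrightarrow> c \<cdot>\<^sub>m a ^\<^sub>m i = c ^ i \<cdot>\<^sub>m b"
    by (rule iffI, erule emb.mat_hom_inj, erule arg_cong)
  finally show ?thesis .
qed

text \<open>The entries of a matrix power are sums over walks; the walk \<open>v\<^sub>0, \<dots>, v\<^sub>i\<close> is given by the
  number with the base \<open>n\<close> digits \<open>v\<^sub>0, \<dots>, v\<^sub>i\<close>.\<close>

definition walks :: "nat \<Rightarrow> (nat \<Rightarrow> nat \<Rightarrow> 'a :: comm_ring_1) \<Rightarrow> nat \<Rightarrow> nat \<Rightarrow> nat \<Rightarrow> 'a" where
  "walks n f i j l = (\<Sum>w<n ^ Suc i. if w mod n = j \<and> w div n ^ i mod n = l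
     then \<Prod>s<i. f (w div n ^ s mod n) (w div n ^ Suc s mod n) else 0)"

lemma sum_lessThan_mult:
  fixes f :: "nat \<Rightarrow> 'a :: comm_monoid_add"
  shows "(\<Sum>w<X * n. f w) = (\<Sum>a<n. \<Sum>u<X. f (u + X * a))"
proof -
  have "(\<Sum>w<m + k. f w) = (\<Sum>w<m. f w) + (\<Sum>u<k. f (u + m))" for m k
    by (induction k) (simp_all add: ac_simps)
  from this[of "X * n" X for n] show ?thesis
    by (induction n) (simp_all add: add.commute)
qed

lemma walks_0:
  fixes f :: "nat \<Rightarrow> nat \<Rightarrow> 'a :: comm_ring_1"
  assumes jl: "j < n" "l < n"
  shows "walks n f 0 j l = (if j = l then 1 else 0)"
proof -
  have "walks n f 0 j l = (\<Sum>w<n. if w mod n = j \<and> w mod n = l then 1 else 0)"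
    by (simp add: walks_def cong: if_cong)
  also have "\<dots> = (\<Sum>w<n. if w = j then (if j = l then 1 else 0) else 0)"
  proof (rule sum.cong[OF refl])
    fix w assume "w \<in> {..<n}"
    then have "w mod n = w" by simp
    then show "(if w mod n = j \<and> w mod n = l then 1 else 0) = (if w = j then (if j = l then 1 else 0) else (0 :: 'a))"
      by auto
  qed
  also have "\<dots> = (if j = l then 1 else 0)" using jl(1) by (subst sum.delta) auto
  finally show "walks n f 0 j l = (if j = l then 1 else 0)" .
qed

text \<open>With \<open>X = n ^ Suc i\<close>, every number below \<open>X * n\<close> is
  \<open>u + X * a\<close>. The leading digit \<open>a\<close> is the last vertex, and the lower
  digits describe the walk without its last step.\<close>

lemma walks_Suc:
  fixes f :: "nat \<Rightarrow> nat \<Rightarrow> 'a :: comm_ring_1"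
  assumes l: "l < n"
  shows "walks n f (Suc i) j l = (\<Sum>q<n. walks n f i j q * f q l)"
proof -
  define d where "d s w = w div n ^ s mod n" for s w
  define X where "X = n ^ Suc i"
  define P where "P u = (\<Prod>s<i. f (d s u) (d (Suc s) u))" for u
  have d_less: "d s u < n" for s u using l by (simp add: d_def)
  have low: "d s (u + X * a) = d s u" if si: "s \<le> i" for s u a
  proof -
    obtain k where k: "i = s + k" using le_Suc_ex[OF si] by (elim exE)
    have pos: "n ^ s \<noteq> 0" using l by (cases n) auto
    have eq: "u + X * a = u + n ^ s * (n * (n ^ k * a))" unfolding k X_def by (simp add: power_add)
    show ?thesis unfolding d_def eq div_mult_self2[OF pos]
      by (simp only: add.commute[of "n * _"] mod_mult_self2)
  qed
  have top: "d (Suc i) (u + X * a) = a" if "u < X" "a < n" for u a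
  proof -
    have pos: "X \<noteq> 0" unfolding X_def using l by (cases n) auto
    show ?thesis
      unfolding d_def X_def[symmetric] div_mult_self2[OF pos] div_less[OF that(1)] using that(2) by simp
  qed
  have term_eq: "(if (u + X * a) mod n = j \<and> d (Suc i) (u + X * a) = l
      then \<Prod>s<Suc i. f (d s (u + X * a)) (d (Suc s) (u + X * a)) else 0) =
    (if a = l then (if d 0 u = j then P u * f (d i u) l else 0) else 0)"
    if u: "u < X" and a: "a < n" for u a
  proof -
    have "(u + X * a) mod n = d 0 u" using low[of 0 u a] by (simp add: d_def)
    moreover have "(\<Prod>s<i. f (d s (u + X * a)) (d (Suc s) (u + X * a))) = P u"
      unfolding P_def by (rule prod.cong) (simp_all add: low Suc_leI)
    ultimately show ?thesis using top[OF u a] low[of i u a] by (auto simp: prod.lessThan_Suc)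
  qed
  have "walks n f (Suc i) j l = (\<Sum>w<X * n. if w mod n = j \<and> d (Suc i) w = l
      then \<Prod>s<Suc i. f (d s w) (d (Suc s) w) else 0)"
    unfolding walks_def d_def X_def power_Suc2[of n "Suc i"] ..
  also have "\<dots> = (\<Sum>a<n. \<Sum>u<X. if a = l then (if d 0 u = j then P u * f (d i u) l else 0) else 0)"
    unfolding sum_lessThan_mult by (intro sum.cong refl term_eq) auto
  also have "\<dots> = (\<Sum>u<X. \<Sum>a<n. if a = l then (if d 0 u = j then P u * f (d i u) l else 0) else 0)"
    by (rule sum.swap)
  also have "\<dots> = (\<Sum>u<X. if d 0 u = j then P u * f (d i u) l else 0)"
    using l by simp
  also have "\<dots> = (\<Sum>u<X. \<Sum>q<n. (if d 0 u = j \<and> d i u = q then P u else 0) * f q l)"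
  proof (rule sum.cong[OF refl])
    fix u
    have "(\<Sum>q<n. (if d 0 u = j \<and> d i u = q then P u else 0) * f q l) =
        (\<Sum>q<n. if q = d i u then (if d 0 u = j then P u * f (d i u) l else 0) else 0)"
      by (rule sum.cong) auto
    then show "(if d 0 u = j then P u * f (d i u) l else 0) =
        (\<Sum>q<n. (if d 0 u = j \<and> d i u = q then P u else 0) * f q l)"
      using d_less by simp
  qed
  also have "\<dots> = (\<Sum>q<n. \<Sum>u<X. (if d 0 u = j \<and> d i u = q then P u else 0) * f q l)"
    by (rule sum.swap)
  also have "\<dots> = (\<Sum>q<n. walks n f i j q * f q l)"
    unfolding walks_def sum_distrib_right d_def P_def X_def by simp
  finally show ?thesis .
qed

lemma walks_cong: "(\<And>p q. p < n \<Longrightarrow> q < n \<Longrightarrow> f p q = g p q) \<Longrightarrow> 0 < n \<Longrightarrow> walks n f i j l = walks n g i j l"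
  unfolding walks_def by (intro sum.cong if_cong prod.cong refl) simp

text \<open>Bounded sums and products suffice for this closed form, so the entries of matrix powers
  are computable without coding intermediate matrices by numbers.\<close>

lemma pow_mat_walks:
  fixes M :: "'a :: comm_ring_1 mat"
  assumes M: "M \<in> carrier_mat n n" and "j < n" "l < n"
  shows "(M ^\<^sub>m i) $$ (j, l) = walks n (\<lambda>p q. M $$ (p, q)) i j l"
  using \<open>l < n\<close>
proof (induction i arbitrary: l)
  case 0
  then show ?case using M \<open>j < n\<close> by (simp add: walks_0)
next
  case (Suc i)
  have "(M ^\<^sub>m Suc i) $$ (j, l) = (\<Sum>q<n. (M ^\<^sub>m i) $$ (j, q) * M $$ (q, l))"
    using M \<open>j < n\<close> Suc.prems by (simp add: scalar_prod_def atLeast0LessThan)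
  then show ?case using Suc by (simp add: walks_Suc)
qed

section \<open>Certificates for bounds on the exponent\<close>

lemma pow_smult_mat:
  fixes A :: "'a :: comm_ring_1 mat"
  assumes A: "A \<in> carrier_mat n n"
  shows "(c \<cdot>\<^sub>m A) ^\<^sub>m k = c ^ k \<cdot>\<^sub>m A ^\<^sub>m k"
proof (induction k)
  case 0
  show ?case by (rule eq_matI) (use A in auto)
next
  case (Suc k)
  have "(c \<cdot>\<^sub>m A) ^\<^sub>m Suc k = (c ^ k \<cdot>\<^sub>m A ^\<^sub>m k) * (c \<cdot>\<^sub>m A)" using Suc by simp
  also have "\<dots> = (c ^ k * c) \<cdot>\<^sub>m (A ^\<^sub>m k * A)"
    unfolding mult_smult_assoc_mat[OF pow_carrier_mat[OF A] smult_carrier_mat[OF A]]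
      mult_smult_distrib[OF pow_carrier_mat[OF A] A] smult_smult_mat ..
  finally show ?case by (simp add: mult.commute)
qed

lemma pow_mat_mult:
  fixes A :: "'a :: semiring_1 mat"
  assumes A: "A \<in> carrier_mat n n"
  shows "(A ^\<^sub>m k) ^\<^sub>m l = A ^\<^sub>m (k * l)"
  by (induction l) (use A in \<open>simp_all add: pow_mat_add[OF A, symmetric] add.commute\<close>)

lemma pow_mat_commute_mult:
  fixes A B :: "'a :: semiring_1 mat"
  assumes A: "A \<in> carrier_mat n n" and B: "B \<in> carrier_mat n n" and AB: "A * B = B * A"
  shows "(A * B) ^\<^sub>m k = A ^\<^sub>m k * B ^\<^sub>m k"
proof (induction k)
  case 0
  show ?case using A B by simp
next
  case (Suc k)
  note c = pow_carrier_mat[OF A] pow_carrier_mat[OF B] A B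
  have comm: "B ^\<^sub>m k * A = A * B ^\<^sub>m k" for k
  proof (induction k)
    case (Suc k)
    have "B ^\<^sub>m Suc k * A = B ^\<^sub>m k * (A * B)" using c by (simp add: AB assoc_mult_mat[of _ n n _ n _ n])
    also have "\<dots> = A * B ^\<^sub>m Suc k"
      using c Suc by (simp add: assoc_mult_mat[of _ n n _ n _ n, symmetric])
    finally show ?case .
  qed (use A B in auto)
  note m = mult_carrier_mat[OF c(2)[of k] A] mult_carrier_mat[OF A c(2)[of k]] mult_carrier_mat[OF A B]
  have "(A * B) ^\<^sub>m Suc k = A ^\<^sub>m k * (B ^\<^sub>m k * (A * B))"
    using Suc assoc_mult_mat[OF c(1)[of k] c(2)[of k] m(3)] by simp
  also have "B ^\<^sub>m k * (A * B) = A * B ^\<^sub>m k * B"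
    using assoc_mult_mat[OF c(2)[of k] A B] comm by simp
  also have "A ^\<^sub>m k * (A * B ^\<^sub>m k * B) = A ^\<^sub>m k * A * (B ^\<^sub>m k * B)"
    using assoc_mult_mat[OF A c(2)[of k] B] assoc_mult_mat[OF c(1)[of k] A mult_carrier_mat[OF c(2)[of k] B]]
    by simp
  finally show ?case by simp
qed

lemma smult_mat_cancel:
  fixes M :: "'a :: idom mat"
  assumes k: "k \<noteq> 0" and eq: "k \<cdot>\<^sub>m M = k \<cdot>\<^sub>m M'"
  shows "M = M'"
proof (rule eq_matI)
  show d: "dim_row M = dim_row M'" "dim_col M = dim_col M'"
    using arg_cong[OF eq, of dim_row] arg_cong[OF eq, of dim_col] by simp_all
  fix i j assume "i < dim_row M'" "j < dim_col M'"
  then show "M $$ (i, j) = M' $$ (i, j)"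
    using arg_cong[OF eq, of "\<lambda>M. M $$ (i, j)"] k d by simp
qed

lemma smult_minus_mat:
  fixes X Y :: "'a :: comm_ring_1 mat"
  assumes "X \<in> carrier_mat m n" "Y \<in> carrier_mat m n"
  shows "c \<cdot>\<^sub>m (X - Y) = c \<cdot>\<^sub>m X - c \<cdot>\<^sub>m Y"
  using assms by (intro eq_matI) (auto simp: algebra_simps)

text \<open>The rational matrices \<open>F / d\<close> and \<open>B / d\<close> are given by the integer matrices \<open>F\<close>, \<open>B\<close>.\<close>

definition power_eq :: "int \<Rightarrow> int mat \<Rightarrow> int mat \<Rightarrow> nat \<Rightarrow> bool" where
  "power_eq d F B i \<longleftrightarrow> d \<cdot>\<^sub>m F ^\<^sub>m i = d ^ i \<cdot>\<^sub>m B"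

text \<open>This is \<open>d ^ E\<close> times \<open>(F / d) ^ E - 1\<close>, written without
  denominators. It is used both for integers and for polynomials.\<close>

definition shift :: "'a :: comm_ring_1 \<Rightarrow> 'a mat \<Rightarrow> nat \<Rightarrow> 'a mat" where
  "shift d F E = F ^\<^sub>m E - d ^ E \<cdot>\<^sub>m 1\<^sub>m (dim_row F)"

text \<open>\<open>L\<close> is the bound of the effective Kronecker theorem for \<open>B\<close>,
  and the matrix is a multiple of \<open>A ^ (L + L!) - A ^ L\<close> with \<open>A = F / d\<close>.
  A solution above \<open>L\<close> would force that difference to be nilpotent.\<close>

definition cert1 :: "nat \<Rightarrow> int \<Rightarrow> int mat \<Rightarrow> int mat \<Rightarrow> nat \<Rightarrow> bool" where
  "cert1 n d F B L \<longleftrightarrow>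
     L = (2 * (n * nat \<bar>d\<bar> * (nat (\<Sum>i<n. \<Sum>j<n. \<bar>B $$ (i, j)\<bar>) + 1)) + 1) ^ n + n \<and>
     (F ^\<^sub>m (L + fact L) - d ^ fact L \<cdot>\<^sub>m F ^\<^sub>m L) ^\<^sub>m n \<noteq> 0\<^sub>m n n"

text \<open>With \<open>R = (F / d) ^ E\<close> and \<open>W = U R - U\<close>, the condition \<open>U (R - 1)\<^sup>2 = 0\<close> gives
  \<open>U R ^ i = U + i W\<close>, so \<open>i\<close> can be read off \<open>U R ^ i\<close> if \<open>W \<noteq> 0\<close>.\<close>

definition cert2 :: "nat \<Rightarrow> int \<Rightarrow> int mat \<Rightarrow> int mat \<Rightarrow> nat \<Rightarrow> int mat \<Rightarrow> nat \<Rightarrow> bool" where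
  "cert2 n d F B L U E \<longleftrightarrow>
     U * shift d F E * shift d F E = 0\<^sub>m 1 n \<and>
     (\<exists>l<n. (U * shift d F E) $$ (0, l) \<noteq> 0 \<and> \<bar>(U * shift d B E) $$ (0, l)\<bar> \<le> int L)"

text \<open>This is \<open>A ^ L = A ^ k\<close> with denominators cleared. It does not involve
  \<open>B\<close>, and it limits only the least exponent of a solution.\<close>

definition cert3 :: "int \<Rightarrow> int mat \<Rightarrow> nat \<Rightarrow> bool" where
  "cert3 d F L \<longleftrightarrow> (\<exists>k<L. F ^\<^sub>m L = d ^ (L - k) \<cdot>\<^sub>m F ^\<^sub>m k)"

lemma shift_carrier [simp]: "F \<in> carrier_mat n n \<Longrightarrow> shift d F E \<in> carrier_mat n n"
  unfolding shift_def by (intro minus_carrier_mat smult_carrier_mat) auto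

lemma map_mat_minus:
  assumes "\<And>x y. h (x - y) = h x - h y" "X \<in> carrier_mat m n" "Y \<in> carrier_mat m n"
  shows "map_mat h (X - Y) = map_mat h X - map_mat h Y"
  using assms by (intro eq_matI) auto

lemma map_mat_smult:
  assumes "\<And>x y. h (x * y) = h x * h y"
  shows "map_mat h (c \<cdot>\<^sub>m X) = h c \<cdot>\<^sub>m map_mat h X"
  using assms by (intro eq_matI) auto

lemma map_mat_shift:
  assumes "comm_ring_hom h" "F \<in> carrier_mat n n"
  shows "map_mat h (shift d F E) = shift (h d) (map_mat h F) E"
proof -
  interpret comm_ring_hom h by fact
  show ?thesis using assms(2) unfolding shift_def
    by (subst map_mat_minus[of _ _ n n])
       (auto simp: hom_minus mat_hom_pow[OF assms(2)] map_mat_smult hom_mult hom_power mat_hom_one)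
qed

text \<open>The certificates speak of integer matrices, the results on eigenvalues of the rational
  matrices \<open>C = F / d\<close> and \<open>D = B / d\<close>; the locale translates between
  them.\<close>

locale fraction_pair =
  fixes n :: nat and d :: int and F B :: "int mat" and C D :: "rat mat"
  assumes d: "d \<noteq> 0" and F: "F \<in> carrier_mat n n" and B: "B \<in> carrier_mat n n"
    and C: "C \<in> carrier_mat n n" and D: "D \<in> carrier_mat n n"
    and CF: "of_int d \<cdot>\<^sub>m C = map_mat of_int F" and DB: "of_int d \<cdot>\<^sub>m D = map_mat of_int B"
begin

lemma d_rat: "rat_of_int d \<noteq> 0" "rat_of_int d ^ k \<noteq> 0"
  using d by auto

lemma F_pow: "map_mat of_int (F ^\<^sub>m k) = rat_of_int d ^ k \<cdot>\<^sub>m C ^\<^sub>m k"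
  unfolding of_int_hom.mat_hom_pow[OF F] CF[symmetric] by (rule pow_smult_mat[OF C])

lemma B_pow: "map_mat of_int (B ^\<^sub>m k) = rat_of_int d ^ k \<cdot>\<^sub>m D ^\<^sub>m k"
  unfolding of_int_hom.mat_hom_pow[OF B] DB[symmetric] by (rule pow_smult_mat[OF D])

lemma power_eq_iff: "power_eq d F B i \<longleftrightarrow> C ^\<^sub>m i = D"
proof -
  have s: "map_mat rat_of_int (c \<cdot>\<^sub>m X) = of_int c \<cdot>\<^sub>m map_mat of_int X" for c X
    by (rule map_mat_smult) simp
  have "power_eq d F B i \<longleftrightarrow> map_mat rat_of_int (d \<cdot>\<^sub>m F ^\<^sub>m i) = map_mat of_int (d ^ i \<cdot>\<^sub>m B)"
    unfolding power_eq_def by (rule iffI, erule arg_cong, erule of_int_hom.mat_hom_inj)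
  also have "\<dots> \<longleftrightarrow> (of_int d * of_int d ^ i) \<cdot>\<^sub>m C ^\<^sub>m i = (of_int d * of_int d ^ i) \<cdot>\<^sub>m D"
    unfolding s F_pow DB[symmetric] of_int_power smult_smult_mat mult.commute[of "of_int d ^ i"] ..
  also have "\<dots> \<longleftrightarrow> C ^\<^sub>m i = D"
    using smult_mat_cancel[of "of_int d * of_int d ^ i" "C ^\<^sub>m i" D] d_rat by auto
  finally show ?thesis .
qed

lemma pow_diff_eq: "map_mat of_int (F ^\<^sub>m (k + q) - d ^ q \<cdot>\<^sub>m F ^\<^sub>m k) =
    rat_of_int d ^ (k + q) \<cdot>\<^sub>m (C ^\<^sub>m (k + q) - C ^\<^sub>m k)"
proof -
  have "map_mat of_int (F ^\<^sub>m (k + q) - d ^ q \<cdot>\<^sub>m F ^\<^sub>m k) =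
      map_mat rat_of_int (F ^\<^sub>m (k + q)) - of_int (d ^ q) \<cdot>\<^sub>m map_mat of_int (F ^\<^sub>m k)"
    using F by (subst map_mat_minus[of _ _ n n]) (auto simp: map_mat_smult)
  also have "\<dots> = of_int d ^ (k + q) \<cdot>\<^sub>m C ^\<^sub>m (k + q) - of_int d ^ (k + q) \<cdot>\<^sub>m C ^\<^sub>m k"
    unfolding F_pow smult_smult_mat by (simp add: power_add mult.commute)
  also have "\<dots> = of_int d ^ (k + q) \<cdot>\<^sub>m (C ^\<^sub>m (k + q) - C ^\<^sub>m k)"
    by (rule smult_minus_mat[OF pow_carrier_mat[OF C] pow_carrier_mat[OF C], symmetric])
  finally show ?thesis .
qed

lemma nilpotent_iff: "(F ^\<^sub>m (k + q) - d ^ q \<cdot>\<^sub>m F ^\<^sub>m k) ^\<^sub>m n = 0\<^sub>m n n \<longleftrightarrow>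
    (C ^\<^sub>m (k + q) - C ^\<^sub>m k) ^\<^sub>m n = 0\<^sub>m n n"
proof -
  let ?N = "F ^\<^sub>m (k + q) - d ^ q \<cdot>\<^sub>m F ^\<^sub>m k" and ?M = "C ^\<^sub>m (k + q) - C ^\<^sub>m k"
  have N: "?N \<in> carrier_mat n n" and M: "?M \<in> carrier_mat n n"
    using F C by (auto intro!: minus_carrier_mat)
  have z: "map_mat rat_of_int (0\<^sub>m n n) = c \<cdot>\<^sub>m 0\<^sub>m n n" for c by (rule eq_matI) auto
  have eq: "map_mat rat_of_int (?N ^\<^sub>m n) = (of_int d ^ (k + q)) ^ n \<cdot>\<^sub>m ?M ^\<^sub>m n"
    unfolding of_int_hom.mat_hom_pow[OF N] pow_diff_eq by (rule pow_smult_mat[OF M])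
  have nz: "(rat_of_int d ^ (k + q)) ^ n \<noteq> 0" using d by simp
  have "?N ^\<^sub>m n = 0\<^sub>m n n \<longleftrightarrow> map_mat rat_of_int (?N ^\<^sub>m n) = map_mat rat_of_int (0\<^sub>m n n)"
    by (rule iffI, erule arg_cong, erule of_int_hom.mat_hom_inj)
  also have "\<dots> \<longleftrightarrow> ?M ^\<^sub>m n = 0\<^sub>m n n"
    unfolding eq z[of "(of_int d ^ (k + q)) ^ n"]
    by (rule iffI, erule smult_mat_cancel[OF nz], erule arg_cong)
  finally show ?thesis .
qed

lemma cert1_sound:
  assumes "power_eq d F B i" "cert1 n d F B L"
  shows "i \<le> L"
proof (rule ccontr)
  assume "\<not> i \<le> L"
  then have less: "L < i" by simp
  have L: "L = (2 * (n * nat \<bar>d\<bar> * (nat (\<Sum>i<n. \<Sum>j<n. \<bar>B $$ (i, j)\<bar>) + 1)) + 1) ^ n + n"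
    and N: "(C ^\<^sub>m (L + fact L) - C ^\<^sub>m L) ^\<^sub>m n \<noteq> 0\<^sub>m n n"
    using assms(2) unfolding cert1_def nilpotent_iff by blast+
  have "of_int d \<cdot>\<^sub>m C ^\<^sub>m i = map_mat of_int B"
    using assms(1) DB unfolding power_eq_iff by simp
  from nilpotent_of_large_power[OF C B d this, folded L, OF less] show False by (rule notE[OF N])
qed

text \<open>Nilpotency at any \<open>L\<close> would imply it at \<open>W\<close>. Failure at
  \<open>W\<close>, a number depending on \<open>n\<close> only, therefore gives failure at every
  \<open>L\<close>, in particular at the one that \<open>B\<close> prescribes.\<close>

lemma cert1_complete:
  defines "W \<equiv> (2 * n + 1) ^ n + n"
  assumes "(F ^\<^sub>m (W + fact W) - d ^ fact W \<cdot>\<^sub>m F ^\<^sub>m W) ^\<^sub>m n \<noteq> 0\<^sub>m n n"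
  shows "\<exists>L. cert1 n d F B L"
proof -
  have "(C ^\<^sub>m (W + fact W) - C ^\<^sub>m W) ^\<^sub>m n \<noteq> 0\<^sub>m n n" using assms(2) unfolding nilpotent_iff .
  moreover have "(C ^\<^sub>m (W + fact W) - C ^\<^sub>m W) ^\<^sub>m n = 0\<^sub>m n n"
    if "(C ^\<^sub>m (L + fact L) - C ^\<^sub>m L) ^\<^sub>m n = 0\<^sub>m n n" for L
    unfolding W_def by (rule nilpotent_uniform[OF C that fact_gt_zero])
  ultimately have nz: "(C ^\<^sub>m (L + fact L) - C ^\<^sub>m L) ^\<^sub>m n \<noteq> 0\<^sub>m n n" for L by blast
  show ?thesis unfolding cert1_def nilpotent_iff by (rule exI, rule conjI, rule refl, rule nz)
qed

lemma shift_int: "map_mat rat_of_int (shift d F E) = of_int d ^ E \<cdot>\<^sub>m (C ^\<^sub>m E - 1\<^sub>m n)"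
    "map_mat rat_of_int (shift d B E) = of_int d ^ E \<cdot>\<^sub>m (D ^\<^sub>m E - 1\<^sub>m n)"
proof -
  have *: "map_mat rat_of_int (shift d X E) = of_int d ^ E \<cdot>\<^sub>m (Y ^\<^sub>m E - 1\<^sub>m n)"
    if X: "X \<in> carrier_mat n n" and Y: "Y \<in> carrier_mat n n"
      and eq: "map_mat of_int (X ^\<^sub>m E) = rat_of_int d ^ E \<cdot>\<^sub>m Y ^\<^sub>m E" for X Y
  proof -
    have "map_mat rat_of_int (shift d X E) = map_mat of_int (X ^\<^sub>m E) - of_int d ^ E \<cdot>\<^sub>m 1\<^sub>m n"
      unfolding shift_def using X
      by (subst map_mat_minus[of _ _ n n]) (auto simp: map_mat_smult of_int_hom.mat_hom_one)
    also have "\<dots> = of_int d ^ E \<cdot>\<^sub>m (Y ^\<^sub>m E - 1\<^sub>m n)"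
      unfolding eq by (rule smult_minus_mat[OF pow_carrier_mat[OF Y] one_carrier_mat, symmetric])
    finally show ?thesis .
  qed
  show "map_mat rat_of_int (shift d F E) = of_int d ^ E \<cdot>\<^sub>m (C ^\<^sub>m E - 1\<^sub>m n)"
    "map_mat rat_of_int (shift d B E) = of_int d ^ E \<cdot>\<^sub>m (D ^\<^sub>m E - 1\<^sub>m n)"
    by (rule *[OF F C F_pow], rule *[OF B D B_pow])
qed

lemma cert2_sound:
  assumes eq: "power_eq d F B i" and cert: "cert2 n d F B L U E" and U: "U \<in> carrier_mat 1 n"
  shows "i \<le> L"
proof -
  let ?e = "rat_of_int d ^ E" and ?V = "map_mat rat_of_int U"
  define R where "R = C ^\<^sub>m E"
  define W where "W = ?V * R - ?V"
  have R: "R \<in> carrier_mat n n" unfolding R_def using C by simp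
  have V: "?V \<in> carrier_mat 1 n" using U by simp
  have W: "W \<in> carrier_mat 1 n" unfolding W_def using V R by (intro minus_carrier_mat) auto
  have VX: "?V * (X - 1\<^sub>m n) = ?V * X - ?V" if "X \<in> carrier_mat n n" for X
    using mult_minus_distrib_mat[OF V that one_carrier_mat] V by simp
  have US: "map_mat rat_of_int (U * shift d F E) = ?e \<cdot>\<^sub>m W"
    unfolding of_int_hom.mat_hom_mult[OF U shift_carrier[OF F]] shift_int W_def VX[OF R, symmetric]
    unfolding R_def using V C by (intro mult_smult_distrib[of _ 1 n _ n] minus_carrier_mat) auto
  have UB: "map_mat rat_of_int (U * shift d B E) = ?e \<cdot>\<^sub>m (?V * D ^\<^sub>m E - ?V)"
    unfolding of_int_hom.mat_hom_mult[OF U shift_carrier[OF B]] shift_int VX[OF pow_carrier_mat[OF D], symmetric]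
    using V D by (intro mult_smult_distrib[of _ 1 n _ n] minus_carrier_mat) auto
  have "map_mat rat_of_int (U * shift d F E * shift d F E) = ?e \<cdot>\<^sub>m (?e \<cdot>\<^sub>m (W * R - W))"
  proof -
    have "map_mat rat_of_int (U * shift d F E * shift d F E) = (?e \<cdot>\<^sub>m W) * (?e \<cdot>\<^sub>m (R - 1\<^sub>m n))"
      unfolding of_int_hom.mat_hom_mult[OF mult_carrier_mat[OF U shift_carrier[OF F]] shift_carrier[OF F]]
        US shift_int R_def ..
    also have "\<dots> = ?e \<cdot>\<^sub>m (W * (?e \<cdot>\<^sub>m (R - 1\<^sub>m n)))"
      using W by (intro mult_smult_assoc_mat[of _ 1 n _ n] smult_carrier_mat minus_carrier_mat) auto
    also have "W * (?e \<cdot>\<^sub>m (R - 1\<^sub>m n)) = ?e \<cdot>\<^sub>m (W * (R - 1\<^sub>m n))"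
      using W by (intro mult_smult_distrib[of _ 1 n _ n] minus_carrier_mat) auto
    also have "W * (R - 1\<^sub>m n) = W * R - W"
      using mult_minus_distrib_mat[OF W R one_carrier_mat] W by simp
    finally show ?thesis .
  qed
  moreover have "U * shift d F E * shift d F E = 0\<^sub>m 1 n" using cert unfolding cert2_def by blast
  ultimately have "?e \<cdot>\<^sub>m (?e \<cdot>\<^sub>m (W * R - W)) = map_mat rat_of_int (0\<^sub>m 1 n)" by simp
  also have "\<dots> = ?e \<cdot>\<^sub>m (?e \<cdot>\<^sub>m 0\<^sub>m 1 n)" by (rule eq_matI) auto
  finally have "?e \<cdot>\<^sub>m (W * R - W) = ?e \<cdot>\<^sub>m 0\<^sub>m 1 n" by (rule smult_mat_cancel[OF d_rat(2)])
  then have WR0: "W * R - W = 0\<^sub>m 1 n" by (rule smult_mat_cancel[OF d_rat(2)])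
  have WR: "W * R = W"
  proof (rule eq_matI)
    fix a b assume "a < dim_row W" "b < dim_col W"
    then show "(W * R) $$ (a, b) = W $$ (a, b)"
      using arg_cong[OF WR0, of "\<lambda>M. M $$ (a, b)"] W by simp
  qed (use W R in auto)
  \<comment> \<open>\<open>R\<close> fixes \<open>W\<close>, so every further factor
    \<open>R\<close> adds \<open>W\<close> once more.\<close>
  have VR: "?V * R ^\<^sub>m k = ?V + of_nat k \<cdot>\<^sub>m W" for k
  proof (induction k)
    case 0
    show ?case using V W R by (intro eq_matI) auto
  next
    case (Suc k)
    have "?V * R ^\<^sub>m Suc k = (?V + of_nat k \<cdot>\<^sub>m W) * R"
      using assoc_mult_mat[OF V pow_carrier_mat[OF R, of k] R] Suc by simp
    also have "\<dots> = ?V * R + of_nat k \<cdot>\<^sub>m W"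
      using add_mult_distrib_mat[OF V smult_carrier_mat[OF W] R] mult_smult_assoc_mat[OF W R] WR by simp
    also have "?V * R = ?V + W"
      unfolding W_def using V mult_carrier_mat[OF V R] by (intro eq_matI) auto
    also have "?V + W + of_nat k \<cdot>\<^sub>m W = ?V + of_nat (Suc k) \<cdot>\<^sub>m W"
      using V W by (intro eq_matI) (auto simp: algebra_simps)
    finally show ?case .
  qed
  obtain l where l: "l < n" "(U * shift d F E) $$ (0, l) \<noteq> 0" "\<bar>(U * shift d B E) $$ (0, l)\<bar> \<le> int L"
    using cert unfolding cert2_def by blast
  have "R ^\<^sub>m i = D ^\<^sub>m E"
    using eq pow_mat_mult[OF C, of E i] pow_mat_mult[OF C, of i E] unfolding R_def power_eq_iff
    by (simp add: mult.commute)
  then have "?V * D ^\<^sub>m E - ?V = of_nat i \<cdot>\<^sub>m W"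
    using VR[of i] V W by (intro eq_matI) auto
  \<comment> \<open>Both rows carry the same factor \<open>d ^ E\<close>, so \<open>i\<close> is a
    quotient of integer entries.\<close>
  then have "map_mat rat_of_int (U * shift d B E) = of_nat i \<cdot>\<^sub>m map_mat rat_of_int (U * shift d F E)"
    unfolding UB US by (simp add: smult_smult_mat mult.commute)
  moreover have "rat_of_int (X $$ (0, l)) = of_int (int i * Y $$ (0, l))"
    if "map_mat rat_of_int X = of_nat i \<cdot>\<^sub>m map_mat rat_of_int Y" "X \<in> carrier_mat 1 n" "Y \<in> carrier_mat 1 n"
    for X Y
    using arg_cong[OF that(1), of "\<lambda>M. M $$ (0, l)"] that(2,3) l(1) by simp
  ultimately have "rat_of_int ((U * shift d B E) $$ (0, l)) = of_int (int i * (U * shift d F E) $$ (0, l))"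
    using mult_carrier_mat[OF U shift_carrier[OF F]] mult_carrier_mat[OF U shift_carrier[OF B]] by blast
  then have "(U * shift d B E) $$ (0, l) = int i * (U * shift d F E) $$ (0, l)" by (simp only: of_int_eq_iff)
  then have "int i * \<bar>(U * shift d F E) $$ (0, l)\<bar> \<le> int L" using l(3) by (simp add: abs_mult)
  \<comment> \<open>A nonzero integer has absolute value at least 1.\<close>
  moreover have "int i * 1 \<le> int i * \<bar>(U * shift d F E) $$ (0, l)\<bar>"
    using l(2) by (intro mult_left_mono) auto
  ultimately show ?thesis by linarith
qed

text \<open>Descent: an exponent \<open>L + r\<close> can be replaced by the smaller exponent
  \<open>k + r\<close>.\<close>

lemma cert3_sound:
  assumes eq: "power_eq d F B i" and cert: "cert3 d F L"
  shows "\<exists>j\<le>L. power_eq d F B j"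
  using eq
proof (induction i rule: less_induct)
  case (less i)
  obtain k where k: "k < L" "F ^\<^sub>m L = d ^ (L - k) \<cdot>\<^sub>m F ^\<^sub>m k" using cert unfolding cert3_def by blast
  have "map_mat rat_of_int (d ^ (L - k) \<cdot>\<^sub>m F ^\<^sub>m k) = (of_int d ^ (L - k) * of_int d ^ k) \<cdot>\<^sub>m C ^\<^sub>m k"
    by (simp add: map_mat_smult F_pow smult_smult_mat)
  then have "of_int d ^ L \<cdot>\<^sub>m C ^\<^sub>m L = of_int d ^ L \<cdot>\<^sub>m C ^\<^sub>m k"
    using arg_cong[OF k(2), of "map_mat rat_of_int"] k(1) unfolding F_pow by (simp add: power_add[symmetric])
  then have CL: "C ^\<^sub>m L = C ^\<^sub>m k" by (rule smult_mat_cancel[OF d_rat(2)])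
  show ?case
  proof (cases "i \<le> L")
    case False
    then obtain r where i: "i = L + r" by (metis le_iff_add linear)
    have "C ^\<^sub>m (k + r) = C ^\<^sub>m i" unfolding i pow_mat_add[OF C] CL ..
    then have "power_eq d F B (k + r)" using less.prems unfolding power_eq_iff by simp
    then show ?thesis using less.IH[of "k + r"] k(1) i by simp
  qed (use less.prems in blast)
qed

end

lemma fraction_pair_ex:
  assumes "d \<noteq> 0" "F \<in> carrier_mat n n" "B \<in> carrier_mat n n"
  obtains C D where "fraction_pair n d F B C D"
proof
  have *: "of_int d \<cdot>\<^sub>m (inverse (rat_of_int d) \<cdot>\<^sub>m map_mat of_int M) = map_mat of_int M" for M
    using assms(1) unfolding smult_smult_mat by (intro eq_matI) auto
  show "fraction_pair n d F B (inverse (of_int d) \<cdot>\<^sub>m map_mat of_int F) (inverse (of_int d) \<cdot>\<^sub>m map_mat of_int B)"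
    using assms * by unfold_locales auto
qed

section \<open>Existence of a certificate\<close>

lemma mat_neqE:
  assumes "X \<noteq> Y" "X \<in> carrier_mat m n" "Y \<in> carrier_mat m n"
  obtains j l where "j < m" "l < n" "X $$ (j, l) \<noteq> Y $$ (j, l)"
  using assms eq_matI[of Y X] by auto

lemma pow_mult_shift:
  fixes A :: "'a :: comm_ring_1 mat"
  assumes A: "A \<in> carrier_mat n n"
  shows "A ^\<^sub>m k * shift c A E = A ^\<^sub>m (k + E) - c ^ E \<cdot>\<^sub>m A ^\<^sub>m k"
    and "shift c A E * A ^\<^sub>m k = A ^\<^sub>m (k + E) - c ^ E \<cdot>\<^sub>m A ^\<^sub>m k"
proof -
  note Ak = pow_carrier_mat[OF A]
  have d: "dim_row A = n" using A by simp
  show "A ^\<^sub>m k * shift c A E = A ^\<^sub>m (k + E) - c ^ E \<cdot>\<^sub>m A ^\<^sub>m k"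
    unfolding shift_def d mult_minus_distrib_mat[OF Ak Ak smult_carrier_mat[OF one_carrier_mat]]
      mult_smult_distrib[OF Ak one_carrier_mat] pow_mat_add[OF A, symmetric] right_mult_one_mat[OF Ak] ..
  show "shift c A E * A ^\<^sub>m k = A ^\<^sub>m (k + E) - c ^ E \<cdot>\<^sub>m A ^\<^sub>m k"
    unfolding shift_def d minus_mult_distrib_mat[OF Ak smult_carrier_mat[OF one_carrier_mat] Ak]
      mult_smult_assoc_mat[OF one_carrier_mat Ak] pow_mat_add[OF A, symmetric] left_mult_one_mat[OF Ak]
      add.commute[of E] ..
qed

text \<open>The cases are distinguished over the polynomials, before a point is chosen. For
  \<open>A = a / c\<close>, \<open>T\<close> is a multiple of \<open>A ^ (W + E) - A ^ W\<close>. If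
  \<open>T ^ n\<close> is nonzero, some point keeps it nonzero and the first certificate exists
  there. Otherwise \<open>a ^ m * S ^ n = 0\<close>. If already \<open>a ^ m * S = 0\<close>, the
  powers of \<open>A\<close> are eventually periodic. If not, the product two steps before the first
  vanishing one has a row \<open>U\<close> with \<open>U S \<noteq> 0\<close> and
  \<open>U S S = 0\<close>.\<close>

lemma certificate_ex:
  fixes a b :: "qpoly mat" and c :: qpoly and d :: "nat \<Rightarrow> nat \<Rightarrow> int" and F B :: "nat \<Rightarrow> nat \<Rightarrow> int mat"
  assumes a: "a \<in> carrier_mat n n" and b: "b \<in> carrier_mat n n" and c: "c \<noteq> 0"
    and F: "\<And>G t. F G t \<in> carrier_mat n n" and B: "\<And>G t. B G t \<in> carrier_mat n n"
    and ev_c: "\<And>G t. ev G t c = of_int (d G t)"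
    and ev_a: "\<And>G t. map_mat (ev G t) a = map_mat of_int (F G t)"
    and ev_b: "\<And>G t. map_mat (ev G t) b = map_mat of_int (B G t)"
    and no: "\<And>i. c \<cdot>\<^sub>m a ^\<^sub>m i \<noteq> c ^ i \<cdot>\<^sub>m b"
  shows "\<exists>G t G' t' L. d G t \<noteq> 0 \<and> d G' t' \<noteq> 0 \<and>
    (cert1 n (d G t) (F G t) (B G t) L \<or>
     (\<exists>U \<in> carrier_mat 1 n. \<exists>E. cert2 n (d G t) (F G t) (B G t) L U E) \<or> cert3 (d G' t') (F G' t') L) \<and>
    (\<forall>i\<le>L. \<not> power_eq (d G' t') (F G' t') (B G' t') i)"
proof -
  \<comment> \<open>\<open>c\<close> joins the set, so that the common denominator does not vanish
    at the point either.\<close>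
  have point: "\<exists>G t. d G t \<noteq> 0 \<and> (\<forall>p \<in> S. ev G t p \<noteq> 0)" if "finite S" "0 \<notin> S" for S
    using ev_nonzero_ex[of "insert c S"] that c by (auto simp: ev_c)
  have ev_smult: "map_mat (ev G t) (p \<cdot>\<^sub>m M) = ev G t p \<cdot>\<^sub>m map_mat (ev G t) M" for G t p M
  proof -
    interpret comm_ring_hom "ev G t" by (rule ev_hom)
    show ?thesis by (rule map_mat_smult[OF hom_mult])
  qed
  have ev_power: "ev G t (p ^ k) = ev G t p ^ k" for G t p k
  proof -
    interpret comm_ring_hom "ev G t" by (rule ev_hom)
    show ?thesis by (rule hom_power)
  qed
  have ev_pow: "map_mat (ev G t) (a ^\<^sub>m k) = map_mat of_int (F G t ^\<^sub>m k)" for G t k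
  proof -
    interpret comm_ring_hom "ev G t" by (rule ev_hom)
    show ?thesis by (simp add: mat_hom_pow[OF a] of_int_hom.mat_hom_pow[OF F] ev_a)
  qed
  have int_smult: "map_mat rat_of_int (z \<cdot>\<^sub>m M) = of_int z \<cdot>\<^sub>m map_mat of_int M" for z M
    by (rule map_mat_smult) simp
  \<comment> \<open>Each \<open>i \<le> L\<close> contributes one entry in which the two sides
    differ; a point that keeps these finitely many polynomials nonzero separates all of these
    exponents.\<close>
  have differ: "\<exists>G t. d G t \<noteq> 0 \<and> (\<forall>i\<le>L. \<not> power_eq (d G t) (F G t) (B G t) i)" for L
  proof -
    have "\<exists>j l. j < n \<and> l < n \<and> (c \<cdot>\<^sub>m a ^\<^sub>m i) $$ (j, l) \<noteq> (c ^ i \<cdot>\<^sub>m b) $$ (j, l)" for i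
      by (rule mat_neqE[OF no[of i] smult_carrier_mat[OF pow_carrier_mat[OF a]] smult_carrier_mat[OF b]]) blast
    then obtain j l where jl: "\<And>i. j i < n" "\<And>i. l i < n"
      "\<And>i. (c \<cdot>\<^sub>m a ^\<^sub>m i) $$ (j i, l i) \<noteq> (c ^ i \<cdot>\<^sub>m b) $$ (j i, l i)" by metis
    define p where "p i = (c \<cdot>\<^sub>m a ^\<^sub>m i) $$ (j i, l i) - (c ^ i \<cdot>\<^sub>m b) $$ (j i, l i)" for i
    have "0 \<notin> p ` {..L}" using jl(3) by (auto simp: p_def)
    then obtain G t where Gt: "d G t \<noteq> 0" "\<forall>q \<in> p ` {..L}. ev G t q \<noteq> 0" using point[of "p ` {..L}"] by auto
    have "\<not> power_eq (d G t) (F G t) (B G t) i" if "i \<le> L" for i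
    proof
      interpret comm_ring_hom "ev G t" by (rule ev_hom)
      assume "power_eq (d G t) (F G t) (B G t) i"
      then have "map_mat rat_of_int (d G t \<cdot>\<^sub>m F G t ^\<^sub>m i) = map_mat of_int (d G t ^ i \<cdot>\<^sub>m B G t)"
        unfolding power_eq_def by simp
      then have "map_mat (ev G t) (c \<cdot>\<^sub>m a ^\<^sub>m i) = map_mat (ev G t) (c ^ i \<cdot>\<^sub>m b)"
        unfolding ev_smult ev_power ev_c ev_pow ev_b int_smult of_int_power .
      from arg_cong[OF this, of "\<lambda>M. M $$ (j i, l i)"]
      have "ev G t ((c \<cdot>\<^sub>m a ^\<^sub>m i) $$ (j i, l i)) = ev G t ((c ^ i \<cdot>\<^sub>m b) $$ (j i, l i))"
        using index_map_mat(1)[of "j i" "c \<cdot>\<^sub>m a ^\<^sub>m i" "l i" "ev G t"]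
          index_map_mat(1)[of "j i" "c ^ i \<cdot>\<^sub>m b" "l i" "ev G t"]
          smult_carrier_mat[OF pow_carrier_mat[OF a], of c i] smult_carrier_mat[OF b, of "c ^ i"] jl(1,2)[of i]
        by (metis carrier_matD)
      then have "ev G t (p i) = 0" by (simp add: p_def hom_minus)
      then show False using Gt(2) that by auto
    qed
    then show ?thesis using Gt(1) by blast
  qed
  \<comment> \<open>The first two certificates bound the exponents outright, so the separating point
    can be chosen afterwards, once \<open>L\<close> is known.\<close>
  have finish: ?thesis
    if "\<exists>G t L. d G t \<noteq> 0 \<and> (cert1 n (d G t) (F G t) (B G t) L \<or>
      (\<exists>U \<in> carrier_mat 1 n. \<exists>E. cert2 n (d G t) (F G t) (B G t) L U E))"
    using that differ by meson
  define W where "W = (2 * n + 1) ^ n + n"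
  define E where "E = (fact W :: nat)"
  define T where "T = a ^\<^sub>m (W + E) - c ^ E \<cdot>\<^sub>m a ^\<^sub>m W"
  define S where "S = shift c a E"
  have T: "T \<in> carrier_mat n n" unfolding T_def using a by (intro minus_carrier_mat smult_carrier_mat pow_carrier_mat)
  have S: "S \<in> carrier_mat n n" unfolding S_def using a by simp
  have ev_S: "map_mat (ev G t) S = map_mat of_int (shift (d G t) (F G t) E)" for G t
    unfolding S_def map_mat_shift[OF ev_hom a] ev_a ev_c
      map_mat_shift[OF of_int_hom.comm_ring_hom_axioms F] ..
  show ?thesis
  proof (cases "T ^\<^sub>m n = 0\<^sub>m n n")
    case False
    then obtain j l where jl: "j < n" "l < n" "(T ^\<^sub>m n) $$ (j, l) \<noteq> 0\<^sub>m n n $$ (j, l)"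
      by (rule mat_neqE[OF _ pow_carrier_mat[OF T] zero_carrier_mat])
    then obtain G t where Gt: "d G t \<noteq> 0" "ev G t ((T ^\<^sub>m n) $$ (j, l)) \<noteq> 0"
      using point[of "{(T ^\<^sub>m n) $$ (j, l)}"] by auto
    interpret ev: comm_ring_hom "ev G t" by (rule ev_hom)
    let ?T = "F G t ^\<^sub>m (W + E) - d G t ^ E \<cdot>\<^sub>m F G t ^\<^sub>m W"
    have T': "?T \<in> carrier_mat n n" using F by (intro minus_carrier_mat smult_carrier_mat pow_carrier_mat)
    have "map_mat (ev G t) T = map_mat of_int ?T"
      unfolding T_def
        map_mat_minus[OF ev.hom_minus pow_carrier_mat[OF a] smult_carrier_mat[OF pow_carrier_mat[OF a]]]
        map_mat_minus[OF of_int_diff pow_carrier_mat[OF F] smult_carrier_mat[OF pow_carrier_mat[OF F]]]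
        ev_smult ev_power ev_c ev_pow int_smult of_int_power ..
    then have evT: "map_mat (ev G t) (T ^\<^sub>m n) = map_mat of_int (?T ^\<^sub>m n)"
      by (simp add: ev.mat_hom_pow[OF T] of_int_hom.mat_hom_pow[OF T'])
    have "?T ^\<^sub>m n \<noteq> 0\<^sub>m n n"
    proof
      assume "?T ^\<^sub>m n = 0\<^sub>m n n"
      then have "map_mat (ev G t) (T ^\<^sub>m n) $$ (j, l) = 0" unfolding evT using jl(1,2) by simp
      then show False using Gt(2) jl(1,2) pow_carrier_mat[OF T, of n] by (metis carrier_matD index_map_mat(1))
    qed
    moreover obtain C D where "fraction_pair n (d G t) (F G t) (B G t) C D"
      using fraction_pair_ex[OF Gt(1) F B] .
    ultimately have "\<exists>L. cert1 n (d G t) (F G t) (B G t) L"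
      unfolding W_def E_def by (intro fraction_pair.cert1_complete)
    then show ?thesis using finish Gt(1) by blast
  next
    case True
    \<comment> \<open>\<open>T = a ^ W * S\<close> with commuting factors, so
      \<open>T ^ n = a ^ (W * n) * S ^ n\<close>.\<close>
    define m where "m = W * n"
    define Z where "Z s = a ^\<^sub>m m * S ^\<^sub>m s" for s
    note am = pow_carrier_mat[OF a, of m]
    have Z: "Z s \<in> carrier_mat n n" for s unfolding Z_def using am pow_carrier_mat[OF S] by (rule mult_carrier_mat)
    have Z_Suc: "Z (Suc s) = Z s * S" for s
      unfolding Z_def using assoc_mult_mat[OF am pow_carrier_mat[OF S] S] by simp
    have "T = a ^\<^sub>m W * S" "a ^\<^sub>m W * S = S * a ^\<^sub>m W"
      unfolding T_def S_def pow_mult_shift[OF a] by simp_all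
    then have "T ^\<^sub>m n = Z n"
      using pow_mat_commute_mult[OF pow_carrier_mat[OF a] S] pow_mat_mult[OF a] unfolding Z_def m_def by simp
    then have Zn: "Z n = 0\<^sub>m n n" using True by simp
    show ?thesis
    proof (cases "Z 1 = 0\<^sub>m n n")
      case True
      have "a ^\<^sub>m (m + E) - c ^ E \<cdot>\<^sub>m a ^\<^sub>m m = 0\<^sub>m n n"
        using True S unfolding Z_def S_def pow_mult_shift(1)[OF a, symmetric] by simp
      then have "a ^\<^sub>m (m + E) = c ^ E \<cdot>\<^sub>m a ^\<^sub>m m"
      proof (intro eq_matI)
        fix i j assume eq: "a ^\<^sub>m (m + E) - c ^ E \<cdot>\<^sub>m a ^\<^sub>m m = 0\<^sub>m n n"
          and ij: "i < dim_row (c ^ E \<cdot>\<^sub>m a ^\<^sub>m m)" "j < dim_col (c ^ E \<cdot>\<^sub>m a ^\<^sub>m m)"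
        have "i < n" "j < n" using ij am by auto
        then show "(a ^\<^sub>m (m + E)) $$ (i, j) = (c ^ E \<cdot>\<^sub>m a ^\<^sub>m m) $$ (i, j)"
          using arg_cong[OF eq, of "\<lambda>M. M $$ (i, j)"] ij by simp
      qed (use a pow_carrier_mat[OF a, of "m + E"] am in auto)
      then have "map_mat (ev G t) (a ^\<^sub>m (m + E)) = map_mat (ev G t) (c ^ E \<cdot>\<^sub>m a ^\<^sub>m m)" for G t by simp
      then have "map_mat rat_of_int (F G t ^\<^sub>m (m + E)) = map_mat of_int (d G t ^ E \<cdot>\<^sub>m F G t ^\<^sub>m m)" for G t
        unfolding ev_smult ev_power ev_c ev_pow int_smult of_int_power .
      then have "F G t ^\<^sub>m (m + E) = d G t ^ E \<cdot>\<^sub>m F G t ^\<^sub>m m" for G t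
        by (rule of_int_hom.mat_hom_inj)
      then have "F G t ^\<^sub>m (m + E) = d G t ^ (m + E - m) \<cdot>\<^sub>m F G t ^\<^sub>m m" for G t
        by simp
      moreover have "0 < E" by (simp add: E_def)
      \<comment> \<open>The identity holds over the polynomials, hence at every point; this allows
        the periodicity certificate to be used at the separating point.\<close>
      ultimately have c3: "cert3 (d G t) (F G t) (m + E)" for G t
        unfolding cert3_def by (intro exI[of _ m]) simp
      obtain G t where "d G t \<noteq> 0" "\<forall>i\<le>m + E. \<not> power_eq (d G t) (F G t) (B G t) i"
        using differ by blast
      then show ?thesis using c3 by blast
    next
      case False
      \<comment> \<open>\<open>Z 0\<close> and \<open>Z 1\<close> are nonzero, so \<open>s\<close>
        is at least 2 and there is room for two factors \<open>S\<close>.\<close>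
      define s where "s = (LEAST s. Z s = 0\<^sub>m n n)"
      have s: "Z s = 0\<^sub>m n n" unfolding s_def by (rule LeastI[of _ n]) (rule Zn)
      have "s \<noteq> 0"
      proof
        assume "s = 0"
        then have "Z 1 = 0\<^sub>m n n" using Z_Suc[of 0] s S by simp
        then show False using False by simp
      qed
      moreover have "s \<noteq> 1" using s False by auto
      ultimately obtain r where r: "s = Suc (Suc r)" by (metis One_nat_def not0_implies_Suc)
      have "Z (Suc r) \<noteq> 0\<^sub>m n n" using not_less_Least[of "Suc r" "\<lambda>s. Z s = 0\<^sub>m n n"] r s_def by simp
      then obtain j l where jl: "j < n" "l < n" "Z (Suc r) $$ (j, l) \<noteq> 0\<^sub>m n n $$ (j, l)"
        by (rule mat_neqE[OF _ Z zero_carrier_mat])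
      then obtain G t where Gt: "d G t \<noteq> 0" "ev G t (Z (Suc r) $$ (j, l)) \<noteq> 0"
        using point[of "{Z (Suc r) $$ (j, l)}"] by auto
      interpret ev: comm_ring_hom "ev G t" by (rule ev_hom)
      define S' where "S' = shift (d G t) (F G t) E"
      define Q where "Q = F G t ^\<^sub>m m * S' ^\<^sub>m r"
      \<comment> \<open>The row of the specialised \<open>Z r\<close> in which
        \<open>Z (Suc r)\<close> stays nonzero: one factor \<open>S'\<close> gives a nonzero row,
        two give zero because \<open>Z s = 0\<close>.\<close>
      define U where "U = mat 1 n (\<lambda>(_, q). Q $$ (j, q))"
      have S': "S' \<in> carrier_mat n n" unfolding S'_def using F by simp
      have ev_S': "map_mat (ev G t) S = map_mat of_int S'" unfolding S'_def by (rule ev_S)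
      have Q: "Q \<in> carrier_mat n n" unfolding Q_def by (rule mult_carrier_mat[OF pow_carrier_mat[OF F] pow_carrier_mat[OF S']])
      have evQ: "map_mat (ev G t) (Z r) = map_mat of_int Q"
        unfolding Z_def Q_def ev.mat_hom_mult[OF am pow_carrier_mat[OF S]]
          of_int_hom.mat_hom_mult[OF pow_carrier_mat[OF F] pow_carrier_mat[OF S']]
          ev_pow ev.mat_hom_pow[OF S] ev_S' of_int_hom.mat_hom_pow[OF S'] ..
      have evQS: "map_mat (ev G t) (Z (Suc r)) = map_mat of_int (Q * S')"
        unfolding Z_Suc ev.mat_hom_mult[OF Z S] of_int_hom.mat_hom_mult[OF Q S'] evQ ev_S' ..
      have evQSS: "map_mat (ev G t) (Z (Suc (Suc r))) = map_mat of_int (Q * S' * S')"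
        unfolding Z_Suc[of "Suc r"] ev.mat_hom_mult[OF Z S] evQS ev_S'
          of_int_hom.mat_hom_mult[OF mult_carrier_mat[OF Q S'] S'] ..
      have U: "U \<in> carrier_mat 1 n" by (simp add: U_def)
      have UX: "(U * X) $$ (0, q) = (Q * X) $$ (j, q)" if "X \<in> carrier_mat n n" "q < n" for X q
        using that Q jl(1) by (simp add: U_def scalar_prod_def)
      have "map_mat rat_of_int (Q * S' * S') = map_mat of_int (0\<^sub>m n n)"
        unfolding evQSS[symmetric] r[symmetric] s using ev.hom_zero by (intro eq_matI) auto
      then have QSS: "Q * S' * S' = 0\<^sub>m n n" by (rule of_int_hom.mat_hom_inj)
      have "U * (S' * S') = 0\<^sub>m 1 n"
      proof (rule eq_matI)
        fix p q assume "p < dim_row (0\<^sub>m 1 n)" "q < dim_col (0\<^sub>m 1 n)"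
        then have pq: "p = 0" "q < n" by auto
        have "(U * (S' * S')) $$ (0, q) = (Q * (S' * S')) $$ (j, q)"
          by (rule UX[OF mult_carrier_mat[OF S' S'] pq(2)])
        also have "Q * (S' * S') = 0\<^sub>m n n" using QSS assoc_mult_mat[OF Q S' S'] by simp
        finally show "(U * (S' * S')) $$ (p, q) = 0\<^sub>m 1 n $$ (p, q)" using pq jl(1) by simp
      qed (use U S' in auto)
      then have "U * S' * S' = 0\<^sub>m 1 n" using assoc_mult_mat[OF U S' S'] by simp
      moreover have "(U * S') $$ (0, l) \<noteq> 0"
      proof
        assume "(U * S') $$ (0, l) = 0"
        then have "(Q * S') $$ (j, l) = 0" using UX[OF S' jl(2)] by simp
        then have "map_mat (ev G t) (Z (Suc r)) $$ (j, l) = 0"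
          unfolding evQS using mult_carrier_mat[OF Q S'] jl(1,2) by (metis carrier_matD index_map_mat(1) of_int_0)
        then show False using Gt(2) jl(1,2) Z[of "Suc r"] by (metis carrier_matD index_map_mat(1))
      qed
      moreover have "\<bar>(U * shift (d G t) (B G t) E) $$ (0, l)\<bar> \<le> int (nat \<bar>(U * shift (d G t) (B G t) E) $$ (0, l)\<bar>)"
        by simp
      ultimately have "\<exists>L. cert2 n (d G t) (F G t) (B G t) L U E"
        unfolding cert2_def S'_def using jl(2) by blast
      then show ?thesis using finish Gt(1) U by blast
    qed
  qed
qed

section \<open>The checker on matrices of integers\<close>

definition eqpow :: "nat \<Rightarrow> int \<Rightarrow> (nat \<Rightarrow> nat \<Rightarrow> int) \<Rightarrow> (nat \<Rightarrow> nat \<Rightarrow> int) \<Rightarrow> nat \<Rightarrow> bool" where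
  "eqpow n d f g i \<longleftrightarrow> (\<forall>j<n. \<forall>l<n. d * walks n f i j l = d ^ i * g j l)"

text \<open>The bound is written with \<open>nat\<close> of absolute values so that it is built only
  from operations with closure rules; as the sum is nonnegative, its value is that in
  \<open>cert1\<close>.\<close>

definition check1 :: "nat \<Rightarrow> int \<Rightarrow> (nat \<Rightarrow> nat \<Rightarrow> int) \<Rightarrow> (nat \<Rightarrow> nat \<Rightarrow> int) \<Rightarrow> nat \<Rightarrow> bool" where
  "check1 n d f g L \<longleftrightarrow>
     L = (2 * (n * nat \<bar>d\<bar> * (nat \<bar>\<Sum>i<n. \<Sum>j<n. int (nat \<bar>g i j\<bar>)\<bar> + 1)) + 1) ^ n + n \<and>
     (\<exists>j<n. \<exists>l<n. walks n (\<lambda>p q. walks n f (L + fact L) p q - d ^ fact L * walks n f L p q) n j l \<noteq> 0)"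

definition shift_entry :: "nat \<Rightarrow> int \<Rightarrow> (nat \<Rightarrow> nat \<Rightarrow> int) \<Rightarrow> nat \<Rightarrow> nat \<Rightarrow> nat \<Rightarrow> int" where
  "shift_entry n d f E q l = walks n f E q l - (if q = l then d ^ E else 0)"

definition check2 :: "nat \<Rightarrow> int \<Rightarrow> (nat \<Rightarrow> nat \<Rightarrow> int) \<Rightarrow> (nat \<Rightarrow> nat \<Rightarrow> int) \<Rightarrow> nat \<Rightarrow> (nat \<Rightarrow> int) \<Rightarrow> nat \<Rightarrow> bool" where
  "check2 n d f g L u E \<longleftrightarrow>
     (\<forall>l<n. (\<Sum>q<n. (\<Sum>r<n. u r * shift_entry n d f E r q) * shift_entry n d f E q l) = 0) \<and>
     (\<exists>l<n. (\<Sum>r<n. u r * shift_entry n d f E r l) \<noteq> 0 \<and>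
        int (nat \<bar>\<Sum>r<n. u r * shift_entry n d g E r l\<bar>) \<le> int L)"

definition check3 :: "nat \<Rightarrow> int \<Rightarrow> (nat \<Rightarrow> nat \<Rightarrow> int) \<Rightarrow> nat \<Rightarrow> bool" where
  "check3 n d f L \<longleftrightarrow> (\<exists>k<L. \<forall>j<n. \<forall>l<n. walks n f L j l = d ^ (L - k) * walks n f k j l)"

lemma mat_eq_iff:
  "X \<in> carrier_mat m n \<Longrightarrow> Y \<in> carrier_mat m n \<Longrightarrow> X = Y \<longleftrightarrow> (\<forall>j<m. \<forall>l<n. X $$ (j, l) = Y $$ (j, l))"
  by (auto intro!: eq_matI)

abbreviation fmat :: "nat \<Rightarrow> (nat \<Rightarrow> nat \<Rightarrow> int) \<Rightarrow> int mat" where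
  "fmat n f \<equiv> mat n n (\<lambda>(p, q). f p q)"

lemma pow_fmat:
  assumes "j < n" "l < n"
  shows "(fmat n f ^\<^sub>m i) $$ (j, l) = walks n f i j l"
proof -
  have "(fmat n f ^\<^sub>m i) $$ (j, l) = walks n (\<lambda>p q. fmat n f $$ (p, q)) i j l"
    by (rule pow_mat_walks) (use assms in auto)
  also have "\<dots> = walks n f i j l" by (rule walks_cong) (use assms in auto)
  finally show ?thesis .
qed

lemma fmat_pow_carrier: "fmat n f ^\<^sub>m k \<in> carrier_mat n n"
  by (rule pow_carrier_mat) simp

lemma smult_pow_fmat:
  assumes "j < n" "l < n"
  shows "(c \<cdot>\<^sub>m fmat n f ^\<^sub>m i) $$ (j, l) = c * walks n f i j l"
proof -
  have "j < dim_row (fmat n f ^\<^sub>m i)" "l < dim_col (fmat n f ^\<^sub>m i)"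
    using fmat_pow_carrier[of n f i] assms by auto
  then show ?thesis using pow_fmat[OF assms] by (simp only: index_smult_mat)
qed

lemma eqpow_iff: "eqpow n d f g i \<longleftrightarrow> power_eq d (fmat n f) (fmat n g) i"
proof -
  have "power_eq d (fmat n f) (fmat n g) i \<longleftrightarrow>
      (\<forall>j<n. \<forall>l<n. (d \<cdot>\<^sub>m fmat n f ^\<^sub>m i) $$ (j, l) = (d ^ i \<cdot>\<^sub>m fmat n g) $$ (j, l))"
    unfolding power_eq_def by (rule mat_eq_iff) (use fmat_pow_carrier[of n f i] in auto)
  then show ?thesis unfolding eqpow_def by (simp add: pow_fmat)
qed

lemma check1_iff: "check1 n d f g L \<longleftrightarrow> cert1 n d (fmat n f) (fmat n g) L"
proof -
  let ?N = "fmat n f ^\<^sub>m (L + fact L) - d ^ fact L \<cdot>\<^sub>m fmat n f ^\<^sub>m L"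
  let ?h = "\<lambda>p q. walks n f (L + fact L) p q - d ^ fact L * walks n f L p q"
  note c = fmat_pow_carrier[of n f]
  have cN: "?N \<in> carrier_mat n n" and cN': "fmat n ?h \<in> carrier_mat n n"
    using c by (auto intro: minus_carrier_mat)
  have "?N $$ (j, l) = fmat n ?h $$ (j, l)" if "j < n" "l < n" for j l
  proof -
    have "?N $$ (j, l) = (fmat n f ^\<^sub>m (L + fact L)) $$ (j, l) - (d ^ fact L \<cdot>\<^sub>m fmat n f ^\<^sub>m L) $$ (j, l)"
      by (rule index_minus_mat(1)) (use c[of L] that in auto)
    then show ?thesis using that by (simp only: pow_fmat smult_pow_fmat index_mat(1) prod.case)
  qed
  then have N: "?N = fmat n ?h" using mat_eq_iff[OF cN cN'] by blast
  have "fmat n ?h ^\<^sub>m n \<noteq> 0\<^sub>m n n \<longleftrightarrow> (\<exists>j<n. \<exists>l<n. walks n ?h n j l \<noteq> 0)"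
    unfolding mat_eq_iff[OF fmat_pow_carrier[of n ?h n] zero_carrier_mat] by (auto simp: pow_fmat)
  moreover have "nat \<bar>\<Sum>i<n. \<Sum>j<n. int (nat \<bar>g i j\<bar>)\<bar> = nat (\<Sum>i<n. \<Sum>j<n. \<bar>fmat n g $$ (i, j)\<bar>)"
    by (simp add: sum_nonneg)
  ultimately show ?thesis unfolding check1_def cert1_def N by simp
qed

lemma shift_fmat:
  assumes "q < n" "l < n"
  shows "shift d (fmat n f) E $$ (q, l) = shift_entry n d f E q l"
proof -
  have "shift d (fmat n f) E $$ (q, l) = (fmat n f ^\<^sub>m E) $$ (q, l) - (d ^ E \<cdot>\<^sub>m 1\<^sub>m n) $$ (q, l)"
    unfolding shift_def dim_row_mat(1) by (rule index_minus_mat(1)) (use assms in auto)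
  also have "\<dots> = shift_entry n d f E q l"
    unfolding pow_fmat[OF assms] shift_entry_def using assms by simp
  finally show ?thesis .
qed

lemma row_mult:
  fixes X :: "int mat"
  assumes "X \<in> carrier_mat n n" "l < n"
  shows "(mat 1 n (\<lambda>(_, q). u q) * X) $$ (0, l) = (\<Sum>q<n. u q * X $$ (q, l))"
  using assms by (simp add: scalar_prod_def atLeast0LessThan)

lemma check2_iff: "check2 n d f g L u E \<longleftrightarrow> cert2 n d (fmat n f) (fmat n g) L (mat 1 n (\<lambda>(_, q). u q)) E"
proof -
  let ?U = "mat 1 n (\<lambda>(_, q). u q)" and ?S = "\<lambda>f. shift d (fmat n f) E"
  have S: "?S f \<in> carrier_mat n n" for f by simp
  have Sd: "dim_col (?S f) = n" for f by (rule carrier_matD(2)[OF S])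
  have U: "?U \<in> carrier_mat 1 n" by simp
  have US: "(?U * ?S f) $$ (0, l) = (\<Sum>r<n. u r * shift_entry n d f E r l)" if "l < n" for f l
    unfolding row_mult[OF S that] using that by (intro sum.cong) (auto simp: shift_fmat)
  have eq: "?U * ?S f = mat 1 n (\<lambda>(_, q). \<Sum>r<n. u r * shift_entry n d f E r q)" for f
  proof (rule eq_matI)
    fix i j assume "i < dim_row (mat 1 n (\<lambda>(_, q). \<Sum>r<n. u r * shift_entry n d f E r q))"
      "j < dim_col (mat 1 n (\<lambda>(_, q). \<Sum>r<n. u r * shift_entry n d f E r q))"
    then have "i = 0" "j < n" by auto
    then show "(?U * ?S f) $$ (i, j) = mat 1 n (\<lambda>(_, q). \<Sum>r<n. u r * shift_entry n d f E r q) $$ (i, j)"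
      using US[of j f] by simp
  qed (simp_all add: Sd)
  have "(?U * ?S f * ?S f) $$ (0, l) =
      (\<Sum>q<n. (\<Sum>r<n. u r * shift_entry n d f E r q) * shift_entry n d f E q l)" if "l < n" for l
    unfolding eq row_mult[OF S that] using that by (intro sum.cong) (auto simp: shift_fmat)
  then have "?U * ?S f * ?S f = 0\<^sub>m 1 n \<longleftrightarrow>
      (\<forall>l<n. (\<Sum>q<n. (\<Sum>r<n. u r * shift_entry n d f E r q) * shift_entry n d f E q l) = 0)"
    unfolding mat_eq_iff[OF mult_carrier_mat[OF mult_carrier_mat[OF U S] S] zero_carrier_mat] by auto
  then show ?thesis unfolding check2_def cert2_def using US by auto
qed

lemma check3_iff: "check3 n d f L \<longleftrightarrow> cert3 d (fmat n f) L"
proof -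
  have "fmat n f ^\<^sub>m L = d ^ (L - k) \<cdot>\<^sub>m fmat n f ^\<^sub>m k \<longleftrightarrow>
      (\<forall>j<n. \<forall>l<n. walks n f L j l = d ^ (L - k) * walks n f k j l)" for k
    unfolding mat_eq_iff[OF fmat_pow_carrier smult_carrier_mat[OF fmat_pow_carrier]]
    by (simp add: pow_fmat smult_pow_fmat)
  then show ?thesis unfolding check3_def cert3_def by simp
qed

section \<open>Evaluating the codes\<close>

text \<open>A nonempty list has the successor of the pair of head and tail as its code, the empty
  list has code 0. Since \<open>p2 0 = 0\<close>, the tail of the empty list is empty again.\<close>

definition code_tl :: "nat \<Rightarrow> nat" where
  "code_tl c = p2 (c - 1)"

definition code_drop :: "nat \<Rightarrow> nat \<Rightarrow> nat" where
  "code_drop c j = (code_tl ^^ j) c"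

definition code_nth :: "nat \<Rightarrow> nat \<Rightarrow> nat" where
  "code_nth c j = p1 (code_drop c j - 1)"

text \<open>Counts the nonempty tails. A list is never longer than its code, so the range
  \<open>j < c\<close> reaches all of them.\<close>

definition code_len :: "nat \<Rightarrow> nat" where
  "code_len c = (\<Sum>j<c. if code_drop c j = 0 then 0 else 1)"

lemma code_drop_encode: "code_drop (list_encode xs) j = list_encode (drop j xs)"
proof (induction j)
  case (Suc j)
  have "p2 0 = 0" using prod_encode_inverse[of "(0, 0)"] by (simp add: prod_encode_def)
  then have "code_tl (list_encode ys) = list_encode (tl ys)" for ys
    by (cases ys) (simp_all add: code_tl_def)
  then have "code_tl (list_encode (drop j xs)) = list_encode (drop (Suc j) xs)"
    by (simp add: tl_drop drop_Suc)
  then show ?case using Suc by (simp add: code_drop_def)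
qed (simp add: code_drop_def)

lemma code_nth_encode: "j < length xs \<Longrightarrow> code_nth (list_encode xs) j = xs ! j"
  by (simp add: code_nth_def code_drop_encode Cons_nth_drop_Suc[symmetric])

lemma length_le_encode: "length xs \<le> list_encode xs"
proof (induction xs)
  case (Cons x xs)
  then show ?case using le_prod_encode_2[of "list_encode xs" x] by simp
qed simp

lemma code_len_encode: "code_len (list_encode xs) = length xs"
proof -
  have "list_encode ys = 0 \<longleftrightarrow> ys = []" for ys by (cases ys) auto
  then have "code_len (list_encode xs) = (\<Sum>j<list_encode xs. if length xs \<le> j then 0 else 1)"
    unfolding code_len_def code_drop_encode by (intro sum.cong) auto
  also have "(\<Sum>j<c. if m \<le> j then 0 else 1) = min c m" for c m :: nat by (induction c) auto
  finally show ?thesis using length_le_encode[of xs] by simp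
qed

lemma sum_code: "(\<Sum>k<code_len (list_encode xs). f (code_nth (list_encode xs) k)) = sum_list (map f xs)"
  unfolding code_len_encode by (simp add: sum_list_sum_nth code_nth_encode atLeast0LessThan)

lemma all_code: "(\<forall>k<code_len (list_encode xs). P (code_nth (list_encode xs) k)) \<longleftrightarrow> (\<forall>x \<in> set xs. P x)"
  unfolding code_len_encode all_set_conv_all_nth by (simp add: code_nth_encode)

definition exp_code :: "nat \<Rightarrow> nat \<Rightarrow> nat" where
  "exp_code G c = (\<Sum>k<code_len c. p2 (code_nth c k) * G ^ p1 (code_nth c k))"

definition eval_code :: "nat \<Rightarrow> nat \<Rightarrow> nat \<Rightarrow> int" where
  "eval_code G t c = (\<Sum>k<code_len c. int_decode (p1 (code_nth c k)) * int t ^ exp_code G (p2 (code_nth c k)))"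

lemma mono_val_Cons: "mono_val ((i, e) # m) = Poly_Mapping.single i e + mono_val m"
  by (simp add: mono_val_def)

lemma poly_val_Cons: "poly_val ((c, m) # p) = Poly_Mapping.single (mono_val m) (of_int c) + poly_val p"
  by (simp add: poly_val_def)

lemma exp_code: "exp_code G (mono_code m) = kron_exp G (mono_val m)"
proof -
  have "exp_code G (mono_code m) = (\<Sum>(i, e)\<leftarrow>m. e * G ^ i)"
    unfolding exp_code_def mono_code_def
    using sum_code[of "\<lambda>x. p2 x * G ^ p1 x" "map prod_encode m"] by (simp add: o_def case_prod_unfold)
  also have "\<dots> = kron_exp G (mono_val m)"
  proof (induction m)
    case (Cons a m)
    then show ?case by (cases a) (simp add: mono_val_Cons kron_exp_add)
  qed (simp add: mono_val_def)
  finally show ?thesis .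
qed

text \<open>Evaluation is additive, so repeated monomials and zero coefficients in a code require no
  normalisation.\<close>

lemma eval_code: "of_int (eval_code G t (poly_code p)) = ev G t (poly_val p)"
proof -
  interpret comm_ring_hom "ev G t" by (rule ev_hom)
  have "eval_code G t (poly_code p) = (\<Sum>(c, m)\<leftarrow>p. c * int t ^ kron_exp G (mono_val m))"
    unfolding eval_code_def poly_code_def
    using sum_code[of "\<lambda>x. int_decode (p1 x) * int t ^ exp_code G (p2 x)"
        "map (\<lambda>(c, m). prod_encode (int_encode c, mono_code m)) p"]
    by (simp add: o_def case_prod_unfold exp_code)
  also have "rat_of_int \<dots> = ev G t (poly_val p)"
  proof (induction p)
    case Nil
    show ?case by (simp add: poly_val_def)
  next
    case (Cons a p)
    then show ?case by (cases a) (simp add: poly_val_Cons ev_def kron_add poly_monom)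
  qed
  finally show ?thesis .
qed

lemma add_le_prod_encode: "m + n \<le> prod_encode (m, n)"
proof -
  have "k \<le> triangle k" for k by (induction k) auto
  from this[of "m + n"] show ?thesis by (simp add: prod_encode_def)
qed

text \<open>The exponents of a repeated indeterminate add up, and the code still bounds the sum
  because a pair code is at least the sum of its components. The code thus serves as its own degree
  bound.\<close>

lemma mono_val_bound:
  "Poly_Mapping.keys (mono_val m) \<subseteq> {..mono_code m} \<and> Poly_Mapping.lookup (mono_val m) i \<le> mono_code m"
proof (induction m)
  case (Cons a m)
  obtain j e where a: "a = (j, e)" by force
  have "prod_encode (j, e) + mono_code m \<le> mono_code (a # m)"
    using add_le_prod_encode[of "prod_encode (j, e)" "mono_code m"] by (simp add: mono_code_def a)
  then have code: "j + (e + mono_code m) \<le> mono_code (a # m)" using add_le_prod_encode[of j e] by linarith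
  have "Poly_Mapping.keys (mono_val (a # m)) \<subseteq> {j} \<union> Poly_Mapping.keys (mono_val m)"
  proof -
    have "Poly_Mapping.keys (Poly_Mapping.single j e) \<subseteq> {j}" by simp
    then show ?thesis
      unfolding a mono_val_Cons using Poly_Mapping.keys_add[of "Poly_Mapping.single j e" "mono_val m"] by blast
  qed
  moreover have "Poly_Mapping.lookup (mono_val (a # m)) i \<le> e + mono_code m"
    using Cons unfolding a mono_val_Cons by (auto simp: lookup_add lookup_single when_def)
  moreover have "{j} \<union> {..mono_code m} \<subseteq> {..mono_code (a # m)}" using code by auto
  moreover have "e + mono_code m \<le> mono_code (a # m)" using code by linarith
  ultimately show ?case using Cons by (intro conjI) (blast, linarith)
qed (simp add: mono_val_def)

lemma deg_le_poly_val: "poly_code p \<le> N \<Longrightarrow> deg_le (Suc N) N (poly_val p)"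
proof (induction p)
  case (Cons a p)
  obtain c m where a: "a = (c, m)" by force
  have "prod_encode (prod_encode (int_encode c, mono_code m), poly_code p) < poly_code (a # p)"
    by (simp add: poly_code_def a)
  then have "mono_code m \<le> N" "poly_code p \<le> N"
    using add_le_prod_encode[of "prod_encode (int_encode c, mono_code m)" "poly_code p"]
      add_le_prod_encode[of "int_encode c" "mono_code m"] Cons.prems by linarith+
  then have "deg_le (Suc N) N (Poly_Mapping.single (mono_val m) (rat_of_int c))"
  proof -
    assume N: "mono_code m \<le> N"
    have "Poly_Mapping.keys (mono_val m) \<subseteq> {..<Suc N}" "\<And>i. Poly_Mapping.lookup (mono_val m) i \<le> N"
      using mono_val_bound[of m] N by (force, meson le_trans)
    then show ?thesis unfolding deg_le_def by simp
  qed
  then show ?case using Cons.IH[OF \<open>poly_code p \<le> N\<close>] unfolding a poly_val_Cons by (rule deg_le_add)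
qed (simp add: poly_val_def)

text \<open>All indices and exponents in the polynomial are at most \<open>c\<close>, so
  \<open>Suc c\<close> serves both as the base and as the number of digits of the Kronecker
  substitution.\<close>

definition nonzero_code :: "nat \<Rightarrow> bool" where
  "nonzero_code c \<longleftrightarrow> (\<exists>t<Suc c ^ Suc c. eval_code (Suc c) t c \<noteq> 0)"

lemma nonzero_code: "nonzero_code (poly_code p) \<longleftrightarrow> poly_val p \<noteq> 0"
  unfolding nonzero_code_def eq_0_iff_ev[OF deg_le_poly_val[OF order.refl] lessI] eval_code[symmetric]
  by simp

section \<open>Well-formedness of codes\<close>

definition vars_ok :: "nat set \<Rightarrow> nat \<Rightarrow> bool" where
  "vars_ok I c \<longleftrightarrow> (\<forall>k<code_len c. \<forall>l<code_len (p2 (code_nth c k)). p1 (code_nth (p2 (code_nth c k)) l) \<in> I)"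

definition mat_ok :: "nat set \<Rightarrow> nat \<Rightarrow> nat \<Rightarrow> bool" where
  "mat_ok I n c \<longleftrightarrow> code_len c = n \<and> (\<forall>i<code_len c. code_len (code_nth c i) = n \<and>
     (\<forall>j<code_len (code_nth c i). vars_ok I (p1 (code_nth (code_nth c i) j)) \<and>
        vars_ok I (p2 (code_nth (code_nth c i) j)) \<and> nonzero_code (p2 (code_nth (code_nth c i) j))))"

lemma vars_ok: "vars_ok I (poly_code p) \<longleftrightarrow> poly_expr_ok I p"
proof -
  have "vars_ok I (poly_code p) \<longleftrightarrow>
      (\<forall>x \<in> set (map (\<lambda>(c, m). prod_encode (int_encode c, mono_code m)) p).
        \<forall>l<code_len (p2 x). p1 (code_nth (p2 x) l) \<in> I)"
    unfolding vars_ok_def poly_code_def by (rule all_code)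
  also have "\<dots> \<longleftrightarrow> (\<forall>(c, m) \<in> set p. \<forall>l<code_len (mono_code m). p1 (code_nth (mono_code m) l) \<in> I)"
    by auto
  also have "\<dots> \<longleftrightarrow> poly_expr_ok I p"
    unfolding poly_expr_ok_def mono_code_def
    by (simp only: all_code[of _ "\<lambda>x. p1 x \<in> I"]) fastforce
  finally show ?thesis .
qed

lemma mat_ok: "mat_ok I n (mat_code rss) \<longleftrightarrow> mat_expr_ok n I rss"
proof -
  let ?P = "\<lambda>r. vars_ok I (p1 r) \<and> vars_ok I (p2 r) \<and> nonzero_code (p2 r)"
  have r: "?P (ratfun_code r) \<longleftrightarrow> ratfun_expr_ok I r" for r
    by (simp add: ratfun_code_def vars_ok nonzero_code ratfun_expr_ok_def)
  have "mat_ok I n (mat_code rss) \<longleftrightarrow> length rss = n \<and>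
      (\<forall>x \<in> set (map (\<lambda>rs. list_encode (map ratfun_code rs)) rss). code_len x = n \<and>
         (\<forall>j<code_len x. ?P (code_nth x j)))"
    unfolding mat_ok_def mat_code_def code_len_encode[of "map _ rss"]
    using all_code[of "map (\<lambda>rs. list_encode (map ratfun_code rs)) rss"
        "\<lambda>x. code_len x = n \<and> (\<forall>j<code_len x. ?P (code_nth x j))"]
    by (simp add: code_len_encode)
  also have "\<dots> \<longleftrightarrow> length rss = n \<and> (\<forall>rs \<in> set rss. length rs = n \<and> (\<forall>r \<in> set rs. ratfun_expr_ok I r))"
    using all_code[of "map ratfun_code _" ?P] by (simp add: code_len_encode r)
  finally show ?thesis by (simp add: mat_expr_ok_def)
qed

lemma surj_list_code: "surj f \<Longrightarrow> surj (\<lambda>xs. list_encode (map f xs))"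
proof (rule surjI)
  assume "surj f"
  then show "list_encode (map f (map (inv_into UNIV f) (list_decode x))) = x" for x
    by (simp add: o_def surj_f_inv_f)
qed

text \<open>Every number codes some expression. Hence only the dimensions, the indices and the
  denominators of an input have to be checked, and \<open>mat_ok\<close> does exactly this.\<close>

lemma surj_mat_code: "surj mat_code"
proof -
  have mono: "surj mono_code"
    unfolding mono_code_def by (intro surj_list_code surj_prod_encode)
  have "surj (\<lambda>(c, m). prod_encode (int_encode c, mono_code m))"
  proof (rule surjI)
    show "(\<lambda>(c, m). prod_encode (int_encode c, mono_code m)) (int_decode (p1 x), inv_into UNIV mono_code (p2 x)) = x" for x
      by (simp add: surj_f_inv_f[OF mono])
  qed
  then have poly: "surj poly_code" unfolding poly_code_def by (rule surj_list_code)
  have "surj ratfun_code"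
  proof (rule surjI)
    show "ratfun_code (inv_into UNIV poly_code (p1 x), inv_into UNIV poly_code (p2 x)) = x" for x
      by (simp add: ratfun_code_def surj_f_inv_f[OF poly])
  qed
  then show ?thesis unfolding mat_code_def by (intro surj_list_code)
qed

section \<open>Common denominators\<close>

text \<open>The positions are numbered row by row as \<open>p = j * n + l\<close>, which makes the
  common denominator a single bounded product.\<close>

definition entry_code :: "nat \<Rightarrow> nat \<Rightarrow> nat \<Rightarrow> nat" where
  "entry_code c n p = code_nth (code_nth c (p div n)) (p mod n)"

definition eval_den :: "nat \<Rightarrow> nat \<Rightarrow> nat \<Rightarrow> nat \<Rightarrow> int" where
  "eval_den G t c n = (\<Prod>p<n * n. eval_code G t (p2 (entry_code c n p)))"

text \<open>The numerator of the entry \<open>q\<close> over the common denominator: in the product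
  of all denominators, the one at position \<open>q\<close> is replaced by the numerator.\<close>

definition eval_num :: "nat \<Rightarrow> nat \<Rightarrow> nat \<Rightarrow> nat \<Rightarrow> nat \<Rightarrow> int" where
  "eval_num G t c n q = (\<Prod>p<n * n. if p = q then eval_code G t (p1 (entry_code c n p))
     else eval_code G t (p2 (entry_code c n p)))"

definition den_poly :: "mat_expr \<Rightarrow> nat \<Rightarrow> qpoly" where
  "den_poly rss n = (\<Prod>p<n * n. poly_val (snd (rss ! (p div n) ! (p mod n))))"

definition num_poly :: "mat_expr \<Rightarrow> nat \<Rightarrow> nat \<Rightarrow> qpoly" where
  "num_poly rss n q = (\<Prod>p<n * n. if p = q then poly_val (fst (rss ! (p div n) ! (p mod n)))
     else poly_val (snd (rss ! (p div n) ! (p mod n))))"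

lemma div_mod_less:
  assumes "p < n * n"
  shows "p div n < n" "p mod n < (n :: nat)"
proof -
  have "0 < n" using assms by (cases n) auto
  then show "p div n < n" "p mod n < n" using assms by (auto simp: less_mult_imp_div_less)
qed

lemma ev_prod: "ev G t (\<Prod>x\<in>S. f x) = (\<Prod>x\<in>S. ev G t (f x))"
proof -
  interpret comm_ring_hom "ev G t" by (rule ev_hom)
  show ?thesis by (rule hom_prod)
qed

context
  fixes I n rss
  assumes ok: "mat_expr_ok n I rss"
begin

lemma entry_ok:
  assumes "j < n" "l < n"
  shows "length rss = n" "length (rss ! j) = n" "ratfun_expr_ok I (rss ! j ! l)"
proof -
  show len: "length rss = n" using ok by (simp add: mat_expr_ok_def)
  then have "rss ! j \<in> set rss" using assms by simp
  then have j: "length (rss ! j) = n" "\<forall>r \<in> set (rss ! j). ratfun_expr_ok I r"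
    using ok by (auto simp: mat_expr_ok_def)
  then show "length (rss ! j) = n" "ratfun_expr_ok I (rss ! j ! l)" using assms by auto
qed

lemma entry_code:
  assumes "p < n * n"
  shows "entry_code (mat_code rss) n p = ratfun_code (rss ! (p div n) ! (p mod n))"
  using entry_ok[OF div_mod_less[OF assms]] div_mod_less[OF assms]
  by (simp add: entry_code_def mat_code_def code_nth_encode)

lemma entry_codes:
  assumes "p < n * n"
  shows "p1 (entry_code (mat_code rss) n p) = poly_code (fst (rss ! (p div n) ! (p mod n)))"
    "p2 (entry_code (mat_code rss) n p) = poly_code (snd (rss ! (p div n) ! (p mod n)))"
  by (simp_all add: entry_code[OF assms] ratfun_code_def)

lemma eval_den: "of_int (eval_den G t (mat_code rss) n) = ev G t (den_poly rss n)"
  unfolding eval_den_def den_poly_def ev_prod of_int_prod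
  by (intro prod.cong) (auto simp: entry_codes eval_code)

lemma eval_num: "of_int (eval_num G t (mat_code rss) n q) = ev G t (num_poly rss n q)"
  unfolding eval_num_def num_poly_def ev_prod of_int_prod
  by (intro prod.cong) (auto simp: entry_codes eval_code)

lemma den_poly_nonzero: "den_poly rss n \<noteq> 0"
  unfolding den_poly_def using entry_ok(3)[OF div_mod_less] by (auto simp: ratfun_expr_ok_def)

text \<open>The spare factor \<open>c\<close> takes the denominator of the other matrix, so that
  both matrices get the same denominator.\<close>

lemma ratfun_val_num_den:
  assumes "j < n" "l < n" "c \<noteq> 0"
  shows "ratfun_val (rss ! j ! l) = Fract (num_poly rss n (j * n + l) * c) (den_poly rss n * c)"
proof -
  let ?q = "j * n + l" and ?r = "\<lambda>p. rss ! (p div n) ! (p mod n)"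
  have "?q < Suc j * n" using assms by simp
  also have "\<dots> \<le> n * n" using assms by (intro mult_right_mono) auto
  finally have q: "?q \<in> {..<n * n}" by simp
  have qr: "?r ?q = rss ! j ! l" using assms by simp
  let ?R = "\<Prod>p \<in> {..<n * n} - {?q}. poly_val (snd (?r p))"
  have "den_poly rss n = poly_val (snd (rss ! j ! l)) * ?R"
    unfolding den_poly_def using prod.remove[OF _ q, of "\<lambda>p. poly_val (snd (?r p))"] qr by simp
  moreover have "num_poly rss n ?q = poly_val (fst (rss ! j ! l)) * ?R"
  proof -
    let ?f = "\<lambda>p. if p = ?q then poly_val (fst (?r p)) else poly_val (snd (?r p))"
    have "num_poly rss n ?q = ?f ?q * (\<Prod>p \<in> {..<n * n} - {?q}. ?f p)"
      unfolding num_poly_def by (rule prod.remove[OF _ q]) simp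
    also have "(\<Prod>p \<in> {..<n * n} - {?q}. ?f p) = ?R" by (intro prod.cong) auto
    finally show ?thesis using qr by simp
  qed
  moreover have "poly_val (snd (rss ! j ! l)) \<noteq> 0"
    using entry_ok(3)[OF assms(1,2)] by (simp add: ratfun_expr_ok_def)
  moreover have "den_poly rss n * c \<noteq> 0" using den_poly_nonzero assms(3) by simp
  ultimately show ?thesis unfolding ratfun_val_def by (subst eq_fract(1)) (auto simp: mult_ac)
qed

lemma deg_le_den_num:
  assumes "mat_code rss \<le> N"
  shows "deg_le (Suc N) (n * n * N) (den_poly rss n)" "deg_le (Suc N) (n * n * N) (num_poly rss n q)"
proof -
  have el: "x \<le> list_encode xs" if "x \<in> set xs" for x xs
    using that
  proof (induction xs)
    case (Cons y xs)
    then show ?case using add_le_prod_encode[of y "list_encode xs"] by (auto intro: order.trans)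
  qed simp
  have *: "deg_le (Suc N) N (poly_val (fst (rss ! (p div n) ! (p mod n)))) \<and>
      deg_le (Suc N) N (poly_val (snd (rss ! (p div n) ! (p mod n))))" if "p < n * n" for p
  proof -
    note p = div_mod_less[OF that]
    let ?r = "rss ! (p div n) ! (p mod n)" and ?rs = "rss ! (p div n)"
    have "ratfun_code ?r \<le> list_encode (map ratfun_code ?rs)" using entry_ok(2)[OF p] p by (intro el) auto
    also have "\<dots> \<le> mat_code rss" unfolding mat_code_def using entry_ok(1)[OF p] p by (intro el) auto
    also have "\<dots> \<le> N" by (rule assms)
    finally have "poly_code (fst ?r) \<le> N" "poly_code (snd ?r) \<le> N"
      using add_le_prod_encode[of "poly_code (fst ?r)" "poly_code (snd ?r)"]
      unfolding ratfun_code_def by linarith+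
    then show ?thesis by (intro conjI deg_le_poly_val)
  qed
  show "deg_le (Suc N) (n * n * N) (den_poly rss n)"
    using deg_le_prod[of "{..<n * n}" "Suc N" N "\<lambda>p. poly_val (snd (rss ! (p div n) ! (p mod n)))"] *
    unfolding den_poly_def by simp
  show "deg_le (Suc N) (n * n * N) (num_poly rss n q)"
    using deg_le_prod[of "{..<n * n}" "Suc N" N "\<lambda>p. if p = q then poly_val (fst (rss ! (p div n) ! (p mod n)))
     else poly_val (snd (rss ! (p div n) ! (p mod n)))"] *
    unfolding num_poly_def by simp
qed

end

text \<open>The instance with code \<open>x\<close> is given by \<open>A = a / \<Delta>\<close> and \<open>B = b / \<Delta>\<close> with a common
  denominator \<open>\<Delta>\<close>; these are the values of \<open>\<Delta>\<close>, \<open>a\<close> and \<open>b\<close> at the point given by \<open>G\<close> and \<open>t\<close>.\<close>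

abbreviation "dim_of x \<equiv> p1 x"
abbreviation "code_A x \<equiv> p1 (p2 x)"
abbreviation "code_B x \<equiv> p2 (p2 x)"

definition val_den :: "nat \<Rightarrow> nat \<Rightarrow> nat \<Rightarrow> int" where
  "val_den x G t = eval_den G t (code_A x) (dim_of x) * eval_den G t (code_B x) (dim_of x)"

definition val_A :: "nat \<Rightarrow> nat \<Rightarrow> nat \<Rightarrow> nat \<Rightarrow> nat \<Rightarrow> int" where
  "val_A x G t j l = eval_num G t (code_A x) (dim_of x) (j * dim_of x + l) * eval_den G t (code_B x) (dim_of x)"

definition val_B :: "nat \<Rightarrow> nat \<Rightarrow> nat \<Rightarrow> nat \<Rightarrow> nat \<Rightarrow> int" where
  "val_B x G t j l = eval_num G t (code_B x) (dim_of x) (j * dim_of x + l) * eval_den G t (code_A x) (dim_of x)"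

definition valid :: "nat set \<Rightarrow> nat \<Rightarrow> bool" where
  "valid I x \<longleftrightarrow> 1 \<le> dim_of x \<and> mat_ok I (dim_of x) (code_A x) \<and> mat_ok I (dim_of x) (code_B x)"

text \<open>Each of the polynomials \<open>c\<close>, \<open>a\<close> and \<open>b\<close> is a
  product over both matrices, with \<open>2 * (n * n)\<close> factors of degree at most
  \<open>x\<close> in each indeterminate. Either side of \<open>c a ^ i = c ^ i b\<close> involves
  \<open>Suc i\<close> of them, up to sums. The base is one more than the resulting bound, and all
  indices are below \<open>Suc x\<close>; so the points tested decide the polynomial
  identity.\<close>

definition accept :: "nat \<Rightarrow> nat \<Rightarrow> bool" where
  "accept x i \<longleftrightarrow> (\<forall>t<Suc (Suc i * (2 * (dim_of x * dim_of x * x))) ^ Suc x.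
     eqpow (dim_of x) (val_den x (Suc (Suc i * (2 * (dim_of x * dim_of x * x)))) t)
       (val_A x (Suc (Suc i * (2 * (dim_of x * dim_of x * x)))) t)
       (val_B x (Suc (Suc i * (2 * (dim_of x * dim_of x * x)))) t) i)"

text \<open>\<open>(G, t)\<close> is the point of the first two certificates,
  \<open>(G', t')\<close> the one at which the exponents up to \<open>L\<close> fail. The number
  \<open>u\<close> is read as the code of a list of integers, the row vector of the second
  certificate.\<close>

definition reject :: "nat \<Rightarrow> nat \<Rightarrow> nat \<Rightarrow> nat \<Rightarrow> nat \<Rightarrow> nat \<Rightarrow> nat \<Rightarrow> nat \<Rightarrow> bool" where
  "reject x G t G' t' L u E \<longleftrightarrow> val_den x G t \<noteq> 0 \<and> val_den x G' t' \<noteq> 0 \<and>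
     (check1 (dim_of x) (val_den x G t) (val_A x G t) (val_B x G t) L \<or>
      check2 (dim_of x) (val_den x G t) (val_A x G t) (val_B x G t) L (\<lambda>q. int_decode (code_nth u q)) E \<or>
      check3 (dim_of x) (val_den x G' t') (val_A x G' t') L) \<and>
     (\<forall>i<Suc L. \<not> eqpow (dim_of x) (val_den x G' t') (val_A x G' t') (val_B x G' t') i)"

locale encoded_instance =
  fixes I :: "nat set" and x n :: nat and as bs :: mat_expr
  assumes n: "0 < n" and as: "mat_expr_ok n I as" and bs: "mat_expr_ok n I bs"
    and x: "x = prod_encode (n, prod_encode (mat_code as, mat_code bs))"
begin

definition c :: qpoly where "c = den_poly as n * den_poly bs n"
definition a :: "qpoly mat" where "a = mat n n (\<lambda>(j, l). num_poly as n (j * n + l) * den_poly bs n)"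
definition b :: "qpoly mat" where "b = mat n n (\<lambda>(j, l). num_poly bs n (j * n + l) * den_poly as n)"

lemma carriers [simp]: "a \<in> carrier_mat n n" "b \<in> carrier_mat n n"
  by (simp_all add: a_def b_def)

lemma codes: "dim_of x = n" "code_A x = mat_code as" "code_B x = mat_code bs"
  by (simp_all add: x)

lemma c_nonzero: "c \<noteq> 0"
  unfolding c_def using den_poly_nonzero[OF as] den_poly_nonzero[OF bs] by simp

lemma power_iff: "mat_val n as ^\<^sub>m i = mat_val n bs \<longleftrightarrow> c \<cdot>\<^sub>m a ^\<^sub>m i = c ^ i \<cdot>\<^sub>m b"
proof (rule fract_mat_pow_eq_iff[OF carriers c_nonzero])
  have entry: "mat_val n rss $$ (j, l) = ratfun_val (rss ! j ! l)" "dim_row (mat_val n rss) = n"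
    "dim_col (mat_val n rss) = n" if "mat_expr_ok n I rss" "j < n" "l < n" for rss j l
    using entry_ok[OF that] that(2,3) by (simp_all add: mat_val_def mat_of_rows_list_def)
  note dims = entry(2,3)[OF _ n n]
  show "mat_val n as = map_mat (\<lambda>p. Fract p c) a"
    by (rule eq_matI)
       (use ratfun_val_num_den[OF as _ _ den_poly_nonzero[OF bs]] in
         \<open>auto simp: a_def c_def entry[OF as] dims[OF as]\<close>)
  show "mat_val n bs = map_mat (\<lambda>p. Fract p c) b"
    by (rule eq_matI)
       (use ratfun_val_num_den[OF bs _ _ den_poly_nonzero[OF as]] in
         \<open>auto simp: b_def c_def entry[OF bs] dims[OF bs] mult.commute\<close>)
qed

lemma ev_mult: "ev G t (p * q) = ev G t p * ev G t q"
  by (simp add: ev_def kron_mult)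

lemma ev_c: "ev G t c = of_int (val_den x G t)"
  by (simp add: c_def val_den_def codes ev_mult eval_den[OF as] eval_den[OF bs])

lemma ev_a: "map_mat (ev G t) a = map_mat of_int (fmat n (val_A x G t))"
  by (rule eq_matI) (auto simp: a_def val_A_def codes ev_mult eval_num[OF as] eval_den[OF bs])

lemma ev_b: "map_mat (ev G t) b = map_mat of_int (fmat n (val_B x G t))"
  by (rule eq_matI) (auto simp: b_def val_B_def codes ev_mult eval_num[OF bs] eval_den[OF as])

lemma ev_pow: "map_mat (ev G t) (c \<cdot>\<^sub>m a ^\<^sub>m i) =
      map_mat of_int (val_den x G t \<cdot>\<^sub>m fmat n (val_A x G t) ^\<^sub>m i)"
    and ev_pow': "map_mat (ev G t) (c ^ i \<cdot>\<^sub>m b) = map_mat of_int (val_den x G t ^ i \<cdot>\<^sub>m fmat n (val_B x G t))"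
proof -
  interpret ev: comm_ring_hom "ev G t" by (rule ev_hom)
  have F: "fmat n (val_A x G t) \<in> carrier_mat n n" by simp
  note s = map_mat_smult[of "ev G t", OF ev.hom_mult] map_mat_smult[of rat_of_int, OF of_int_mult]
  show "map_mat (ev G t) (c \<cdot>\<^sub>m a ^\<^sub>m i) = map_mat of_int (val_den x G t \<cdot>\<^sub>m fmat n (val_A x G t) ^\<^sub>m i)"
    unfolding s ev_c ev.mat_hom_pow[OF carriers(1)] of_int_hom.mat_hom_pow[OF F] ev_a ..
  show "map_mat (ev G t) (c ^ i \<cdot>\<^sub>m b) = map_mat of_int (val_den x G t ^ i \<cdot>\<^sub>m fmat n (val_B x G t))"
    unfolding s ev.hom_power ev_c ev_b of_int_power ..
qed

lemma eqpow_iff_ev: "eqpow n (val_den x G t) (val_A x G t) (val_B x G t) i \<longleftrightarrow>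
    map_mat (ev G t) (c \<cdot>\<^sub>m a ^\<^sub>m i) = map_mat (ev G t) (c ^ i \<cdot>\<^sub>m b)"
  unfolding eqpow_iff power_eq_def ev_pow ev_pow'
  by (rule iffI, erule arg_cong, erule of_int_hom.mat_hom_inj)

lemma deg_le_entries:
  assumes "j < n" "l < n"
  shows "deg_le (Suc x) (Suc i * (2 * (n * n * x))) ((c \<cdot>\<^sub>m a ^\<^sub>m i) $$ (j, l) - (c ^ i \<cdot>\<^sub>m b) $$ (j, l))"
proof -
  let ?d = "2 * (n * n * x)"
  have "mat_code as + mat_code bs \<le> x"
    using add_le_prod_encode[of "mat_code as" "mat_code bs"]
      add_le_prod_encode[of n "prod_encode (mat_code as, mat_code bs)"] unfolding x by linarith
  then have le: "mat_code as \<le> x" "mat_code bs \<le> x" by auto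
  note da = deg_le_den_num[OF as le(1)] and db = deg_le_den_num[OF bs le(2)]
  have two: "n * n * x + n * n * x = ?d" by simp
  have c: "deg_le (Suc x) ?d c"
    unfolding c_def using deg_le_mult[OF da(1) db(1)] unfolding two .
  have entry_a: "deg_le (Suc x) ?d (a $$ (j, l))" if "j < n" "l < n" for j l
    using deg_le_mult[OF da(2) db(1)] that unfolding two by (simp add: a_def)
  have entry_b: "deg_le (Suc x) ?d (b $$ (j, l))" if "j < n" "l < n" for j l
    using deg_le_mult[OF db(2) da(1)] that unfolding two by (simp add: b_def)
  have mult_entry: "(X * Y) $$ (j, l) = (\<Sum>q = 0..<n. X $$ (j, q) * Y $$ (q, l))"
    if "X \<in> carrier_mat n n" "Y \<in> carrier_mat n n" "j < n" "l < n" for X Y :: "qpoly mat" and j l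
    using that by (simp add: scalar_prod_def)
  have "deg_le (Suc x) (i * ?d) ((a ^\<^sub>m i) $$ (j, l))" if "j < n" "l < n" for j l
    using that
  proof (induction i arbitrary: l)
    case 0
    then show ?case by (simp add: a_def)
  next
    case (Suc i)
    have "(a ^\<^sub>m Suc i) $$ (j, l) = (\<Sum>q = 0..<n. (a ^\<^sub>m i) $$ (j, q) * a $$ (q, l))"
      using Suc.prems mult_entry[OF pow_carrier_mat[OF carriers(1)] carriers(1)] by simp
    moreover have "deg_le (Suc x) (Suc i * ?d) ((a ^\<^sub>m i) $$ (j, q) * a $$ (q, l))" if "q < n" for q
      using deg_le_mult[OF Suc.IH[OF Suc.prems(1) that] entry_a[OF that Suc.prems(2)]] by (simp add: add.commute)
    ultimately show ?case by (auto intro!: deg_le_sum)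
  qed
  then have "deg_le (Suc x) (?d + i * ?d) (c * (a ^\<^sub>m i) $$ (j, l))"
    using assms by (intro deg_le_mult[OF c])
  moreover have "deg_le (Suc x) (i * ?d + ?d) (c ^ i * b $$ (j, l))"
    using assms by (intro deg_le_mult[OF deg_le_power[OF c] entry_b])
  moreover have "(c \<cdot>\<^sub>m a ^\<^sub>m i) $$ (j, l) = c * (a ^\<^sub>m i) $$ (j, l)"
    using carrier_matD[OF carriers(1)] assms by (intro index_smult_mat) auto
  moreover have "(c ^ i \<cdot>\<^sub>m b) $$ (j, l) = c ^ i * b $$ (j, l)"
    using carrier_matD[OF carriers(2)] assms by (intro index_smult_mat) auto
  ultimately show ?thesis by (simp add: deg_le_diff add.commute)
qed

lemma accept_iff: "accept x i \<longleftrightarrow> mat_val n as ^\<^sub>m i = mat_val n bs"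
proof -
  let ?X = "c \<cdot>\<^sub>m a ^\<^sub>m i" and ?Y = "c ^ i \<cdot>\<^sub>m b" and ?G = "Suc (Suc i * (2 * (n * n * x)))"
  have X: "?X \<in> carrier_mat n n" and Y: "?Y \<in> carrier_mat n n"
    using smult_carrier_mat[OF pow_carrier_mat[OF carriers(1)]] smult_carrier_mat[OF carriers(2)] by blast+
  have "accept x i \<longleftrightarrow> (\<forall>t<?G ^ Suc x. map_mat (ev ?G t) ?X = map_mat (ev ?G t) ?Y)"
    unfolding accept_def codes eqpow_iff_ev ..
  also have "\<dots> \<longleftrightarrow> (\<forall>t<?G ^ Suc x. \<forall>j<n. \<forall>l<n. ev ?G t (?X $$ (j, l) - ?Y $$ (j, l)) = 0)"
  proof -
    have "map_mat (ev G t) ?X = map_mat (ev G t) ?Y \<longleftrightarrow>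
        (\<forall>j<n. \<forall>l<n. ev G t (?X $$ (j, l) - ?Y $$ (j, l)) = 0)" for G t
    proof -
      interpret comm_ring_hom "ev G t" by (rule ev_hom)
      have M: "map_mat (ev G t) Z $$ (j, l) = ev G t (Z $$ (j, l))"
        if "Z \<in> carrier_mat n n" "j < n" "l < n" for Z j l using that by simp
      show ?thesis
        unfolding mat_eq_iff[OF map_carrier_mat[THEN iffD2, OF X] map_carrier_mat[THEN iffD2, OF Y]]
        by (simp add: M[OF X] M[OF Y] hom_minus del: index_map_mat index_smult_mat)
    qed
    then show ?thesis by (simp only:)
  qed
  also have "\<dots> \<longleftrightarrow> (\<forall>j<n. \<forall>l<n. ?X $$ (j, l) - ?Y $$ (j, l) = 0)"
    using eq_0_iff_ev[OF deg_le_entries lessI] by blast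
  also have "\<dots> \<longleftrightarrow> ?X = ?Y" unfolding mat_eq_iff[OF X Y] by simp
  finally show ?thesis unfolding power_iff .
qed

lemma reject_sound:
  assumes rej: "reject x G t G' t' L u E"
  shows "mat_val n as ^\<^sub>m i \<noteq> mat_val n bs"
proof
  assume "mat_val n as ^\<^sub>m i = mat_val n bs"
  then have "eqpow n (val_den x G t) (val_A x G t) (val_B x G t) i" for G t
    unfolding power_iff eqpow_iff_ev by simp
  then have eq: "power_eq (val_den x G t) (fmat n (val_A x G t)) (fmat n (val_B x G t)) i" for G t
    unfolding eqpow_iff .
  have nz: "val_den x G t \<noteq> 0" "val_den x G' t' \<noteq> 0"
    and no: "\<And>i. i \<le> L \<Longrightarrow> \<not> power_eq (val_den x G' t') (fmat n (val_A x G' t')) (fmat n (val_B x G' t')) i"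
    using rej unfolding reject_def codes eqpow_iff by (auto simp: less_Suc_eq_le)
  have F: "fmat n h \<in> carrier_mat n n" for h by simp
  obtain C D where CD: "fraction_pair n (val_den x G t) (fmat n (val_A x G t)) (fmat n (val_B x G t)) C D"
    using fraction_pair_ex[OF nz(1) F[of "val_A x G t"] F[of "val_B x G t"]] by blast
  obtain C' D' where CD': "fraction_pair n (val_den x G' t') (fmat n (val_A x G' t')) (fmat n (val_B x G' t')) C' D'"
    using fraction_pair_ex[OF nz(2) F[of "val_A x G' t'"] F[of "val_B x G' t'"]] by blast
  have U: "mat 1 n (\<lambda>(_, q). int_decode (code_nth u q)) \<in> carrier_mat 1 n" by simp
  consider "cert1 n (val_den x G t) (fmat n (val_A x G t)) (fmat n (val_B x G t)) L"
    | "cert2 n (val_den x G t) (fmat n (val_A x G t)) (fmat n (val_B x G t)) L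
        (mat 1 n (\<lambda>(_, q). int_decode (code_nth u q))) E"
    | "cert3 (val_den x G' t') (fmat n (val_A x G' t')) L"
    using rej unfolding reject_def codes check1_iff check2_iff check3_iff by blast
  then show False
  proof cases
    case 1
    then show False using fraction_pair.cert1_sound[OF CD eq] no eq by blast
  next
    case 2
    then show False using fraction_pair.cert2_sound[OF CD eq _ U] no eq by blast
  next
    \<comment> \<open>The exponent is lowered at the second point itself; lowering it at the first
      point would say nothing about the exponents excluded here.\<close>
    case 3
    then show False using fraction_pair.cert3_sound[OF CD' eq] no by blast
  qed
qed

lemma reject_complete:
  assumes no: "\<And>i. mat_val n as ^\<^sub>m i \<noteq> mat_val n bs"
  shows "\<exists>G t G' t' L u E. reject x G t G' t' L u E"
proof -
  have F: "fmat n (f G t) \<in> carrier_mat n n" for f :: "nat \<Rightarrow> nat \<Rightarrow> nat \<Rightarrow> nat \<Rightarrow> int" and G t by simp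
  obtain G t G' t' L where nz: "val_den x G t \<noteq> 0" "val_den x G' t' \<noteq> 0"
    and cert: "cert1 n (val_den x G t) (fmat n (val_A x G t)) (fmat n (val_B x G t)) L \<or>
     (\<exists>U \<in> carrier_mat 1 n. \<exists>E. cert2 n (val_den x G t) (fmat n (val_A x G t)) (fmat n (val_B x G t)) L U E) \<or>
     cert3 (val_den x G' t') (fmat n (val_A x G' t')) L"
    and diff: "\<forall>i\<le>L. \<not> power_eq (val_den x G' t') (fmat n (val_A x G' t')) (fmat n (val_B x G' t')) i"
    using certificate_ex[OF carriers c_nonzero F[of "val_A x"] F[of "val_B x"] ev_c ev_a ev_b
        no[unfolded power_iff]] by blast
  have code: "\<exists>u. U = mat 1 n (\<lambda>(_, q). int_decode (code_nth u q))" if "U \<in> carrier_mat 1 n" for U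
  proof
    let ?xs = "map (\<lambda>q. int_encode (U $$ (0, q))) [0..<n]"
    show "U = mat 1 n (\<lambda>(_, q). int_decode (code_nth (list_encode ?xs) q))"
      using that by (intro eq_matI) (auto simp: code_nth_encode)
  qed
  have "\<exists>u E. check1 n (val_den x G t) (val_A x G t) (val_B x G t) L \<or>
      check2 n (val_den x G t) (val_A x G t) (val_B x G t) L (\<lambda>q. int_decode (code_nth u q)) E \<or>
      check3 n (val_den x G' t') (val_A x G' t') L"
    unfolding check1_iff check2_iff check3_iff using cert code by metis
  then show ?thesis
    using nz diff unfolding reject_def codes eqpow_iff less_Suc_eq_le by blast
qed

end

section \<open>The checker is primitive recursive\<close>

lemma computable2:
  assumes "computable (\<lambda>z. f (p1 z) (p2 z))" "computable a" "computable b"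
  shows "computable (\<lambda>x. f (a x) (b x))"
  using computable_comp[OF assms(1) computable_pair[OF assms(2,3)]] by simp

lemma computable_int2:
  assumes "computable_int (\<lambda>z. f (p1 z) (p2 z))" "computable a" "computable b"
  shows "computable_int (\<lambda>x. f (a x) (b x))"
  using computable_int_comp[OF assms(1) computable_pair[OF assms(2,3)]] by simp

lemma computable_int3:
  assumes "computable_int (\<lambda>z. f (p1 z) (p1 (p2 z)) (p2 (p2 z)))" "computable a" "computable b" "computable c"
  shows "computable_int (\<lambda>x. f (a x) (b x) (c x))"
  using computable_int_comp[OF assms(1) computable_pair[OF assms(2) computable_pair[OF assms(3,4)]]] by simp

lemma computable_int5:
  assumes "computable_int (\<lambda>z. f (p1 z) (p1 (p2 z)) (p1 (p2 (p2 z))) (p1 (p2 (p2 (p2 z)))) (p2 (p2 (p2 (p2 z)))))"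
    "computable a" "computable b" "computable c" "computable d" "computable e"
  shows "computable_int (\<lambda>x. f (a x) (b x) (c x) (d x) (e x))"
  using computable_int_comp[OF assms(1) computable_pair[OF assms(2) computable_pair[OF assms(3)
        computable_pair[OF assms(4) computable_pair[OF assms(5,6)]]]]] by simp

lemma computable_code_tl: "computable f \<Longrightarrow> computable (\<lambda>x. code_tl (f x))"
  unfolding code_tl_def by (intro computable_intros)

lemma computable_code_drop:
  assumes "computable c" "computable j"
  shows "computable (\<lambda>x. code_drop (c x) (j x))"
  unfolding code_drop_def by (intro computable_iter computable_code_tl computable_intros assms)

lemma computable_code_nth: "computable c \<Longrightarrow> computable j \<Longrightarrow> computable (\<lambda>x. code_nth (c x) (j x))"
  unfolding code_nth_def by (intro computable_code_drop computable_intros)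

lemma computable_code_len: "computable c \<Longrightarrow> computable (\<lambda>x. code_len (c x))"
proof (rule computable_comp[of code_len])
  show "computable code_len"
    unfolding code_len_def[abs_def] by (intro computable_code_drop computable_intros)
qed

lemma computable_exp_code: "computable G \<Longrightarrow> computable c \<Longrightarrow> computable (\<lambda>x. exp_code (G x) (c x))"
  by (rule computable2[of exp_code], unfold exp_code_def)
     (intro computable_code_nth computable_code_len computable_intros, assumption+)

lemma computable_eval_code:
  "computable G \<Longrightarrow> computable t \<Longrightarrow> computable c \<Longrightarrow> computable_int (\<lambda>x. eval_code (G x) (t x) (c x))"
  by (rule computable_int3[of eval_code], unfold eval_code_def)
     (intro computable_code_nth computable_code_len computable_exp_code computable_intros, assumption+)

lemmas code_intros = computable_code_nth computable_code_len computable_exp_code computable_eval_code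

lemma decides_nonzero_code: "computable c \<Longrightarrow> decides (\<lambda>x. nonzero_code (c x))"
proof (rule decides_comp[of nonzero_code])
  show "decides nonzero_code"
    unfolding nonzero_code_def[abs_def] by (intro code_intros computable_intros)
qed

lemma decides_vars_ok:
  assumes "decides (\<lambda>i. i \<in> I)" "computable c"
  shows "decides (\<lambda>x. vars_ok I (c x))"
proof (rule decides_comp[of "vars_ok I", OF _ assms(2)])
  show "decides (vars_ok I)"
    unfolding vars_ok_def[abs_def] by (intro decides_comp[OF assms(1)] code_intros computable_intros)
qed

lemma decides_mat_ok:
  assumes I: "decides (\<lambda>i. i \<in> I)" and n: "computable n" and c: "computable c"
  shows "decides (\<lambda>x. mat_ok I (n x) (c x))"
proof -
  have "decides (\<lambda>z. mat_ok I (p1 z) (p2 z))"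
    unfolding mat_ok_def
    by (intro decides_vars_ok[OF I] decides_nonzero_code code_intros computable_intros)
  from decides_comp[OF this computable_pair[OF n c]] show ?thesis by simp
qed

lemma computable_entry_code:
  "computable c \<Longrightarrow> computable n \<Longrightarrow> computable p \<Longrightarrow> computable (\<lambda>x. entry_code (c x) (n x) (p x))"
  unfolding entry_code_def by (intro code_intros computable_intros)

lemma computable_val_den:
  "computable x \<Longrightarrow> computable G \<Longrightarrow> computable t \<Longrightarrow> computable_int (\<lambda>y. val_den (x y) (G y) (t y))"
  by (rule computable_int3[of val_den], unfold val_den_def eval_den_def)
     (intro computable_entry_code code_intros computable_intros, assumption+)

lemma computable_val_A:
  "computable x \<Longrightarrow> computable G \<Longrightarrow> computable t \<Longrightarrow> computable j \<Longrightarrow> computable l \<Longrightarrow>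
    computable_int (\<lambda>y. val_A (x y) (G y) (t y) (j y) (l y))"
  by (rule computable_int5[of val_A], unfold val_A_def eval_num_def eval_den_def)
     (intro computable_entry_code code_intros computable_intros, assumption+)

lemma computable_val_B:
  "computable x \<Longrightarrow> computable G \<Longrightarrow> computable t \<Longrightarrow> computable j \<Longrightarrow> computable l \<Longrightarrow>
    computable_int (\<lambda>y. val_B (x y) (G y) (t y) (j y) (l y))"
  by (rule computable_int5[of val_B], unfold val_B_def eval_num_def eval_den_def)
     (intro computable_entry_code code_intros computable_intros, assumption+)

lemma computable_walks:
  assumes f: "computable_int (\<lambda>z. f (p1 z) (p1 (p2 z)) (p2 (p2 z)))"
    and n: "computable n" and i: "computable i" and j: "computable j" and l: "computable l"
  shows "computable_int (\<lambda>x. walks (n x) (f x) (i x) (j x) (l x))"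
  unfolding walks_def
  by (intro computable_int3[OF f] computable_comp[OF n] computable_comp[OF i] computable_comp[OF j]
      computable_comp[OF l] computable_intros)

context
  fixes f g :: "nat \<Rightarrow> nat \<Rightarrow> nat \<Rightarrow> int" and n :: "nat \<Rightarrow> nat" and d :: "nat \<Rightarrow> int"
  assumes f: "computable_int (\<lambda>z. f (p1 z) (p1 (p2 z)) (p2 (p2 z)))"
    and g: "computable_int (\<lambda>z. g (p1 z) (p1 (p2 z)) (p2 (p2 z)))"
    and n: "computable n" and d: "computable_int d"
begin

lemmas param_intros = computable_int3[OF f] computable_int3[OF g] computable_comp[OF n] computable_int_comp[OF d]

lemma decides_eqpow:
  assumes "computable i"
  shows "decides (\<lambda>x. eqpow (n x) (d x) (f x) (g x) (i x))"
  unfolding eqpow_def by (intro computable_walks param_intros computable_comp[OF assms] computable_intros)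

lemma decides_check1:
  assumes "computable L"
  shows "decides (\<lambda>x. check1 (n x) (d x) (f x) (g x) (L x))"
  unfolding check1_def by (intro computable_walks param_intros computable_comp[OF assms] computable_intros)

lemma decides_check2:
  assumes L: "computable L" and u: "computable_int (\<lambda>z. u (p1 z) (p2 z))" and E: "computable E"
  shows "decides (\<lambda>x. check2 (n x) (d x) (f x) (g x) (L x) (u x) (E x))"
  unfolding check2_def shift_entry_def
  by (intro computable_walks param_intros computable_comp[OF L] computable_comp[OF E] computable_int2[OF u]
      computable_intros)

end

lemma decides_check3:
  assumes f: "computable_int (\<lambda>z. f (p1 z) (p1 (p2 z)) (p2 (p2 z)))"
    and n: "computable n" and d: "computable_int d" and L: "computable L"
  shows "decides (\<lambda>x. check3 (n x) (d x) (f x) (L x))"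
  unfolding check3_def
  by (intro computable_walks computable_int3[OF f] computable_comp[OF n] computable_int_comp[OF d]
      computable_comp[OF L] computable_intros)

text \<open>Either every index is allowed or exactly those below the least missing one.
  \<open>I\<close> is fixed before the machine, so this case distinction may be made
  non-effectively, with the bound built in as a constant.\<close>

lemma decides_initial_segment:
  assumes "initial_segment I"
  shows "decides (\<lambda>i. i \<in> I)"
proof (cases "I = UNIV")
  case False
  then obtain k where "k \<notin> I" by blast
  define K where "K = (LEAST k. k \<notin> I)"
  have "K \<notin> I" unfolding K_def by (rule LeastI[of _ k]) fact
  have "i \<in> I \<longleftrightarrow> i < K" for i
    using assms \<open>K \<notin> I\<close> not_less_Least[of i "\<lambda>k. k \<notin> I"] unfolding initial_segment_def K_def[symmetric]
    by (metis linorder_neqE_nat)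
  then show ?thesis using decides_less[OF computable_id computable_const] by simp
qed (simp add: decides_const)

lemma decides_valid:
  assumes "initial_segment I"
  shows "decides (valid I)"
  unfolding valid_def[abs_def]
  by (intro decides_mat_ok[OF decides_initial_segment[OF assms]] computable_intros)

lemma decides_accept: "decides (\<lambda>z. accept (p1 z) (p2 z))"
  unfolding accept_def
  by (intro decides_all decides_eqpow computable_val_den computable_val_A computable_val_B computable_intros)

lemma decides_reject:
  "decides (\<lambda>z. reject (p1 z) (p1 (p2 z)) (p1 (p2 (p2 z))) (p1 (p2 (p2 (p2 z)))) (p1 (p2 (p2 (p2 (p2 z)))))
     (p1 (p2 (p2 (p2 (p2 (p2 z)))))) (p1 (p2 (p2 (p2 (p2 (p2 (p2 z))))))) (p2 (p2 (p2 (p2 (p2 (p2 (p2 z))))))))"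
  unfolding reject_def
  by (intro decides_conj decides_disj decides_all decides_not decides_int_eq decides_check1 decides_check2 decides_check3
      decides_eqpow computable_val_den computable_val_A computable_val_B computable_code_nth computable_intros)

theorem theorem1p6:
  fixes I :: "nat set"
  assumes "initial_segment I"
  shows "decidable {x. \<exists>n A B. n \<ge> 1 \<and> A \<in> matrices n I \<and> B \<in> matrices n I \<and>
           codes_instance I x n A B \<and> (\<exists>i::nat. A ^\<^sub>m i = B)}"
    (is "decidable ?S")
proof -
  let ?reject = "\<lambda>z. reject (p1 z) (p1 (p2 z)) (p1 (p2 (p2 z))) (p1 (p2 (p2 (p2 z)))) (p1 (p2 (p2 (p2 (p2 z)))))
     (p1 (p2 (p2 (p2 (p2 (p2 z)))))) (p1 (p2 (p2 (p2 (p2 (p2 (p2 z))))))) (p2 (p2 (p2 (p2 (p2 (p2 (p2 z)))))))"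
  \<comment> \<open>The same \<open>w\<close> is tried as an exponent and as the code of a refusal.
    Numbers that code no instance are refused at once, which keeps the search finite on
    them.\<close>
  define f :: "nat \<Rightarrow> nat" where "f z = (if valid I (p1 z) then if accept (p1 z) (p2 z) then 2 else if ?reject z then 1 else 0 else 1)"
    for z
  \<comment> \<open>By surjectivity of \<open>mat_code\<close> expressions with these codes exist,
    and the arithmetical check \<open>mat_ok\<close> shows that they are well-formed.\<close>
  have inst: "\<exists>n as bs. encoded_instance I x n as bs" if v: "valid I x" for x
  proof -
    obtain as bs where c: "mat_code as = p1 (p2 x)" "mat_code bs = p2 (p2 x)"
      using surj_mat_code by (metis surjD)
    then have "encoded_instance I x (p1 x) as bs"
      using v by unfold_locales (auto simp: valid_def mat_ok[symmetric])
    then show ?thesis by blast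
  qed
  have S_iff: "x \<in> ?S \<longleftrightarrow> (\<exists>i. mat_val n as ^\<^sub>m i = mat_val n bs)" if "encoded_instance I x n as bs" for x n as bs
  proof -
    interpret encoded_instance I x n as bs by fact
    have code: "codes_instance I x n (mat_val n as) (mat_val n bs)"
      unfolding codes_instance_def using as bs x by blast
    show ?thesis
    proof
      assume "x \<in> ?S"
      then obtain m A B where AB: "codes_instance I x m A B" "\<exists>i. A ^\<^sub>m i = B" by blast
      note unique = codes_instance_unique[OF code AB(1), THEN conjunct2]
      show "\<exists>i. mat_val n as ^\<^sub>m i = mat_val n bs"
        using AB(2) unfolding conjunct1[OF unique] conjunct2[OF unique] .
    next
      assume i: "\<exists>i. mat_val n as ^\<^sub>m i = mat_val n bs"
      note mats = codes_instance_in[OF code]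
      have "1 \<le> n" using n by simp
      then show "x \<in> ?S"
        by (intro CollectI exI[of _ n] exI[of _ "mat_val n as"] exI[of _ "mat_val n bs"] conjI
            conjunct1[OF mats] conjunct2[OF mats] code i)
    qed
  qed
  have valid: "valid I x" if S: "x \<in> ?S" for x
  proof -
    obtain n A B where nAB: "1 \<le> n" "codes_instance I x n A B" using S by blast
    then obtain as bs where "mat_expr_ok n I as" "mat_expr_ok n I bs"
      "x = prod_encode (n, prod_encode (mat_code as, mat_code bs))"
      unfolding codes_instance_def by blast
    then show ?thesis using nAB(1) by (simp add: valid_def mat_ok)
  qed
  show ?thesis
  proof (rule decidable_search[of f])
    show "computable f"
      unfolding f_def[abs_def]
      by (intro computable_if computable_const decides_accept decides_reject
          decides_comp[OF decides_valid[OF assms]] computable_fst)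
  next
    fix x
    show "\<exists>w. f (prod_encode (x, w)) \<noteq> 0"
    proof (cases "valid I x")
      case True
      then obtain n as bs where "encoded_instance I x n as bs" using inst by blast
      then interpret encoded_instance I x n as bs .
      show ?thesis
      proof (cases "\<exists>i. mat_val n as ^\<^sub>m i = mat_val n bs")
        case True
        then obtain i where "accept x i" using accept_iff by blast
        then show ?thesis by (intro exI[of _ i]) (simp add: f_def)
      next
        case False
        then obtain G t G' t' L u E where "reject x G t G' t' L u E" using reject_complete by blast
        then show ?thesis
          by (intro exI[of _ "prod_encode (G, prod_encode (t, prod_encode (G', prod_encode (t',
                prod_encode (L, prod_encode (u, E))))))"]) (simp add: f_def)
      qed
    qed (simp add: f_def)
  next
    fix x w
    assume f: "f (prod_encode (x, w)) = 1"
    show "x \<notin> ?S"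
    proof
      assume S: "x \<in> ?S"
      then obtain n as bs where "encoded_instance I x n as bs" using inst valid by blast
      then interpret encoded_instance I x n as bs .
      have "?reject (prod_encode (x, w))" using f valid[OF S] by (simp add: f_def split: if_splits)
      then have "mat_val n as ^\<^sub>m i \<noteq> mat_val n bs" for i using reject_sound by simp
      then show False using S S_iff[OF encoded_instance_axioms] by blast
    qed
  next
    fix x w
    assume f: "1 < f (prod_encode (x, w))"
    then have v: "valid I x" and acc: "accept x w" by (auto simp: f_def split: if_splits)
    then obtain n as bs where "encoded_instance I x n as bs" using inst by blast
    then interpret encoded_instance I x n as bs .
    show "x \<in> ?S" using acc S_iff[OF encoded_instance_axioms] accept_iff by blast
  qed
qed

end
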